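(* Let $G$ be a connected finite bipartite graph with color classes $E$ and $V$, and let $h$ be the $h$-vector of an arbitrary triangulation of the root polytope $Q_G$. Then the interior polynomial $I$ of either hypergraph induced by $G$ (i.e. of $(V,E)$ and of $(E,V)$) satisfies \[ I(x)=x^{|E|+|V|-1}\,h(x^{-1}). \]
   Context: A bipartite graph has no multiple edges; every edge joins an element of $E$ to an element of $V$. The hypergraph $(V,E)$ induced by $G$ has vertex set $V$ and one hyperedge for each $e\in E$ (namely the set of neighbours of $e$); the hypergraph $(E,V)$ is defined symmetrically with the roles of $E$ and $V$ swapped. A hypertree of $(V,E)$ is a function $\mathbf f\colon E\to\mathbf N=\{0,1,2,\dots\}$ such that some spanning tree of $G$ has degree $\mathbf f(e)+1$ at every $e\in E$; let $B_{(V,E)}$ be the set of hypertrees. Fix a linear order on $E$. For a hypertree $\mathbf f$, a hyperedge $e$ is internally active if there is no $e'<e$ such that the function obtained from $\mathbf f$ by decreasing $\mathbf f(e)$ by $1$ and increasing $\mathbf f(e')$ by $1$ is again a hypertree; let $\bar\iota(\mathbf f)$ be the number of hyperedges that are not internally active. The interior polynomial is $I_{(V,E)}(\xi)=\sum_{\mathbf f\in B_{(V,E)}}\xi^{\bar\iota(\mathbf f)}$ (for any fixed order on $E$); $I_{(E,V)}$ is defined the same way with $E$ and $V$ interchanged. The root polytope $Q_G\subset\mathbf R^E\oplus\mathbf R^V$ is the convex hull of the vectors $\mathbf i_{\{e\}}+\mathbf i_{\{v\}}$ over all edges $ev$ of $G$ ($\mathbf i_S$ denotes an indicator vector); since $G$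 is connected, $\dim Q_G=|E|+|V|-2$. A triangulation of $Q_G$ is a collection of $(\dim Q_G)$-dimensional simplices, each spanned by vertices of $Q_G$, any two of which intersect in a common face, whose union is $Q_G$; it is viewed as the simplicial complex of all faces of these simplices. For a $d$-dimensional simplicial complex, the $f$-vector is $f(y)=y^{d+1}+f_0y^d+f_1y^{d-1}+\cdots+f_{d-1}y+f_d$, where $f_k$ is the number of $k$-dimensional simplices, and the $h$-vector is $h(x)=f(x-1)$. *)

theory Defs
  imports "HOL-Analysis.Analysis"
begin

text \<open>A finite bipartite graph with colour classes E = UNIV::'e set and V = UNIV::'v set
  is given by its edge set G (no multiple edges, every edge joins E to V).\<close>

definition node_adj :: "('e \<times> 'v) set \<Rightarrow> (('e + 'v) \<times> ('e + 'v)) set" where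
  "node_adj F = {(Inl e, Inr v) | e v. (e, v) \<in> F} \<union> {(Inr v, Inl e) | e v. (e, v) \<in> F}"

text \<open>The spanning subgraph with edge set F (on all vertices E + V) is connected.\<close>
definition bg_connected :: "('e::finite \<times> 'v::finite) set \<Rightarrow> bool" where
  "bg_connected F \<longleftrightarrow> (\<forall>a b. (a, b) \<in> (node_adj F)\<^sup>*)"

text \<open>Spanning tree: connected spanning subgraph with |E|+|V|-1 edges.\<close>
definition spanning_tree :: "('e::finite \<times> 'v::finite) set \<Rightarrow> ('e \<times> 'v) set \<Rightarrow> bool" where
  "spanning_tree G F \<longleftrightarrow> F \<subseteq> G \<and> bg_connected F \<and> card F + 1 = CARD('e) + CARD('v)"

text \<open>Hypertrees of the hypergraph (V,E) (hyperedges indexed by E).\<close>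
definition hypertrees :: "('e::finite \<times> 'v::finite) set \<Rightarrow> ('e \<Rightarrow> nat) set" where
  "hypertrees G = {f. \<exists>F. spanning_tree G F \<and> (\<forall>e. card {v. (e, v) \<in> F} = f e + 1)}"

text \<open>Internal activity w.r.t. the linear order on E given by the type class.\<close>
definition internally_active :: "('e::{finite,linorder} \<times> 'v::finite) set \<Rightarrow> ('e \<Rightarrow> nat) \<Rightarrow> 'e \<Rightarrow> bool" where
  "internally_active G f e \<longleftrightarrow>
     \<not> (\<exists>e'. e' < e \<and> 0 < f e \<and> (f(e := f e - 1))(e' := f e' + 1) \<in> hypertrees G)"

definition internal_inactivity :: "('e::{finite,linorder} \<times> 'v::finite) set \<Rightarrow> ('e \<Rightarrow> nat) \<Rightarrow> nat" where
  "internal_inactivity G f = card {e. \<not> internally_active G f e}"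

text \<open>Interior polynomial of (V,E); that of (E,V) is interior_poly (prod.swap ` G).\<close>
definition interior_poly :: "('e::{finite,linorder} \<times> 'v::finite) set \<Rightarrow> real \<Rightarrow> real" where
  "interior_poly G \<xi> = (\<Sum>f\<in>hypertrees G. \<xi> ^ internal_inactivity G f)"

text \<open>Root polytope in R^E (+) R^V, realised as real^('e+'v).\<close>
definition rp_point :: "('e::finite \<times> 'v::finite) \<Rightarrow> real ^ ('e + 'v)" where
  "rp_point ev = axis (Inl (fst ev)) 1 + axis (Inr (snd ev)) 1"

definition root_polytope :: "('e::finite \<times> 'v::finite) set \<Rightarrow> (real ^ ('e + 'v)) set" where
  "root_polytope G = convex hull (rp_point ` G)"

text \<open>A triangulation is given by the vertex sets (sets of edges of G) of its maximal simplices.\<close>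
definition is_triangulation :: "('e::finite \<times> 'v::finite) set \<Rightarrow> ('e \<times> 'v) set set \<Rightarrow> bool" where
  "is_triangulation G T \<longleftrightarrow>
     (\<forall>S\<in>T. S \<subseteq> G \<and> \<not> affine_dependent (rp_point ` S) \<and>
             aff_dim (convex hull (rp_point ` S)) = aff_dim (root_polytope G)) \<and>
     (\<forall>S\<in>T. \<forall>S'\<in>T.
        (convex hull (rp_point ` S) \<inter> convex hull (rp_point ` S')) face_of convex hull (rp_point ` S) \<and>
        (convex hull (rp_point ` S) \<inter> convex hull (rp_point ` S')) face_of convex hull (rp_point ` S')) \<and>
     \<Union> ((\<lambda>S. convex hull (rp_point ` S)) ` T) = root_polytope G"

text \<open>Faces of the simplicial complex (as vertex sets); a k-simplex has k+1 vertices.\<close>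
definition num_faces :: "'a set set \<Rightarrow> nat \<Rightarrow> nat" where
  "num_faces T k = card {F. (\<exists>S\<in>T. F \<subseteq> S) \<and> card F = k + 1}"

text \<open>f-vector of a d-dimensional complex, and h(x) = f(x-1).\<close>
definition f_vector :: "'a set set \<Rightarrow> nat \<Rightarrow> real \<Rightarrow> real" where
  "f_vector T d y = y ^ (d + 1) + (\<Sum>k\<le>d. real (num_faces T k) * y ^ (d - k))"

definition h_vector :: "'a set set \<Rightarrow> nat \<Rightarrow> real \<Rightarrow> real" where
  "h_vector T d x = f_vector T d (x - 1)"

end

theory Submission
  imports Defs
begin

text \<open>
  Both sides are computed from the generating function of the lattice points of the cone over the
  root polytope, graded by height. Any triangulation is unimodular, so each lattice point is a
  unique positive integer combination of the vertices of one face, and the generating function is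
  the sum of \<open>(x / (1 - x)) ^ card F\<close> over the faces \<open>F\<close>. This is the right-hand side divided
  by \<open>(1 - x) ^ (d + 1)\<close>, and it is symmetric in the two colour classes.

  For the hypertree side, join a new left node to all right nodes and triangulate the cone over the
  larger graph by the supports of lexicographically minimal flows. The trees \<open>S\<close> in it correspond to
  the vectors \<open>g\<close> lying below some hypertree. After a fixed generic shift using the new
  node, every lattice point lies in the interior of exactly one of these trees, and the lattice
  points in the tree of \<open>g\<close> are the nonnegative integer flows on it that are positive on one
  prescribed edge at each node where \<open>g\<close> is positive. Finally, by the exchange
  property, each \<open>g\<close> arises from exactly one hypertree by decreasing it on internally active
  hyperedges, and the contributions of these \<open>g\<close> add up to \<open>x\<close> to the number of inactive hyperedges.
\<close>

section \<open>Flows and cuts in bipartite graphs\<close>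

text \<open>The shift decides which facets of a tree's cone are excluded. If nearly all of its left
  mass sits at one left node, then at every other left node of degree at least 2 exactly one edge,
  the one towards that root, is excluded, so the count depends on the degrees alone. Such a shift
  stays inside the cone only if the root can serve every right node, and G need not contain a left
  node adjacent to all of them; hence the added one. Lattice points have coordinate 0 there, so its
  edges carry no coefficient and the larger graph still enumerates the cone over G. The price is
  that its hypertrees are not those of G but the vectors below them, which the cells of internal
  activity then regroup. Both enumerations are series at a real x with 0 < x < 1; sums over the same
  set have one value, and infinitely many x make the polynomials equal.\<close>

declare split_paired_All [simp del] split_paired_Ex [simp del]

definition marg :: "('a::finite \<times> 'b::finite \<Rightarrow> 'r::comm_monoid_add) \<Rightarrow> 'a + 'b \<Rightarrow> 'r" where
  "marg l x = (case x of Inl a \<Rightarrow> (\<Sum>b\<in>UNIV. l (a, b)) | Inr b \<Rightarrow> (\<Sum>a\<in>UNIV. l (a, b)))"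

definition side :: "'a + 'b \<Rightarrow> real" where
  "side x = (case x of Inl a \<Rightarrow> 1 | Inr b \<Rightarrow> -1)"

text \<open>Left total minus right total over K. For the marginals of a flow this is the net flow
  across the boundary of K.\<close>

definition cutsum :: "('a::finite + 'b::finite \<Rightarrow> real) \<Rightarrow> ('a + 'b) set \<Rightarrow> real" where
  "cutsum p K = (\<Sum>x\<in>K. side x * p x)"

text \<open>K is a union of connected components of the graph with edge set F.\<close>

definition edge_closed :: "('a \<times> 'b) set \<Rightarrow> ('a + 'b) set \<Rightarrow> bool" where
  "edge_closed F K \<longleftrightarrow> (\<forall>(a, b)\<in>F. Inl a \<in> K \<longleftrightarrow> Inr b \<in> K)"

abbreviation supported :: "('i \<Rightarrow> 'r::zero) \<Rightarrow> 'i set \<Rightarrow> bool" where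
  "supported l F \<equiv> (\<forall>\<epsilon>. \<epsilon> \<notin> F \<longrightarrow> l \<epsilon> = 0)"

abbreviation degL :: "('a \<times> 'b) set \<Rightarrow> 'a \<Rightarrow> nat" where
  "degL F a \<equiv> card {b. (a, b) \<in> F}"

lemma marg_simps [simp]:
  "marg l (Inl a) = (\<Sum>b\<in>UNIV. l (a, b))" "marg l (Inr b) = (\<Sum>a\<in>UNIV. l (a, b))"
  by (simp_all add: marg_def)

lemma side_simps [simp]: "side (Inl a) = 1" "side (Inr b) = -1"
  by (simp_all add: side_def)

lemma side_mult_self [simp]: "side x * side x = 1"
  by (cases x) auto

lemma sum_UNIV_sum:
  fixes h :: "'a::finite + 'b::finite \<Rightarrow> 'r::comm_monoid_add"
  shows "(\<Sum>x\<in>UNIV. h x) = (\<Sum>a\<in>UNIV. h (Inl a)) + (\<Sum>b\<in>UNIV. h (Inr b))"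
  by (simp add: UNIV_Plus_UNIV [symmetric] sum.Plus del: UNIV_Plus_UNIV)

lemma sum_UNIV_prod:
  fixes h :: "'a::finite \<times> 'b::finite \<Rightarrow> 'r::comm_monoid_add"
  shows "(\<Sum>x\<in>UNIV. h x) = (\<Sum>a\<in>UNIV. \<Sum>b\<in>UNIV. h (a, b))"
  by (simp add: UNIV_Times_UNIV [symmetric] sum.cartesian_product del: UNIV_Times_UNIV)

lemma cutsum_alt: "cutsum p K = (\<Sum>x\<in>UNIV. of_bool (x \<in> K) * (side x * p x))"
proof -
  have "(\<Sum>x\<in>UNIV. of_bool (x \<in> K) * (side x * p x)) = (\<Sum>x\<in>UNIV. if x \<in> K then side x * p x else 0)"
    by (rule sum.cong) auto
  also have "\<dots> = cutsum p K"
    by (simp add: cutsum_def sum.If_cases)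
  finally show ?thesis by simp
qed

lemma cutsum_Plus:
  "cutsum p K = (\<Sum>a\<in>{a. Inl a \<in> K}. p (Inl a)) - (\<Sum>b\<in>{b. Inr b \<in> K}. p (Inr b))"
proof -
  have *: "(\<Sum>a\<in>UNIV. of_bool (P a) * h a) = (\<Sum>a\<in>{a. P a}. h a)"
    for P :: "'c::finite \<Rightarrow> bool" and h :: "'c \<Rightarrow> real"
  proof -
    have "(\<Sum>a\<in>UNIV. of_bool (P a) * h a) = (\<Sum>a\<in>UNIV. if P a then h a else 0)"
      by (rule sum.cong) auto
    then show ?thesis by (simp add: sum.If_cases)
  qed
  show ?thesis
    unfolding cutsum_alt sum_UNIV_sum by (simp add: * sum_negf)
qed

text \<open>An edge with both ends in K is counted at both with opposite signs and cancels.\<close>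

lemma cutsum_marg:
  "cutsum (marg l) K = (\<Sum>\<epsilon>\<in>UNIV. l \<epsilon> * (of_bool (Inl (fst \<epsilon>) \<in> K) - of_bool (Inr (snd \<epsilon>) \<in> K)))"
proof -
  have "cutsum (marg l) K = (\<Sum>a\<in>UNIV. \<Sum>b\<in>UNIV. of_bool (Inl a \<in> K) * l (a, b))
      - (\<Sum>b\<in>UNIV. \<Sum>a\<in>UNIV. of_bool (Inr b \<in> K) * l (a, b))"
    unfolding cutsum_alt sum_UNIV_sum by (simp add: sum_distrib_left sum_negf)
  also have "(\<Sum>b\<in>UNIV. \<Sum>a\<in>UNIV. of_bool (Inr b \<in> K) * l (a, b)) =
      (\<Sum>a\<in>UNIV. \<Sum>b\<in>UNIV. of_bool (Inr b \<in> K) * l (a, b))"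
    by (rule sum.swap)
  finally show ?thesis
    unfolding sum_UNIV_prod by (simp add: sum_subtractf algebra_simps)
qed

lemma cutsum_Compl: "cutsum p (- K) = cutsum p UNIV - cutsum p K"
proof -
  have "cutsum p UNIV = (\<Sum>x\<in>K \<union> - K. side x * p x)"
    by (simp add: cutsum_def)
  also have "\<dots> = cutsum p K + cutsum p (- K)"
    unfolding cutsum_def by (rule sum.union_disjoint) auto
  finally show ?thesis by simp
qed

lemma cutsum_marg_UNIV [simp]: "cutsum (marg l) UNIV = 0"
  by (simp add: cutsum_marg)

lemma edge_closed_Compl [simp]: "edge_closed F (- K) \<longleftrightarrow> edge_closed F K"
  by (auto simp: edge_closed_def)

lemma cutsum_edge_closed:
  assumes "edge_closed F K" "supported l F"
  shows "cutsum (marg l) K = 0"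
  unfolding cutsum_marg
proof (rule sum.neutral, intro ballI)
  fix \<epsilon> :: "'a \<times> 'b"
  obtain a b where \<epsilon>: "\<epsilon> = (a, b)" by (cases \<epsilon>)
  show "l \<epsilon> * (of_bool (Inl (fst \<epsilon>) \<in> K) - of_bool (Inr (snd \<epsilon>) \<in> K)) = 0"
    using assms by (cases "\<epsilon> \<in> F") (auto simp: \<epsilon> edge_closed_def)
qed

text \<open>The only edge of F that can cross K is (a, b).\<close>

lemma cutsum_cut:
  assumes "edge_closed (F - {(a, b)}) K" "supported l F" "Inl a \<in> K" "Inr b \<notin> K"
  shows "cutsum (marg l) K = l (a, b)"
proof -
  have "cutsum (marg l) K = (\<Sum>\<epsilon>\<in>{(a, b)}. l \<epsilon> * (of_bool (Inl (fst \<epsilon>) \<in> K) - of_bool (Inr (snd \<epsilon>) \<in> K)))"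
    unfolding cutsum_marg
  proof (rule sum.mono_neutral_right, goal_cases)
    case 3
    show ?case
    proof
      fix \<epsilon> assume \<epsilon>: "\<epsilon> \<in> UNIV - {(a, b)}"
      obtain c d where cd: "\<epsilon> = (c, d)" by (cases \<epsilon>)
      show "l \<epsilon> * (of_bool (Inl (fst \<epsilon>) \<in> K) - of_bool (Inr (snd \<epsilon>) \<in> K)) = 0"
        using assms(1,2) \<epsilon> by (cases "\<epsilon> \<in> F") (auto simp: cd edge_closed_def)
    qed
  qed auto
  then show ?thesis using assms by simp
qed

text \<open>The set reachable from a node is closed, and a closed set contains everything reachable
  from its nodes. This form of connectivity combines with \<open>cutsum\<close>.\<close>

lemma bg_connected_iff_edge_closed:
  "bg_connected F \<longleftrightarrow> (\<forall>K. edge_closed F K \<longrightarrow> K = {} \<or> K = UNIV)"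
proof
  assume c: "bg_connected F"
  show "\<forall>K. edge_closed F K \<longrightarrow> K = {} \<or> K = UNIV"
  proof (intro allI impI)
    fix K assume K: "edge_closed F K"
    show "K = {} \<or> K = UNIV"
    proof (rule disjCI)
      assume "K \<noteq> UNIV"
      then obtain y where y: "y \<notin> K" by blast
      have "y \<in> K" if "x \<in> K" for x
      proof -
        have "(x, y) \<in> (node_adj F)\<^sup>*" using c by (simp add: bg_connected_def)
        then show ?thesis
          by (induction rule: rtrancl_induct)
            (use that K in \<open>auto simp: node_adj_def edge_closed_def\<close>)
      qed
      with y show "K = {}" by blast
    qed
  qed
next
  assume c: "\<forall>K. edge_closed F K \<longrightarrow> K = {} \<or> K = UNIV"
  show "bg_connected F"
    unfolding bg_connected_def
  proof (intro allI)
    fix x y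
    let ?K = "{y. (x, y) \<in> (node_adj F)\<^sup>*}"
    have 1: "(Inl a, Inr b) \<in> node_adj F" "(Inr b, Inl a) \<in> node_adj F" if "(a, b) \<in> F" for a b
      using that by (auto simp: node_adj_def)
    have "edge_closed F ?K"
      unfolding edge_closed_def by (auto intro: rtrancl_into_rtrancl 1)
    with c have "?K = {} \<or> ?K = UNIV" by blast
    then show "(x, y) \<in> (node_adj F)\<^sup>*" by blast
  qed
qed

lemma edge_closed_connected:
  "bg_connected F \<Longrightarrow> edge_closed F K \<Longrightarrow> x \<in> K \<Longrightarrow> K = UNIV"
  unfolding bg_connected_iff_edge_closed by blast

lemma connected_neighbour_ex:
  fixes F :: "('a::finite \<times> 'b::finite) set"
  assumes "bg_connected F"
  shows "\<exists>b. (a, b) \<in> F"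
proof (rule ccontr)
  assume "\<nexists>b. (a, b) \<in> F"
  then have "edge_closed F {Inl a}" by (auto simp: edge_closed_def)
  with assms have "{Inl a :: 'a + 'b} = UNIV"
    by (rule edge_closed_connected) simp
  moreover have "(Inr undefined :: 'a + 'b) \<notin> {Inl a}" by simp
  ultimately show False by blast
qed

lemma connected_degL_pos:
  fixes F :: "('a::finite \<times> 'b::finite) set"
  shows "bg_connected F \<Longrightarrow> 0 < degL F a"
  using connected_neighbour_ex[of F a] by (auto simp: card_gt_0_iff)

lemma sum_degL:
  fixes F :: "('a::finite \<times> 'b::finite) set"
  shows "(\<Sum>a\<in>UNIV. degL F a) = card F"
proof -
  have "card (SIGMA a:UNIV. {b. (a, b) \<in> F}) = (\<Sum>a\<in>UNIV. degL F a)"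
    by (rule card_SigmaI) auto
  moreover have "(SIGMA a:UNIV. {b. (a, b) \<in> F}) = F" by auto
  ultimately show ?thesis by simp
qed

section \<open>Edge vectors of the root polytope and flows\<close>

definition flow_vec :: "('a::finite + 'b::finite \<Rightarrow> real) \<Rightarrow> real ^ ('a + 'b)" where
  "flow_vec p = (\<chi> x. p x)"

lemma flow_vec_nth [simp]: "flow_vec p $ x = p x"
  by (simp add: flow_vec_def)

lemma rp_point_nth:
  "rp_point (a, b) $ Inl a' = of_bool (a' = a)" "rp_point (a, b) $ Inr b' = of_bool (b' = b)"
  by (auto simp: rp_point_def axis_def)

text \<open>The values of a flow are the coefficients of a linear combination of the vertices of the
  root polytope.\<close>

lemma flow_vec_marg:
  "flow_vec (marg l) = (\<Sum>\<epsilon>\<in>UNIV. l \<epsilon> *\<^sub>R rp_point \<epsilon>)"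
proof (rule vec_eq_iff[THEN iffD2], rule allI)
  fix x :: "'a + 'b"
  have *: "(\<Sum>a'\<in>UNIV. h a' * of_bool (a = a')) = h a" for a :: "'c::finite" and h :: "'c \<Rightarrow> real"
  proof -
    have "(\<Sum>a'\<in>UNIV. h a' * of_bool (a = a')) = (\<Sum>a'\<in>UNIV. if a = a' then h a' else 0)"
      by (rule sum.cong) auto
    then show ?thesis by simp
  qed
  show "flow_vec (marg l) $ x = (\<Sum>\<epsilon>\<in>UNIV. l \<epsilon> *\<^sub>R rp_point \<epsilon>) $ x"
  proof (cases x)
    case (Inl a)
    have "(\<Sum>\<epsilon>\<in>UNIV. l \<epsilon> *\<^sub>R rp_point \<epsilon>) $ x = (\<Sum>b\<in>UNIV. \<Sum>a'\<in>UNIV. l (a', b) * of_bool (a = a'))"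
      unfolding Inl sum_UNIV_prod by (subst sum.swap) (simp add: rp_point_nth)
    then show ?thesis by (simp add: Inl *)
  next
    case (Inr b)
    have "(\<Sum>\<epsilon>\<in>UNIV. l \<epsilon> *\<^sub>R rp_point \<epsilon>) $ x = (\<Sum>a\<in>UNIV. \<Sum>b'\<in>UNIV. l (a, b') * of_bool (b = b'))"
      unfolding Inr sum_UNIV_prod by (simp add: rp_point_nth)
    then show ?thesis by (simp add: Inr *)
  qed
qed

lemma inj_rp_point: "inj (rp_point :: 'a::finite \<times> 'b::finite \<Rightarrow> _)"
proof (rule injI)
  fix \<epsilon> \<eta> :: "'a \<times> 'b"
  assume eq: "rp_point \<epsilon> = rp_point \<eta>"
  obtain a b c d where [simp]: "\<epsilon> = (a, b)" "\<eta> = (c, d)" by (metis surj_pair)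
  from arg_cong[OF eq, of "\<lambda>z. z $ Inl a"] arg_cong[OF eq, of "\<lambda>z. z $ Inr b"]
  show "\<epsilon> = \<eta>" by (auto simp: rp_point_nth split: if_splits)
qed

lemma sum_rp_point_supported:
  assumes "supported l F"
  shows "flow_vec (marg l) = (\<Sum>\<epsilon>\<in>F. l \<epsilon> *\<^sub>R rp_point \<epsilon>)"
  unfolding flow_vec_marg by (rule sum.mono_neutral_right) (use assms in auto)

lemma marg_add: "marg (\<lambda>\<epsilon>. l \<epsilon> + k \<epsilon>) x = marg l x + marg k x"
  by (cases x) (simp_all add: sum.distrib)

lemma marg_diff:
  fixes l :: "_ \<Rightarrow> 'r::ab_group_add"
  shows "marg (\<lambda>\<epsilon>. l \<epsilon> - k \<epsilon>) x = marg l x - marg k x"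
  by (cases x) (simp_all add: sum_subtractf)

lemma marg_cmult:
  fixes l :: "_ \<Rightarrow> real"
  shows "marg (\<lambda>\<epsilon>. c * l \<epsilon>) x = c * marg l x"
  by (cases x) (simp_all add: sum_distrib_left)

lemma marg_of_nat: "marg (\<lambda>\<epsilon>. real (m \<epsilon>)) x = real (marg m x)"
  by (cases x) simp_all

text \<open>A unit can be routed from any node to a fixed node r along edges of F, and p is a
  combination of such routings because its total defect at r vanishes.\<close>

lemma connected_flow_ex:
  fixes F :: "('a::finite \<times> 'b::finite) set" and p :: "'a + 'b \<Rightarrow> real"
  assumes conn: "bg_connected F" and bal: "cutsum p UNIV = 0"
  shows "\<exists>l. supported l F \<and> marg l = p"
proof -
  define R where "R = {p. \<exists>l::_ \<Rightarrow> real. supported l F \<and> marg l = p}"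
  define u :: "'a + 'b \<Rightarrow> 'a + 'b \<Rightarrow> real" where "u x y = of_bool (y = x)" for x y
  define r :: "'a + 'b" where "r = undefined"
  \<comment> \<open>Modulo R an edge turns \<open>u (Inl a)\<close> into minus
    \<open>u (Inr b)\<close>, so the coefficient at the arbitrary base node r carries the sign
    \<open>side x * side r\<close>.\<close>
  define K where "K = {x. (\<lambda>y. u x y - side x * side r * u r y) \<in> R}"
  have add: "(\<lambda>y. p y + q y) \<in> R" if "p \<in> R" "q \<in> R" for p q
  proof -
    obtain l k where "supported l F" "marg l = p" "supported k F" "marg k = q"
      using \<open>p \<in> R\<close> \<open>q \<in> R\<close> unfolding R_def by blast
    then have "supported (\<lambda>\<epsilon>. l \<epsilon> + k \<epsilon>) F \<and> marg (\<lambda>\<epsilon>. l \<epsilon> + k \<epsilon>) = (\<lambda>y. p y + q y)"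
      by (auto simp: marg_add)
    then show ?thesis unfolding R_def by (intro CollectI exI) 
  qed
  have scale: "(\<lambda>y. c * p y) \<in> R" if "p \<in> R" for p c
  proof -
    obtain l where "supported l F" "marg l = p"
      using \<open>p \<in> R\<close> unfolding R_def by blast
    then have "supported (\<lambda>\<epsilon>. c * l \<epsilon>) F \<and> marg (\<lambda>\<epsilon>. c * l \<epsilon>) = (\<lambda>y. c * p y)"
      by (auto simp: marg_cmult)
    then show ?thesis unfolding R_def by (intro CollectI exI) 
  qed
  have zero: "(\<lambda>y. 0) \<in> R"
    unfolding R_def by (intro CollectI exI[of _ "\<lambda>\<epsilon>. 0"]) (auto simp: marg_def fun_eq_iff split: sum.split)
  have edge: "(\<lambda>y. u (Inl a) y + u (Inr b) y) \<in> R" if "(a, b) \<in> F" for a b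
  proof -
    have s: "(\<Sum>b'\<in>UNIV. of_bool (c = a \<and> b' = b)) = (of_bool (c = a) :: real)" for c
      by (cases "c = a") auto
    have t: "(\<Sum>c\<in>UNIV. of_bool (c = a \<and> d = b)) = (of_bool (d = b) :: real)" for d
      by (cases "d = b") auto
    have "marg (\<lambda>\<epsilon>. of_bool (\<epsilon> = (a, b)) :: real) y = u (Inl a) y + u (Inr b) y" for y
      by (cases y) (auto simp: u_def s t)
    then show ?thesis
      unfolding R_def by (intro CollectI exI[of _ "\<lambda>\<epsilon>. of_bool (\<epsilon> = (a, b))"]) (use that in auto)
  qed
  have "edge_closed F K"
    unfolding edge_closed_def
  proof (clarify)
    fix a b assume ab: "(a, b) \<in> F"
    have "(\<lambda>y. u (Inr b) y - side (Inr b) * side r * u r y) \<in> R"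
      if "(\<lambda>y. u (Inl a) y - side (Inl a) * side r * u r y) \<in> R"
    proof -
      have "(\<lambda>y. (u (Inl a) y + u (Inr b) y) + (-1) * (u (Inl a) y - side (Inl a) * side r * u r y)) \<in> R"
        using add [OF edge [OF ab] scale [OF that, where c = "-1"]] by simp
      then show ?thesis by (simp add: algebra_simps)
    qed
    moreover have "(\<lambda>y. u (Inl a) y - side (Inl a) * side r * u r y) \<in> R"
      if "(\<lambda>y. u (Inr b) y - side (Inr b) * side r * u r y) \<in> R"
    proof -
      have "(\<lambda>y. (u (Inl a) y + u (Inr b) y) + (-1) * (u (Inr b) y - side (Inr b) * side r * u r y)) \<in> R"
        using add [OF edge [OF ab] scale [OF that, where c = "-1"]] by simp
      then show ?thesis by (simp add: algebra_simps)
    qed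
    ultimately show "Inl a \<in> K \<longleftrightarrow> Inr b \<in> K" unfolding K_def by blast
  qed
  moreover have "r \<in> K" unfolding K_def using zero by simp
  ultimately have K: "K = UNIV" using edge_closed_connected conn by blast
  have sums: "(\<lambda>y. \<Sum>x\<in>A. h x y) \<in> R" if "\<And>x. h x \<in> R" "finite A"
    for h :: "'a + 'b \<Rightarrow> 'a + 'b \<Rightarrow> real" and A
    using that(2) by induction (auto intro: zero add that(1))
  \<comment> \<open>Weighted by p, the terms at r add up to a multiple of
    \<open>cutsum p UNIV\<close>, which is 0.\<close>
  have "(\<lambda>y. \<Sum>x\<in>UNIV. p x * (u x y - side x * side r * u r y)) \<in> R"
    by (rule sums) (use K in \<open>auto simp: K_def intro!: scale\<close>)
  also have "(\<lambda>y. \<Sum>x\<in>UNIV. p x * (u x y - side x * side r * u r y)) = p"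
  proof
    fix y
    have "(\<Sum>x\<in>UNIV. p x * (u x y - side x * side r * u r y))
       = (\<Sum>x\<in>UNIV. p x * u x y) - cutsum p UNIV * (side r * u r y)"
      by (simp add: cutsum_def algebra_simps sum_subtractf sum_distrib_left sum_distrib_right)
    also have "(\<Sum>x\<in>UNIV. p x * u x y) = (\<Sum>x\<in>UNIV. if y = x then p x else 0)"
      by (rule sum.cong) (auto simp: u_def)
    finally show "(\<Sum>x\<in>UNIV. p x * (u x y - side x * side r * u r y)) = p y"
      by (simp add: bal)
  qed
  finally show ?thesis unfolding R_def by blast
qed

section \<open>Spanning trees\<close>

abbreviation is_tree :: "('a::finite \<times> 'b::finite) set \<Rightarrow> bool" where
  "is_tree S \<equiv> spanning_tree S S"

text \<open>The hyperplane of equal left and right totals. It is the span of the edge vectors of any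
  connected graph.\<close>

definition balanced_space :: "(real ^ ('a::finite + 'b::finite)) set" where
  "balanced_space = {z. flow_vec side \<bullet> z = 0}"

lemma flow_vec_side_inner: "flow_vec side \<bullet> z = cutsum (\<lambda>x. z $ x) UNIV"
  by (simp add: inner_vec_def cutsum_def)

lemma subspace_balanced_space: "subspace balanced_space"
  unfolding balanced_space_def by (rule subspace_hyperplane)

lemma dim_balanced_space:
  "dim (balanced_space :: (real ^ ('a::finite + 'b::finite)) set) + 1 = CARD('a) + CARD('b)"
proof -
  have "(flow_vec side :: real ^ ('a + 'b)) $ Inl undefined \<noteq> 0 $ Inl undefined"
    by simp
  then have "(flow_vec side :: real ^ ('a + 'b)) \<noteq> 0" by metis
  then have "dim (balanced_space :: (real ^ ('a + 'b)) set) = DIM(real ^ ('a + 'b)) - 1"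
    unfolding balanced_space_def by (rule dim_hyperplane)
  moreover have "CARD('a) > 0" by simp
  ultimately show ?thesis by simp
qed

lemma rp_point_in_balanced_space: "rp_point \<epsilon> \<in> balanced_space"
proof -
  obtain a b where \<epsilon>: "\<epsilon> = (a, b)" by (cases \<epsilon>)
  show ?thesis
    by (simp add: \<epsilon> balanced_space_def flow_vec_side_inner cutsum_Plus rp_point_nth of_bool_def)
qed

lemma span_rp_point_connected:
  fixes F :: "('a::finite \<times> 'b::finite) set"
  assumes "bg_connected F"
  shows "span (rp_point ` F) = balanced_space"
proof (rule span_unique)
  show "rp_point ` F \<subseteq> balanced_space"
    using rp_point_in_balanced_space by blast
  show "subspace balanced_space" by (rule subspace_balanced_space)
  fix T' :: "(real ^ ('a + 'b)) set"
  assume T': "rp_point ` F \<subseteq> T'" "subspace T'"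
  show "balanced_space \<subseteq> T'"
  proof
    fix z :: "real ^ ('a + 'b)"
    assume "z \<in> balanced_space"
    then have "cutsum (\<lambda>x. z $ x) UNIV = 0"
      by (simp add: balanced_space_def flow_vec_side_inner)
    from connected_flow_ex[OF assms this] obtain l
      where l: "supported l F" "marg l = (\<lambda>x. z $ x)" by blast
    have "z = flow_vec (marg l)" by (simp add: l(2) flow_vec_def)
    also have "\<dots> = (\<Sum>\<epsilon>\<in>F. l \<epsilon> *\<^sub>R rp_point \<epsilon>)"
      by (rule sum_rp_point_supported[OF l(1)])
    also have "\<dots> \<in> T'"
      by (intro subspace_sum subspace_scale T') (use T' in auto)
    finally show "z \<in> T'" .
  qed
qed

lemma dim_rp_point_connected:
  fixes F :: "('a::finite \<times> 'b::finite) set"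
  assumes "bg_connected F"
  shows "dim (rp_point ` F) + 1 = CARD('a) + CARD('b)"
  using span_rp_point_connected[OF assms] dim_balanced_space[where 'a='a and 'b='b]
  by (metis dim_span)

lemma connected_card_ge:
  fixes F :: "('a::finite \<times> 'b::finite) set"
  assumes "bg_connected F"
  shows "CARD('a) + CARD('b) \<le> card F + 1"
proof -
  have "dim (rp_point ` F) \<le> card (rp_point ` F)" by (rule dim_le_card') simp
  also have "\<dots> \<le> card F" by (rule card_image_le) simp
  finally show ?thesis using dim_rp_point_connected[OF assms] by simp
qed

text \<open>More edges than the dimension of \<open>balanced_space\<close> give a linear dependency
  of their vectors, and its coefficients form a circulation.\<close>

lemma circulation_ex:
  fixes F :: "('a::finite \<times> 'b::finite) set"
  assumes "CARD('a) + CARD('b) \<le> card F"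
  shows "\<exists>l::_ \<Rightarrow> real. supported l F \<and> l \<noteq> (\<lambda>_. 0) \<and> marg l = (\<lambda>_. 0)"
proof -
  have inj: "inj_on rp_point F" by (rule inj_on_subset[OF inj_rp_point]) simp
  have "dependent (rp_point ` F)"
  proof (rule ccontr)
    assume "independent (rp_point ` F)"
    moreover have "rp_point ` F \<subseteq> balanced_space" using rp_point_in_balanced_space by blast
    ultimately have "card (rp_point ` F) \<le> dim (balanced_space :: (real ^ ('a + 'b)) set)"
      by (rule independent_card_le_dim[rotated])
    then show False
      using assms dim_balanced_space[where 'a='a and 'b='b] by (simp add: card_image[OF inj])
  qed
  then obtain u where u: "\<exists>v\<in>rp_point ` F. u v \<noteq> 0" "(\<Sum>v\<in>rp_point ` F. u v *\<^sub>R v) = 0"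
    using dependent_finite[of "rp_point ` F"] by auto
  define l where "l \<epsilon> = (if \<epsilon> \<in> F then u (rp_point \<epsilon>) else 0)" for \<epsilon>
  have supp: "supported l F" by (simp add: l_def)
  have "flow_vec (marg l) = (\<Sum>\<epsilon>\<in>F. l \<epsilon> *\<^sub>R rp_point \<epsilon>)"
    by (rule sum_rp_point_supported[OF supp])
  also have "\<dots> = (\<Sum>\<epsilon>\<in>F. u (rp_point \<epsilon>) *\<^sub>R rp_point \<epsilon>)"
    by (rule sum.cong) (auto simp: l_def)
  also have "\<dots> = 0"
    using u(2) by (simp add: sum.reindex[OF inj])
  finally have z: "flow_vec (marg l) = 0" .
  have "marg l x = 0" for x
    using arg_cong[OF z, of "\<lambda>z. z $ x"] by simp
  moreover have "l \<noteq> (\<lambda>_. 0)"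
    using u(1) by (auto simp: l_def fun_eq_iff)
  ultimately show ?thesis using supp by blast
qed

text \<open>Otherwise \<epsilon> alone crosses some cut, and the cut sum of the circulation, which
  is 0, would be its value at \<epsilon> up to sign.\<close>

lemma bg_connected_remove_circulation:
  assumes "bg_connected F" "supported l F" "marg l = (\<lambda>_. 0 :: real)" "l \<epsilon> \<noteq> 0"
  shows "bg_connected (F - {\<epsilon>})"
proof (rule ccontr)
  assume "\<not> bg_connected (F - {\<epsilon>})"
  then obtain K where K: "edge_closed (F - {\<epsilon>}) K" "K \<noteq> {}" "K \<noteq> UNIV"
    unfolding bg_connected_iff_edge_closed by blast
  obtain a b where \<epsilon>: "\<epsilon> = (a, b)" by (cases \<epsilon>)
  have "\<not> edge_closed F K"
    using assms(1) K unfolding bg_connected_iff_edge_closed by blast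
  then have ne: "(Inl a \<in> K) \<noteq> (Inr b \<in> K)"
    using K(1) unfolding edge_closed_def \<epsilon> by auto
  have zero: "cutsum (marg l) K' = 0" for K' by (simp add: assms(3) cutsum_def)
  show False
  proof (cases "Inl a \<in> K")
    case True
    then have "l (a, b) = 0"
      using cutsum_cut[of F a b K l] K(1) assms(2) ne zero[of K] by (simp add: \<epsilon>)
    then show False using assms(4) \<epsilon> by simp
  next
    case False
    then have "l (a, b) = 0"
      using cutsum_cut[of F a b "- K" l] K(1) assms(2) ne zero[of "- K"] by (simp add: \<epsilon>)
    then show False using assms(4) \<epsilon> by simp
  qed
qed

lemma is_tree_connected: "is_tree S \<Longrightarrow> bg_connected S"
  by (simp add: spanning_tree_def)

lemma is_tree_card:
  "is_tree (S :: ('a::finite \<times> 'b::finite) set) \<Longrightarrow> card S + 1 = CARD('a) + CARD('b)"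
  by (simp add: spanning_tree_def)

lemma is_tree_remove_disconnected:
  assumes "is_tree S" "\<epsilon> \<in> S"
  shows "\<not> bg_connected (S - {\<epsilon>})"
proof
  assume "bg_connected (S - {\<epsilon>})"
  from connected_card_ge[OF this] is_tree_card[OF assms(1)]
  have "card S \<le> card (S - {\<epsilon>})" by simp
  moreover have "card (S - {\<epsilon>}) < card S" by (meson assms(2) card_Diff1_less finite)
  ultimately show False by simp
qed

text \<open>An edge carrying a circulation could be removed without disconnecting S, leaving too few
  edges for connectivity.\<close>

lemma is_tree_circulation:
  assumes "is_tree S" "supported l S" "marg l = (\<lambda>_. 0 :: real)"
  shows "l = (\<lambda>_. 0)"
proof (rule ccontr)
  assume "l \<noteq> (\<lambda>_. 0)"
  then obtain \<epsilon> where \<epsilon>: "l \<epsilon> \<noteq> 0" by blast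
  then have "\<epsilon> \<in> S" using assms(2) by blast
  with bg_connected_remove_circulation[OF is_tree_connected[OF assms(1)] assms(2,3) \<epsilon>]
    is_tree_remove_disconnected[OF assms(1)] show False by blast
qed

lemma is_tree_flow_unique:
  assumes "is_tree S" "supported l S" "supported k S" "marg l = (marg k :: _ \<Rightarrow> real)"
  shows "l = k"
proof -
  have "(\<lambda>\<epsilon>. l \<epsilon> - k \<epsilon>) = (\<lambda>_. 0)"
    by (rule is_tree_circulation[OF assms(1)]) (use assms in \<open>auto simp: marg_diff\<close>)
  then show ?thesis by (simp add: fun_eq_iff)
qed

section \<open>Fundamental cuts and the values of tree flows\<close>

lemma is_tree_cut_ex:
  assumes "is_tree S" "(a, b) \<in> S"
  shows "\<exists>K. edge_closed (S - {(a, b)}) K \<and> Inl a \<in> K \<and> Inr b \<notin> K"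
proof -
  obtain K where K: "edge_closed (S - {(a, b)}) K" "K \<noteq> {}" "K \<noteq> UNIV"
    using is_tree_remove_disconnected[OF assms] unfolding bg_connected_iff_edge_closed by blast
  have "\<not> edge_closed S K"
    using is_tree_connected[OF assms(1)] K unfolding bg_connected_iff_edge_closed by blast
  then have ne: "(Inl a \<in> K) \<noteq> (Inr b \<in> K)"
    using K(1) unfolding edge_closed_def by auto
  then show ?thesis
    using K(1) by (cases "Inl a \<in> K") (auto intro: exI[of _ K] exI[of _ "- K"])
qed

text \<open>The component of the left end after an edge \<epsilon> is removed from the tree S; for
  an edge of a tree this set is unique.\<close>

definition tree_cut :: "('a::finite \<times> 'b::finite) set \<Rightarrow> 'a \<times> 'b \<Rightarrow> ('a + 'b) set" where
  "tree_cut S \<epsilon> = (SOME K. edge_closed (S - {\<epsilon>}) K \<and> Inl (fst \<epsilon>) \<in> K \<and> Inr (snd \<epsilon>) \<notin> K)"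

lemma tree_cut:
  assumes "is_tree S" "(a, b) \<in> S"
  shows "edge_closed (S - {(a, b)}) (tree_cut S (a, b))"
    "Inl a \<in> tree_cut S (a, b)" "Inr b \<notin> tree_cut S (a, b)"
  using someI_ex[OF is_tree_cut_ex[OF assms]] by (simp_all add: tree_cut_def)

text \<open>The edge is the only one across its fundamental cut. Integrality, sign and genericity of
  tree flows are read off from this formula.\<close>

lemma is_tree_flow_eq_cutsum:
  assumes "is_tree S" "supported l S" "(a, b) \<in> S"
  shows "l (a, b) = cutsum (marg l) (tree_cut S (a, b))"
  using cutsum_cut[OF _ assms(2)] tree_cut[OF assms(1,3)] by metis

lemma cutsum_Ints:
  assumes "\<And>x. p x \<in> \<int>"
  shows "cutsum p K \<in> \<int>"
  unfolding cutsum_def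
proof (rule Ints_sum)
  fix x show "side x * p x \<in> \<int>" using assms[of x] by (cases x) auto
qed

text \<open>Unimodularity: each value is a signed partial sum of the integral marginals.\<close>

lemma is_tree_flow_Ints:
  assumes "is_tree S" "supported l S" "\<And>x. marg l x \<in> \<int>"
  shows "l \<epsilon> \<in> (\<int> :: real set)"
proof (cases "\<epsilon> \<in> S")
  case True
  then show ?thesis
    using is_tree_flow_eq_cutsum[OF assms(1,2)] cutsum_Ints[OF assms(3)] by (cases \<epsilon>) simp
next
  case False
  then have "l \<epsilon> = 0" using assms(2) by blast
  then show ?thesis by simp
qed

text \<open>The assumption \<open>free\<close> says that F has no cycle. A smallest connected set
  between F and G is a tree, since any circulation on it is nonzero at some edge outside F, and that
  edge could be removed.\<close>

lemma spanning_tree_extend: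
  fixes G :: "('a::finite \<times> 'b::finite) set"
  assumes "bg_connected G" "F \<subseteq> G"
    and free: "\<And>l::_ \<Rightarrow> real. supported l F \<Longrightarrow> marg l = (\<lambda>_. 0) \<Longrightarrow> l = (\<lambda>_. 0)"
  shows "\<exists>S. spanning_tree G S \<and> F \<subseteq> S"
proof -
  let ?P = "\<lambda>S. bg_connected S \<and> F \<subseteq> S \<and> S \<subseteq> G"
  have "?P G" using assms by simp
  then obtain S where S: "?P S" and min: "\<And>S'. ?P S' \<Longrightarrow> card S \<le> card S'"
    using ex_has_least_nat[of ?P G card] by blast
  have "\<not> CARD('a) + CARD('b) \<le> card S"
  proof
    assume "CARD('a) + CARD('b) \<le> card S"
    from circulation_ex[OF this] obtain l :: "_ \<Rightarrow> real"
      where l: "supported l S" "l \<noteq> (\<lambda>_. 0)" "marg l = (\<lambda>_. 0)" by blast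
    then obtain \<epsilon> where \<epsilon>: "\<epsilon> \<notin> F" "l \<epsilon> \<noteq> 0" using free[of l] by blast
    then have "\<epsilon> \<in> S" using l(1) by blast
    have "?P (S - {\<epsilon>})"
      using bg_connected_remove_circulation[OF _ l(1,3) \<epsilon>(2)] S \<epsilon> by blast
    from min[OF this] show False
      using \<open>\<epsilon> \<in> S\<close> by (meson card_Diff1_less finite leD)
  qed
  with connected_card_ge[of S] S have "spanning_tree G S"
    by (simp add: spanning_tree_def)
  then show ?thesis using S by blast
qed

text \<open>Being connected, S' has an edge across the fundamental cut of \<epsilon> in S.\<close>

lemma spanning_tree_exchange:
  assumes "is_tree S" "is_tree S'" "\<epsilon> \<in> S" "\<epsilon> \<notin> S'"
  shows "\<exists>\<eta>. \<eta> \<in> S' \<and> \<eta> \<notin> S \<and> is_tree (insert \<eta> (S - {\<epsilon>}))"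
proof -
  obtain a b where \<epsilon>: "\<epsilon> = (a, b)" by (cases \<epsilon>)
  let ?K = "tree_cut S (a, b)"
  have ab: "(a, b) \<in> S" using assms(3) \<epsilon> by simp
  note K = tree_cut[OF assms(1) ab]
  have "\<not> edge_closed S' ?K"
    using edge_closed_connected[OF is_tree_connected[OF assms(2)] _ K(2)] K(3) by blast
  then obtain c d where cd: "(c, d) \<in> S'" "(Inl c \<in> ?K) \<noteq> (Inr d \<in> ?K)"
    unfolding edge_closed_def by blast
  have cdS: "(c, d) \<notin> S"
    using cd assms(4) K(1) \<epsilon> unfolding edge_closed_def by blast
  have "bg_connected (insert (c, d) (S - {\<epsilon>}))"
    unfolding bg_connected_iff_edge_closed
  proof (intro allI impI)
    fix L assume L: "edge_closed (insert (c, d) (S - {\<epsilon>})) L"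
    have LS: "edge_closed (S - {\<epsilon>}) L" using L unfolding edge_closed_def by blast
    have *: "L = {} \<or> L = UNIV" if "edge_closed S L"
      using that is_tree_connected[OF assms(1)] unfolding bg_connected_iff_edge_closed by blast
    show "L = {} \<or> L = UNIV"
    proof (cases "(Inl a \<in> L) = (Inr b \<in> L)")
      case True
      with LS have "edge_closed S L" unfolding edge_closed_def \<epsilon> by blast
      then show ?thesis by (rule *)
    next
      case False
      \<comment> \<open>L and the fundamental cut both separate the ends of \<epsilon> and of no
        other edge of S, so their symmetric difference is closed for S. Being trivial, it makes L
        the cut or its complement, but the new edge crosses the cut and not L.\<close>
      have "edge_closed S ((L - ?K) \<union> (?K - L))"
        using LS False K unfolding edge_closed_def \<epsilon> by blast
      then have "(L - ?K) \<union> (?K - L) = {} \<or> (L - ?K) \<union> (?K - L) = UNIV"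
        using is_tree_connected[OF assms(1)] unfolding bg_connected_iff_edge_closed by blast
      moreover have "Inl c \<in> L \<longleftrightarrow> Inr d \<in> L" using L unfolding edge_closed_def by blast
      ultimately show ?thesis using cd(2) by blast
    qed
  qed
  moreover have "card (insert (c, d) (S - {\<epsilon>})) = card S"
    using cdS assms(3) by (metis Diff_iff card_Suc_Diff1 card_insert_disjoint finite)
  ultimately have "is_tree (insert (c, d) (S - {\<epsilon>}))"
    using assms(1) by (simp add: spanning_tree_def)
  then show ?thesis using cd cdS by blast
qed

text \<open>For a fixed root r, an edge points away from r at its left end iff r lies on that side of its
  cut; routing a unit of flow from r to any other node shows that exactly one edge at that
  node points towards r.\<close>

lemma tree_flow_between_ex:
  assumes "is_tree S"
  shows "\<exists>l. supported l S \<and> (\<forall>a b. (a, b) \<in> S \<longrightarrow>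
      l (a, b) = side x * (of_bool (x \<in> tree_cut S (a, b)) - of_bool (r \<in> tree_cut S (a, b)))) \<and>
      (\<forall>y. marg l y = of_bool (y = x) - side x * side r * of_bool (y = r))"
proof -
  define p :: "'a + 'b \<Rightarrow> real" where "p y = of_bool (y = x) - side x * side r * of_bool (y = r)" for y
  have cs: "cutsum p K = side x * (of_bool (x \<in> K) - of_bool (r \<in> K))" for K
  proof -
    have *: "(\<Sum>y\<in>K. h y * of_bool (y = z)) = h z * of_bool (z \<in> K)" for z and h :: "'a + 'b \<Rightarrow> real"
    proof -
      have "(\<Sum>y\<in>K. h y * of_bool (y = z)) = (\<Sum>y\<in>K. if y = z then h y else 0)"
        by (rule sum.cong) auto
      then show ?thesis by simp
    qed
    have "cutsum p K = (\<Sum>y\<in>K. side y * of_bool (y = x)) - (\<Sum>y\<in>K. side y * (side x * side r) * of_bool (y = r))"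
      by (simp add: cutsum_def p_def algebra_simps sum_subtractf)
    also have "\<dots> = side x * of_bool (x \<in> K) - side x * (side r * side r) * of_bool (r \<in> K)"
      by (subst (1 2) *) (simp add: mult_ac)
    finally show ?thesis by (simp add: right_diff_distrib)
  qed
  have "cutsum p UNIV = 0" by (simp add: cs)
  from connected_flow_ex[OF is_tree_connected[OF assms] this] obtain l
    where l: "supported l S" "marg l = p" by blast
  show ?thesis
  proof (intro exI conjI allI impI)
    show "l \<epsilon> = 0" if "\<epsilon> \<notin> S" for \<epsilon> using l that by blast
    show "l (a, b) = side x * (of_bool (x \<in> tree_cut S (a, b)) - of_bool (r \<in> tree_cut S (a, b)))"
      if "(a, b) \<in> S" for a b
      by (simp add: is_tree_flow_eq_cutsum[OF assms l(1) that] l(2) cs)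
    show "marg l y = of_bool (y = x) - side x * side r * of_bool (y = r)" for y
      by (simp add: l(2) p_def)
  qed
qed

text \<open>Every cut at a contains \<open>Inl a\<close>, so the routing flow is the indicator of
  the edges at a that have r beyond their right end. Its marginal at a is 1 unless r is a
  itself.\<close>

lemma tree_cut_root_left:
  assumes "is_tree S"
  shows "real (card {b. (a, b) \<in> S \<and> r \<in> tree_cut S (a, b)}) = real (degL S a) - of_bool (r \<noteq> Inl a)"
proof -
  obtain l where l: "supported l S"
    "\<And>a' b. (a', b) \<in> S \<Longrightarrow> l (a', b) = of_bool (Inl a \<in> tree_cut S (a', b)) - of_bool (r \<in> tree_cut S (a', b))"
    "\<And>y. marg l y = of_bool (y = Inl a) - side r * of_bool (y = r)"
    using tree_flow_between_ex[OF assms, of "Inl a" r] by auto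
  have "(\<Sum>b\<in>UNIV. l (a, b)) = (\<Sum>b\<in>{b. (a, b) \<in> S}. l (a, b))"
    by (rule sum.mono_neutral_right) (use l(1) in auto)
  also have "\<dots> = (\<Sum>b\<in>{b. (a, b) \<in> S}. 1 - of_bool (r \<in> tree_cut S (a, b)))"
    by (rule sum.cong) (use l(2) tree_cut[OF assms] in auto)
  also have "\<dots> = real (degL S a) - real (card {b. (a, b) \<in> S \<and> r \<in> tree_cut S (a, b)})"
    by (simp add: sum_subtractf of_bool_def sum.If_cases Collect_conj_eq Int_commute)
  finally have "marg l (Inl a) = real (degL S a) - real (card {b. (a, b) \<in> S \<and> r \<in> tree_cut S (a, b)})"
    by simp
  moreover have "marg l (Inl a) = of_bool (r \<noteq> Inl a)"
    unfolding l(3) by (cases "r = Inl a") auto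
  ultimately show ?thesis by simp
qed

text \<open>No cut at b contains \<open>Inr b\<close>, so the routing flow is the indicator of the
  edges at b with r on the side of the left end.\<close>

lemma tree_cut_root_right:
  assumes "is_tree S"
  shows "real (card {a. (a, b) \<in> S \<and> r \<in> tree_cut S (a, b)}) = of_bool (r \<noteq> Inr b)"
proof -
  obtain l where l: "supported l S"
    "\<And>a b'. (a, b') \<in> S \<Longrightarrow> l (a, b') = of_bool (r \<in> tree_cut S (a, b')) - of_bool (Inr b \<in> tree_cut S (a, b'))"
    "\<And>y. marg l y = of_bool (y = Inr b) + side r * of_bool (y = r)"
    using tree_flow_between_ex[OF assms, of "Inr b" r] by auto
  have "(\<Sum>a\<in>UNIV. l (a, b)) = (\<Sum>a\<in>{a. (a, b) \<in> S}. l (a, b))"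
    by (rule sum.mono_neutral_right) (use l(1) in auto)
  also have "\<dots> = (\<Sum>a\<in>{a. (a, b) \<in> S}. of_bool (r \<in> tree_cut S (a, b)))"
    by (rule sum.cong) (use l(2) tree_cut[OF assms] in auto)
  also have "\<dots> = real (card {a. (a, b) \<in> S \<and> r \<in> tree_cut S (a, b)})"
    by (simp add: of_bool_def sum.If_cases Collect_conj_eq Int_commute)
  finally have "marg l (Inr b) = real (card {a. (a, b) \<in> S \<and> r \<in> tree_cut S (a, b)})"
    by simp
  moreover have "marg l (Inr b) = of_bool (r \<noteq> Inr b)"
    unfolding l(3) by (cases "r = Inr b") auto
  ultimately show ?thesis by simp
qed

section \<open>Lexicographically minimal flows\<close>

definition lexpos :: "('i::countable \<Rightarrow> real) \<Rightarrow> bool" where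
  "lexpos \<mu> \<longleftrightarrow> (\<exists>i. 0 < \<mu> i \<and> (\<forall>j. to_nat j < to_nat i \<longrightarrow> \<mu> j = 0))"

definition flows :: "('a::finite \<times> 'b::finite) set \<Rightarrow> ('a + 'b \<Rightarrow> real) \<Rightarrow> ('a \<times> 'b \<Rightarrow> real) set" where
  "flows H p = {l. (\<forall>\<epsilon>. 0 \<le> l \<epsilon>) \<and> supported l H \<and> marg l = p}"

text \<open>The optimal bases of the transportation problem for the lexicographic order, stated
  without marginals: every direction that stays nonnegative off S makes a flow on S
  lexicographically larger.\<close>

definition lex_trees :: "('a::finite \<times> 'b::finite) set \<Rightarrow> ('a \<times> 'b) set set" where
  "lex_trees H = {S. spanning_tree H S \<and>
     (\<forall>\<mu>. supported \<mu> H \<and> marg \<mu> = (\<lambda>_. 0) \<and> \<mu> \<noteq> (\<lambda>_. 0) \<and> (\<forall>\<epsilon>. \<epsilon> \<notin> S \<longrightarrow> 0 \<le> \<mu> \<epsilon>) \<longrightarrow> lexpos \<mu>)}"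

text \<open>No proper nonempty node set is balanced, so every flow with marginals p has connected
  support.\<close>

definition generic :: "('a::finite + 'b::finite \<Rightarrow> real) \<Rightarrow> bool" where
  "generic p \<longleftrightarrow> (\<forall>K. cutsum p K = 0 \<longrightarrow> K = {} \<or> K = UNIV)"

lemma lex_trees_lexpos:
  assumes "S \<in> lex_trees H" "supported \<mu> H" "marg \<mu> = (\<lambda>_. 0)" "\<mu> \<noteq> (\<lambda>_. 0)"
    "\<And>\<epsilon>. \<epsilon> \<notin> S \<Longrightarrow> 0 \<le> \<mu> \<epsilon>"
  shows "lexpos \<mu>"
  using assms by (simp add: lex_trees_def)

lemma not_lexpos_uminus:
  assumes "lexpos \<mu>" "lexpos (\<lambda>i. - \<mu> i)"
  shows False
proof -
  obtain i j where "0 < \<mu> i" "\<forall>k. to_nat k < to_nat i \<longrightarrow> \<mu> k = 0"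
    "0 < - \<mu> j" "\<forall>k. to_nat k < to_nat j \<longrightarrow> - \<mu> k = 0"
    using assms unfolding lexpos_def by blast
  then show False
    by (metis less_irrefl linorder_less_linear neg_0_less_iff_less neg_equal_0_iff_equal not_less_iff_gr_or_eq to_nat_split)
qed

text \<open>Coordinates are minimised one after another: after k rounds L holds the points of Z that
  are lexicographically minimal in the coordinates of code below k.\<close>

lemma ex_lex_min:
  fixes Z :: "(real ^ 'i::finite) set"
  assumes "compact Z" "Z \<noteq> {}"
  shows "\<exists>z\<in>Z. \<forall>y\<in>Z. y \<noteq> z \<longrightarrow> lexpos (\<lambda>i. y $ i - z $ i)"
proof -
  have "\<exists>L. L \<subseteq> Z \<and> compact L \<and> L \<noteq> {} \<and>
      (\<forall>z\<in>L. \<forall>y\<in>Z. ((\<forall>i. to_nat i < k \<longrightarrow> y $ i = z $ i) \<and> y \<in> L) \<or> lexpos (\<lambda>i. y $ i - z $ i))" for k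
  proof (induction k)
    case 0
    show ?case by (rule exI[of _ Z]) (use assms in auto)
  next
    case (Suc k)
    then obtain L where L: "L \<subseteq> Z" "compact L" "L \<noteq> {}"
      and *: "\<And>z y. z \<in> L \<Longrightarrow> y \<in> Z \<Longrightarrow>
        ((\<forall>i. to_nat i < k \<longrightarrow> y $ i = z $ i) \<and> y \<in> L) \<or> lexpos (\<lambda>i. y $ i - z $ i)"
      by blast
    show ?case
    \<comment> \<open>k need not be the code of an index; such a round changes nothing.\<close>
    proof (cases "\<exists>i::'i. to_nat i = k")
      case False
      then have "(\<forall>i::'i. to_nat i < Suc k \<longrightarrow> P i) = (\<forall>i. to_nat i < k \<longrightarrow> P i)" for P
        by (auto simp: less_Suc_eq)
      then show ?thesis using L * by (intro exI[of _ L]) auto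
    next
      case True
      then obtain i :: 'i where i: "to_nat i = k" by blast
      have "continuous_on L (\<lambda>z. z $ i)" by (intro continuous_intros)
      from continuous_attains_inf[OF L(2,3) this]
      obtain z0 where z0: "z0 \<in> L" "\<And>y. y \<in> L \<Longrightarrow> z0 $ i \<le> y $ i" by blast
      define L' where "L' = L \<inter> {z. z $ i = z0 $ i}"
      have "closed {z. z $ i = z0 $ i}"
        by (intro closed_Collect_eq continuous_intros)
      then have cL': "compact L'" unfolding L'_def using L(2) by (simp add: compact_Int_closed)
      show ?thesis
      proof (intro exI[of _ L'] conjI ballI)
        show "L' \<subseteq> Z" "compact L'" "L' \<noteq> {}" using L cL' z0 by (auto simp: L'_def)
        fix z y assume z: "z \<in> L'" and y: "y \<in> Z"
        have zL: "z \<in> L" "z $ i = z0 $ i" using z by (auto simp: L'_def)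
        from *[OF zL(1) y]
        show "((\<forall>i. to_nat i < Suc k \<longrightarrow> y $ i = z $ i) \<and> y \<in> L') \<or> lexpos (\<lambda>i. y $ i - z $ i)"
        proof
          assume a: "(\<forall>i. to_nat i < k \<longrightarrow> y $ i = z $ i) \<and> y \<in> L"
          show ?thesis
          proof (cases "y $ i = z $ i")
            case True
            have "y $ j = z $ j" if "to_nat j < Suc k" for j
            proof (cases "to_nat j < k")
              case False
              with that i have "to_nat j = to_nat i" by simp
              then have "j = i" by (simp add: inj_eq)
              with True show ?thesis by simp
            qed (use a in blast)
            then show ?thesis using a True zL by (simp add: L'_def)
          next
            case False
            with z0(2)[of y] a zL have "y $ i > z $ i" by fastforce
            then have "lexpos (\<lambda>i. y $ i - z $ i)"
              unfolding lexpos_def using a i by (intro exI[of _ i]) auto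
            then show ?thesis ..
          qed
        qed blast
      qed
    qed
  qed
  \<comment> \<open>Past the largest code every coordinate has been minimised, so L is a single
    point.\<close>
  from this[of "Suc (Max (range (to_nat :: 'i \<Rightarrow> nat)))"]
  obtain L where L: "L \<subseteq> Z" "L \<noteq> {}"
    and *: "\<And>z y. z \<in> L \<Longrightarrow> y \<in> Z \<Longrightarrow>
        (\<forall>i::'i. to_nat i < Suc (Max (range (to_nat :: 'i \<Rightarrow> nat))) \<longrightarrow> y $ i = z $ i) \<or> lexpos (\<lambda>i. y $ i - z $ i)"
    by blast
  have lt: "to_nat i < Suc (Max (range (to_nat :: 'i \<Rightarrow> nat)))" for i :: 'i
    by (simp add: less_Suc_eq_le)
  obtain z where "z \<in> L" using L by blast
  with L * lt show ?thesis by (metis subsetD vec_eq_iff)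
qed

lemma flow_le_marg:
  assumes "\<And>\<epsilon>. 0 \<le> l \<epsilon>"
  shows "l (a, b) \<le> (marg l (Inl a) :: real)"
  by (simp, rule member_le_sum) (use assms in auto)

text \<open>Boundedness holds because no edge value exceeds the marginal at its left end.\<close>

lemma compact_flows: "compact {z. (\<lambda>i. z $ i) \<in> flows H p}"
proof -
  have "{z. (\<lambda>i. z $ i) \<in> flows H p} =
      (\<Inter>i. {z. 0 \<le> z $ i}) \<inter> (\<Inter>i\<in>- H. {z. z $ i = 0}) \<inter> (\<Inter>x. {z. marg (\<lambda>i. z $ i) x = p x})"
    by (auto simp: flows_def fun_eq_iff)
  moreover have "closed {z::real^('a \<times> 'b). marg (\<lambda>i. z $ i) x = p x}" for x
    by (cases x) (auto intro!: closed_Collect_eq continuous_intros)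
  moreover have "closed {z::real^('a \<times> 'b). 0 \<le> z $ i}" "closed {z::real^('a \<times> 'b). z $ i = 0}" for i
    by (intro closed_Collect_le closed_Collect_eq continuous_intros)+
  ultimately have "closed {z. (\<lambda>i. z $ i) \<in> flows H p}"
    by (metis (no_types, lifting) closed_Int closed_INT)
  moreover have "bounded {z. (\<lambda>i. z $ i) \<in> flows H p}"
    unfolding bounded_iff
  proof (intro exI ballI)
    fix z assume "z \<in> {z. (\<lambda>i. z $ i) \<in> flows H p}"
    then have z: "\<And>i. 0 \<le> z $ i" "marg (\<lambda>i. z $ i) = p" by (auto simp: flows_def)
    have "norm z \<le> (\<Sum>i\<in>UNIV. \<bar>z $ i\<bar>)" by (rule norm_le_l1_cart)
    also have "\<dots> \<le> (\<Sum>i\<in>(UNIV :: ('a \<times> 'b) set). p (Inl (fst i)))"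
    proof (rule sum_mono)
      fix i :: "'a \<times> 'b"
      show "\<bar>z $ i\<bar> \<le> p (Inl (fst i))"
        using flow_le_marg[of "\<lambda>i. z $ i" "fst i" "snd i"] z by simp
    qed
    finally show "norm z \<le> (\<Sum>i\<in>(UNIV :: ('a \<times> 'b) set). p (Inl (fst i)))" .
  qed
  ultimately show ?thesis by (simp add: compact_eq_bounded_closed)
qed

lemma ex_lex_min_flow:
  assumes "flows H p \<noteq> {}"
  shows "\<exists>l\<in>flows H p. \<forall>k\<in>flows H p. k \<noteq> l \<longrightarrow> lexpos (\<lambda>\<epsilon>. k \<epsilon> - l \<epsilon>)"
proof -
  have in_Z: "vec_lambda k \<in> {z. (\<lambda>i. z $ i) \<in> flows H p}" if "k \<in> flows H p" for k
    using that by (simp add: vec_lambda_inverse)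
  then have "{z. (\<lambda>i. z $ i) \<in> flows H p} \<noteq> {}" using assms by blast
  from ex_lex_min[OF compact_flows this] obtain z where
    z: "(\<lambda>i. z $ i) \<in> flows H p"
    and min: "\<And>y. (\<lambda>i. y $ i) \<in> flows H p \<Longrightarrow> y \<noteq> z \<Longrightarrow> lexpos (\<lambda>i. y $ i - z $ i)" by blast
  show ?thesis
  proof (intro bexI[OF _ z] ballI impI)
    fix k assume "k \<in> flows H p" "k \<noteq> (\<lambda>i. z $ i)"
    moreover from this have "vec_lambda k \<noteq> z" by (metis vec_lambda_inverse UNIV_I)
    ultimately show "lexpos (\<lambda>\<epsilon>. k \<epsilon> - z $ \<epsilon>)"
      using min[of "vec_lambda k"] by (simp add: vec_lambda_inverse)
  qed
qed

lemma ex_perturb_nonneg: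
  fixes l \<mu> :: "'i::finite \<Rightarrow> real"
  assumes "\<And>\<epsilon>. 0 \<le> l \<epsilon>" "\<And>\<epsilon>. l \<epsilon> = 0 \<Longrightarrow> 0 \<le> \<mu> \<epsilon>"
  shows "\<exists>t>0. \<forall>\<epsilon>. 0 \<le> l \<epsilon> + t * \<mu> \<epsilon>"
proof -
  have "\<exists>t>0. 0 \<le> l \<epsilon> + t * \<mu> \<epsilon> \<and> (\<forall>s. 0 < s \<longrightarrow> s \<le> t \<longrightarrow> 0 \<le> l \<epsilon> + s * \<mu> \<epsilon>)" for \<epsilon>
  proof (cases "0 \<le> \<mu> \<epsilon>")
    case True
    then show ?thesis using assms(1)[of \<epsilon>] by (intro exI[of _ 1]) auto
  next
    case False
    then have pos: "l \<epsilon> > 0" using assms[of \<epsilon>] by fastforce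
    have *: "0 \<le> l \<epsilon> + s * \<mu> \<epsilon>" if "0 < s" "s \<le> l \<epsilon> / - \<mu> \<epsilon>" for s
      using that False by (simp add: field_simps)
    have "l \<epsilon> / - \<mu> \<epsilon> > 0" using pos False by (simp add: field_simps)
    then show ?thesis using * by (intro exI[of _ "l \<epsilon> / - \<mu> \<epsilon>"]) auto
  qed
  then obtain t where t: "\<And>\<epsilon>. t \<epsilon> > 0" "\<And>\<epsilon> s. 0 < s \<Longrightarrow> s \<le> t \<epsilon> \<Longrightarrow> 0 \<le> l \<epsilon> + s * \<mu> \<epsilon>"
    by metis
  let ?t = "Min (range t)"
  have "?t > 0" using t(1) by (subst Min_gr_iff) auto
  moreover have "?t \<le> t \<epsilon>" for \<epsilon> by (rule Min_le) auto
  ultimately show ?thesis using t(2) by blast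
qed

lemma flows_add_circulation:
  assumes "l \<in> flows H p" "supported \<mu> H" "marg \<mu> = (\<lambda>_. 0)" "\<And>\<epsilon>. 0 \<le> l \<epsilon> + t * \<mu> \<epsilon>"
  shows "(\<lambda>\<epsilon>. l \<epsilon> + t * \<mu> \<epsilon>) \<in> flows H p"
  using assms unfolding flows_def by (auto simp: marg_add marg_cmult)

lemma lexpos_scale: "t > 0 \<Longrightarrow> lexpos (\<lambda>\<epsilon>. t * \<mu> \<epsilon>) \<Longrightarrow> lexpos \<mu>"
  by (auto simp: lexpos_def zero_less_mult_iff)

text \<open>Lexicographic minimality of flows replaces a generic cost function: the supports of
  the minimal flows are the simplices of a triangulation of the cone over the root polytope.\<close>

lemma generic_lex_tree_ex:
  assumes gen: "generic p" and ne: "flows H p \<noteq> {}"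
  shows "\<exists>S\<in>lex_trees H. flows S p \<noteq> {}"
proof -
  obtain l where l: "l \<in> flows H p"
    and min: "\<And>k. k \<in> flows H p \<Longrightarrow> k \<noteq> l \<Longrightarrow> lexpos (\<lambda>\<epsilon>. k \<epsilon> - l \<epsilon>)"
    using ex_lex_min_flow[OF ne] by blast
  have l': "\<And>\<epsilon>. 0 \<le> l \<epsilon>" "supported l H" "marg l = p" using l by (auto simp: flows_def)
  define S where "S = {\<epsilon>. l \<epsilon> \<noteq> 0}"
  have SH: "S \<subseteq> H" using l'(2) unfolding S_def by blast
  have suppS: "supported l S" by (simp add: S_def)
  \<comment> \<open>A small step from l along \<mu> is again a flow with marginals p, so minimality
    of l applies to it.\<close>
  have lexp: "lexpos \<mu>" if "supported \<mu> H" "marg \<mu> = (\<lambda>_. 0)" "\<mu> \<noteq> (\<lambda>_. 0)" "\<And>\<epsilon>. \<epsilon> \<notin> S \<Longrightarrow> 0 \<le> \<mu> \<epsilon>" for \<mu>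
  proof -
    have nonneg: "0 \<le> \<mu> \<epsilon>" if "l \<epsilon> = 0" for \<epsilon>
      using \<open>\<And>\<epsilon>. \<epsilon> \<notin> S \<Longrightarrow> 0 \<le> \<mu> \<epsilon>\<close>[of \<epsilon>] that by (simp add: S_def)
    have "\<exists>t>0. \<forall>\<epsilon>. 0 \<le> l \<epsilon> + t * \<mu> \<epsilon>"
      by (rule ex_perturb_nonneg) (simp_all only: l'(1) nonneg)
    then obtain t where t: "t > 0" "\<And>\<epsilon>. 0 \<le> l \<epsilon> + t * \<mu> \<epsilon>" by metis
    have "(\<lambda>\<epsilon>. l \<epsilon> + t * \<mu> \<epsilon>) \<in> flows H p"
      by (rule flows_add_circulation[OF l that(1,2) t(2)])
    moreover have "(\<lambda>\<epsilon>. l \<epsilon> + t * \<mu> \<epsilon>) \<noteq> l"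
    proof
      assume "(\<lambda>\<epsilon>. l \<epsilon> + t * \<mu> \<epsilon>) = l"
      from fun_cong[OF this] have "\<mu> \<epsilon> = 0" for \<epsilon> using t(1) by (auto dest: meta_spec[of _ \<epsilon>])
      then have "\<mu> = (\<lambda>_. 0)" by (rule ext)
      with that(3) show False by contradiction
    qed
    ultimately have "lexpos (\<lambda>\<epsilon>. t * \<mu> \<epsilon>)" using min[of "\<lambda>\<epsilon>. l \<epsilon> + t * \<mu> \<epsilon>"] by simp
    then show ?thesis by (rule lexpos_scale[OF t(1)])
  qed
  \<comment> \<open>A disconnected support would leave a proper node set with cut sum 0, which
    genericity excludes.\<close>
  have "bg_connected S"
    unfolding bg_connected_iff_edge_closed
    using cutsum_edge_closed[of S _ l, OF _ suppS] gen l'(3) unfolding generic_def by metis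
  moreover have "\<not> CARD('a) + CARD('b) \<le> card S"
  proof
    assume "CARD('a) + CARD('b) \<le> card S"
    from circulation_ex[OF this] obtain \<mu> :: "_ \<Rightarrow> real"
      where \<mu>: "supported \<mu> S" "\<mu> \<noteq> (\<lambda>_. 0)" "marg \<mu> = (\<lambda>_. 0)" by blast
    have suppH: "supported \<mu> H" using \<mu>(1) SH by blast
    have "lexpos \<mu>" by (rule lexp[OF suppH \<mu>(3,2)]) (use \<mu>(1) in auto)
    \<comment> \<open>The circulation vanishes off S, so its negative is an admissible direction as
      well.\<close>
    moreover have "lexpos (\<lambda>\<epsilon>. - \<mu> \<epsilon>)"
    proof (rule lexp)
      show "supported (\<lambda>\<epsilon>. - \<mu> \<epsilon>) H" using suppH by auto
      show "marg (\<lambda>\<epsilon>. - \<mu> \<epsilon>) = (\<lambda>_. 0)" using marg_cmult[of "-1" \<mu>] \<mu>(3) by (simp add: fun_eq_iff)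
      show "(\<lambda>\<epsilon>. - \<mu> \<epsilon>) \<noteq> (\<lambda>_. 0)" using \<mu>(2) by (simp add: fun_eq_iff)
      show "0 \<le> - \<mu> \<epsilon>" if "\<epsilon> \<notin> S" for \<epsilon> using \<mu>(1) that by simp
    qed
    ultimately show False by (rule not_lexpos_uminus)
  qed
  ultimately have "spanning_tree H S"
    using connected_card_ge[of S] SH by (simp add: spanning_tree_def)
  then have "S \<in> lex_trees H"
    unfolding lex_trees_def mem_Collect_eq
    by (rule conjI) (intro allI impI lexp; elim conjE; simp)
  moreover have "l \<in> flows S p" using l' suppS unfolding flows_def by blast
  ultimately show ?thesis by blast
qed

text \<open>The difference of the two flows is nonnegative off one tree and its negative is
  nonnegative off the other, so both would be lexicographically positive.\<close>

lemma lex_trees_flow_eq: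
  assumes "S \<in> lex_trees H" "S' \<in> lex_trees H" "l \<in> flows S p" "l' \<in> flows S' p"
  shows "l = l'"
proof (rule ccontr)
  assume ne: "l \<noteq> l'"
  have "lexpos (\<lambda>\<epsilon>. k' \<epsilon> - k \<epsilon>)"
    if "R \<in> lex_trees H" "R' \<in> lex_trees H" "k \<in> flows R p" "k' \<in> flows R' p" "k \<noteq> k'" for R R' k k'
  proof -
    have RH: "R \<subseteq> H" "R' \<subseteq> H" using that(1,2) by (auto simp: lex_trees_def spanning_tree_def)
    have k: "supported k R" "marg k = p" "supported k' R'" "marg k' = p" "\<And>\<epsilon>. 0 \<le> k' \<epsilon>"
      using that(3,4) by (auto simp: flows_def)
    have "supported (\<lambda>\<epsilon>. k' \<epsilon> - k \<epsilon>) H"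
      using k(1,3) RH by (metis diff_self subsetD)
    moreover have "marg (\<lambda>\<epsilon>. k' \<epsilon> - k \<epsilon>) = (\<lambda>_. 0)" using k by (auto simp: marg_diff)
    moreover have "(\<lambda>\<epsilon>. k' \<epsilon> - k \<epsilon>) \<noteq> (\<lambda>_. 0)"
    proof
      assume eq: "(\<lambda>\<epsilon>. k' \<epsilon> - k \<epsilon>) = (\<lambda>_. 0)"
      have "k \<epsilon> = k' \<epsilon>" for \<epsilon> using fun_cong[OF eq, of \<epsilon>] by simp
      then show False using that(5) by blast
    qed
    moreover have "0 \<le> k' \<epsilon> - k \<epsilon>" if "\<epsilon> \<notin> R" for \<epsilon>
    proof -
      have "k \<epsilon> = 0" using k(1) that by blast
      then show ?thesis using k(5)[of \<epsilon>] by simp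
    qed
    ultimately show ?thesis by (rule lex_trees_lexpos[OF that(1)])
  qed
  note lexp = this
  have "lexpos (\<lambda>\<epsilon>. l' \<epsilon> - l \<epsilon>)" by (rule lexp[OF assms ne])
  moreover have "lexpos (\<lambda>\<epsilon>. - (l' \<epsilon> - l \<epsilon>))"
    using lexp[OF assms(2,1,4,3)] ne by simp
  ultimately show False by (rule not_lexpos_uminus)
qed

lemma is_tree_subset_eq: "is_tree S \<Longrightarrow> is_tree S' \<Longrightarrow> S \<subseteq> S' \<Longrightarrow> S = S'"
  by (rule card_subset_eq) (auto simp: spanning_tree_def)

text \<open>The flow on S' coincides with l, which is nonzero on all of S; this forces S inside S',
  and trees have equal size.\<close>

lemma lex_trees_eq:
  assumes "S \<in> lex_trees H" "S' \<in> lex_trees H" "l \<in> flows S p" "flows S' p \<noteq> {}"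
    and pos: "\<And>\<epsilon>. \<epsilon> \<in> S \<Longrightarrow> l \<epsilon> \<noteq> 0"
  shows "S = S'"
proof -
  obtain l' where l': "l' \<in> flows S' p" using assms(4) by blast
  with lex_trees_flow_eq[OF assms(1,2,3)] have "l' = l" by blast
  then have "S \<subseteq> S'" using l' pos unfolding flows_def by blast
  then show ?thesis
    using assms(1,2) by (intro is_tree_subset_eq) (auto simp: lex_trees_def spanning_tree_def)
qed

lemma generic_flow_pos:
  assumes "generic p" "is_tree S" "supported l S" "marg l = p" "\<epsilon> \<in> S"
  shows "l \<epsilon> \<noteq> 0"
proof -
  obtain a b where \<epsilon>: "\<epsilon> = (a, b)" by (cases \<epsilon>)
  have ab: "(a, b) \<in> S" using assms(5) \<epsilon> by simp
  show ?thesis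
    using is_tree_flow_eq_cutsum[OF assms(2,3) ab] tree_cut[OF assms(2) ab] assms(1,4)
    unfolding generic_def \<epsilon> by (metis UNIV_I empty_iff)
qed

section \<open>Hypertrees and lexicographic trees\<close>

text \<open>A flow with these marginals on a tree S is nonnegative precisely when f + 1 is the left
  degree vector of S, so a triangulation contains exactly one tree per hypertree.\<close>

definition hpoint :: "('a::finite \<Rightarrow> nat) \<Rightarrow> 'a + 'b::finite \<Rightarrow> real" where
  "hpoint f x = (case x of Inl a \<Rightarrow> real (f a) + 1 / real CARD('a) | Inr b \<Rightarrow> 1)"

lemma cutsum_hpoint:
  fixes K :: "('a::finite + 'b::finite) set"
  shows "cutsum (hpoint f) K = real (\<Sum>a\<in>{a. Inl a \<in> K}. f a)
     + real (card {a. Inl a \<in> K}) / real CARD('a) - real (card {b. Inr b \<in> K})"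
  by (simp add: cutsum_Plus hpoint_def sum.distrib)

lemma card_eq_CARD_iff: "card (A :: 'a::finite set) = CARD('a) \<longleftrightarrow> A = UNIV"
  by (metis card_subset_eq finite subset_UNIV)

text \<open>Only left nodes contribute fractions, so a balanced K contains a multiple of
  \<open>CARD('a)\<close> of them, that is none or all. The integer parts then determine the number
  of right nodes.\<close>

lemma generic_hpoint:
  fixes f :: "'a::finite \<Rightarrow> nat"
  assumes "(\<Sum>a\<in>UNIV. f a) + 1 = CARD('b::finite)"
  shows "generic (hpoint f :: 'a + 'b \<Rightarrow> real)"
  unfolding generic_def
proof (intro allI impI)
  fix K :: "('a + 'b) set"
  assume K: "cutsum (hpoint f) K = 0"
  let ?X = "{a. Inl a \<in> K}" and ?Y = "{b. Inr b \<in> K}" and ?n = "CARD('a)"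
  have n: "?n > 0" by simp
  from K have "real (card ?X) = real ?n * (real (card ?Y) - real (\<Sum>a\<in>?X. f a))"
    unfolding cutsum_hpoint using n by (simp add: field_simps)
  also have "\<dots> = of_int (int ?n * (int (card ?Y) - int (\<Sum>a\<in>?X. f a)))" by simp
  finally have "of_int (int (card ?X)) = (of_int (int ?n * (int (card ?Y) - int (\<Sum>a\<in>?X. f a))) :: real)"
    by simp
  then have eq: "int (card ?X) = int ?n * (int (card ?Y) - int (\<Sum>a\<in>?X. f a))"
    by (simp only: of_int_eq_iff)
  then have "?n dvd card ?X" by (metis dvd_triv_left int_dvd_int_iff)
  moreover have "card ?X \<le> ?n" by (simp add: card_mono)
  ultimately have "card ?X = 0 \<or> card ?X = ?n"
    by (metis dvd_imp_le le_antisym neq0_conv)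
  then show "K = {} \<or> K = UNIV"
  proof
    assume "card ?X = 0"
    then have X: "?X = {}" by (metis card_0_eq finite)
    with eq have "card ?Y = 0" by simp
    then have "?Y = {}" by (metis card_0_eq finite)
    with X have "x \<notin> K" for x by (cases x) auto
    then show ?thesis by blast
  next
    assume c: "card ?X = ?n"
    then have X: "?X = UNIV" by (simp only: card_eq_CARD_iff)
    have "1 = int (card ?Y) - int (\<Sum>a\<in>UNIV. f a)"
      using eq n unfolding c X by (metis (no_types, lifting) mult_cancel_left mult.right_neutral of_nat_eq_0_iff less_irrefl)
    then have "int (card ?Y) = int ((\<Sum>a\<in>UNIV. f a) + 1)" by simp
    then have "card ?Y = CARD('b)" by (simp only: of_nat_eq_iff assms)
    then have "?Y = UNIV" by (simp only: card_eq_CARD_iff)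
    with X have "x \<in> K" for x by (cases x) auto
    then show ?thesis by blast
  qed
qed

text \<open>Average of \<open>tree_cut_root_left\<close> over all left roots r: the root a
  contributes the degree of a and every other root one less.\<close>

lemma sum_card_tree_cut_left:
  fixes S :: "('a::finite \<times> 'b::finite) set"
  assumes "is_tree S"
  shows "(\<Sum>b\<in>{b. (a, b) \<in> S}. real (card {r::'a. Inl r \<in> tree_cut S (a, b)}) / real CARD('a))
    = real (degL S a) - 1 + 1 / real CARD('a)"
proof -
  let ?n = "real CARD('a)"
  have n: "?n > 0" by simp
  have c: "real (card {r::'a. Inl r \<in> tree_cut S (a, b)}) = (\<Sum>r\<in>UNIV. of_bool (Inl r \<in> tree_cut S (a, b)))" for b
    by (simp add: of_bool_def sum.If_cases)
  have "(\<Sum>b\<in>{b. (a, b) \<in> S}. real (card {r::'a. Inl r \<in> tree_cut S (a, b)}))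
     = (\<Sum>r\<in>UNIV. \<Sum>b\<in>{b. (a, b) \<in> S}. of_bool (Inl r \<in> tree_cut S (a, b)))"
    unfolding c by (rule sum.swap)
  also have "\<dots> = (\<Sum>r\<in>UNIV. real (card {b. (a, b) \<in> S \<and> Inl r \<in> tree_cut S (a, b)}))"
    by (simp add: of_bool_def sum.If_cases Collect_conj_eq)
  also have "\<dots> = (\<Sum>r\<in>(UNIV::'a set). real (degL S a) - of_bool (r \<noteq> a))"
    by (simp add: tree_cut_root_left[OF assms])
  also have "\<dots> = ?n * real (degL S a) - (\<Sum>r\<in>UNIV - {a}. 1)"
    by (simp add: sum_subtractf of_bool_def sum.If_cases Diff_eq Compl_eq)
  also have "(\<Sum>r\<in>UNIV - {a}. 1) = ?n - (1::real)"
    by (simp add: card_Diff_singleton of_nat_diff)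
  finally have "(\<Sum>b\<in>{b. (a, b) \<in> S}. real (card {r::'a. Inl r \<in> tree_cut S (a, b)}))
     = ?n * real (degL S a) - (?n - 1)" .
  then show ?thesis using n by (simp add: sum_divide_distrib[symmetric] field_simps)
qed

lemma sum_card_tree_cut_right:
  fixes S :: "('a::finite \<times> 'b::finite) set"
  assumes "is_tree S"
  shows "(\<Sum>a\<in>{a. (a, b) \<in> S}. real (card {r::'a. Inl r \<in> tree_cut S (a, b)}) / real CARD('a)) = 1"
proof -
  have c: "real (card {r::'a. Inl r \<in> tree_cut S (a, b)}) = (\<Sum>r\<in>UNIV. of_bool (Inl r \<in> tree_cut S (a, b)))" for a
    by (simp add: of_bool_def sum.If_cases)
  have "(\<Sum>a\<in>{a. (a, b) \<in> S}. real (card {r::'a. Inl r \<in> tree_cut S (a, b)}))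
     = (\<Sum>r\<in>UNIV. \<Sum>a\<in>{a. (a, b) \<in> S}. of_bool (Inl r \<in> tree_cut S (a, b)))"
    unfolding c by (rule sum.swap)
  also have "\<dots> = (\<Sum>r\<in>UNIV. real (card {a. (a, b) \<in> S \<and> Inl r \<in> tree_cut S (a, b)}))"
    by (simp add: of_bool_def sum.If_cases Collect_conj_eq)
  also have "\<dots> = real CARD('a)"
    by (simp add: tree_cut_root_right[OF assms])
  finally show ?thesis by (simp add: sum_divide_distrib[symmetric])
qed

lemma hpoint_flow_ex:
  fixes S :: "('a::finite \<times> 'b::finite) set"
  assumes "is_tree S" "\<And>a. degL S a = f a + 1"
  shows "flows S (hpoint f) \<noteq> {}"
proof -
  \<comment> \<open>The average over all left roots r of the flow in which each right node uses its
    one edge towards r.\<close>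
  define l where "l \<epsilon> = (if \<epsilon> \<in> S then real (card {r::'a. Inl r \<in> tree_cut S \<epsilon>}) / real CARD('a) else 0)" for \<epsilon>
  have "marg l x = hpoint f x" for x
  proof (cases x)
    case (Inl a)
    have "(\<Sum>b\<in>UNIV. l (a, b)) = (\<Sum>b\<in>{b. (a, b) \<in> S}. l (a, b))"
      by (rule sum.mono_neutral_right) (auto simp: l_def)
    also have "\<dots> = (\<Sum>b\<in>{b. (a, b) \<in> S}. real (card {r::'a. Inl r \<in> tree_cut S (a, b)}) / real CARD('a))"
      by (rule sum.cong) (auto simp: l_def)
    finally show ?thesis
      unfolding sum_card_tree_cut_left[OF assms(1)] by (simp add: Inl hpoint_def assms(2))
  next
    case (Inr b)
    have "(\<Sum>a\<in>UNIV. l (a, b)) = (\<Sum>a\<in>{a. (a, b) \<in> S}. l (a, b))"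
      by (rule sum.mono_neutral_right) (auto simp: l_def)
    also have "\<dots> = (\<Sum>a\<in>{a. (a, b) \<in> S}. real (card {r::'a. Inl r \<in> tree_cut S (a, b)}) / real CARD('a))"
      by (rule sum.cong) (auto simp: l_def)
    finally show ?thesis
      unfolding sum_card_tree_cut_right[OF assms(1)] by (simp add: Inr hpoint_def)
  qed
  then have "l \<in> flows S (hpoint f)"
    by (auto simp: flows_def l_def)
  then show ?thesis by blast
qed

lemma flows_hpoint_sum:
  fixes S :: "('a::finite \<times> 'b::finite) set"
  assumes "l \<in> flows S (hpoint f)"
  shows "(\<Sum>a\<in>UNIV. f a) + 1 = CARD('b)"
proof -
  have "cutsum (hpoint f :: 'a + 'b \<Rightarrow> real) UNIV = 0"
    using assms cutsum_marg_UNIV[of l] by (simp add: flows_def)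
  then have "real ((\<Sum>a\<in>UNIV. f a) + 1) = real CARD('b)"
    by (simp add: cutsum_hpoint del: of_nat_sum)
  then show ?thesis by (simp only: of_nat_eq_iff)
qed

text \<open>Every edge carries at least its value in the flow built in
  \<open>hpoint_flow_ex\<close>. Summed at a, this bounds the degree by \<open>f a + 1\<close>, and
  equal totals turn the bounds into equalities.\<close>

lemma hpoint_flow_degL:
  fixes S :: "('a::finite \<times> 'b::finite) set"
  assumes tree: "is_tree S" and l: "l \<in> flows S (hpoint f)"
  shows "degL S a = f a + 1"
proof -
  let ?n = "real CARD('a)"
  have l': "supported l S" "marg l = hpoint f" "\<And>\<epsilon>. 0 \<le> l \<epsilon>" using l by (auto simp: flows_def)
  have fs: "(\<Sum>a\<in>UNIV. f a) + 1 = CARD('b)" by (rule flows_hpoint_sum[OF l])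
  have n: "?n > 0" by simp
  have ge: "real (card {r::'a. Inl r \<in> tree_cut S (a, b)}) / ?n \<le> l (a, b)" if ab: "(a, b) \<in> S" for a b
  proof -
    let ?K = "tree_cut S (a, b)"
    let ?X = "{a. Inl a \<in> ?K}" and ?Y = "{b. Inr b \<in> ?K}"
    have eq: "l (a, b) = real (\<Sum>a\<in>?X. f a) + real (card ?X) / ?n - real (card ?Y)"
      using is_tree_flow_eq_cutsum[OF tree l'(1) ab] by (simp only: l'(2) cutsum_hpoint)
    \<comment> \<open>The value of the edge is an integer plus the fraction
      \<open>card ?X / ?n\<close>. If the fraction is below 1, nonnegativity of l makes the integer
      nonnegative; if the cut contains all left nodes, the right end missing from it does.\<close>
    have "card ?Y \<le> (\<Sum>a\<in>?X. f a)"
    proof (cases "?X = UNIV")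
      case True
      have "?Y \<subset> UNIV" using tree_cut(3)[OF tree ab] by blast
      then have "card ?Y < CARD('b)" by (rule psubset_card_mono[rotated]) simp
      then show ?thesis using fs unfolding True by simp
    next
      case False
      then have "card ?X < CARD('a)" by (intro psubset_card_mono) auto
      then have "real (card ?X) / ?n < 1" using n by (simp add: field_simps)
      with eq l'(3)[of "(a, b)"] have "real (card ?Y) < real (\<Sum>a\<in>?X. f a) + 1" by linarith
      then have "real (card ?Y) < real ((\<Sum>a\<in>?X. f a) + 1)" by simp
      then have "card ?Y < (\<Sum>a\<in>?X. f a) + 1" by (simp only: of_nat_less_iff)
      then show ?thesis by simp
    qed
    then have "real (card ?Y) \<le> real (\<Sum>a\<in>?X. f a)" by (simp only: of_nat_le_iff)
    then show ?thesis using eq by simp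
  qed
  have le: "degL S a \<le> f a + 1" for a
  proof -
    have "real (degL S a) - 1 + 1 / ?n \<le> (\<Sum>b\<in>{b. (a, b) \<in> S}. l (a, b))"
      unfolding sum_card_tree_cut_left[OF tree, symmetric] by (rule sum_mono) (use ge in auto)
    also have "\<dots> = (\<Sum>b\<in>UNIV. l (a, b))"
      by (rule sum.mono_neutral_left) (use l'(1) in auto)
    also have "\<dots> = real (f a) + 1 / ?n"
      using fun_cong[OF l'(2), of "Inl a"] by (simp add: hpoint_def)
    finally show ?thesis by simp
  qed
  have "(\<Sum>a\<in>UNIV. degL S a) = (\<Sum>a\<in>UNIV. f a + 1)"
    using is_tree_card[OF tree] fs by (simp add: sum_degL sum_Suc)
  then show ?thesis
    using sum_mono_inv[of "degL S" UNIV "\<lambda>a. f a + 1" a] le by simp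
qed

lemma hypertrees_sum:
  fixes H :: "('a::finite \<times> 'b::finite) set"
  assumes "f \<in> hypertrees H"
  shows "(\<Sum>a\<in>UNIV. f a) + 1 = CARD('b)"
proof -
  obtain S where S: "spanning_tree H S" "\<And>a. degL S a = f a + 1"
    using assms unfolding hypertrees_def by blast
  have "is_tree S" using S(1) by (simp add: spanning_tree_def)
  then show ?thesis using is_tree_card[of S] sum_degL[of S] by (simp add: S(2) sum_Suc)
qed

lemma bij_betw_lex_trees_hypertrees:
  fixes H :: "('a::finite \<times> 'b::finite) set"
  shows "bij_betw (\<lambda>S a. degL S a - 1) (lex_trees H) (hypertrees H)"
proof -
  have tree: "is_tree S" "spanning_tree H S" if "S \<in> lex_trees H" for S
    using that by (auto simp: lex_trees_def spanning_tree_def)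
  have deg: "degL S a = degL S a - 1 + 1" if "S \<in> lex_trees H" for S a
    using connected_degL_pos[OF is_tree_connected[OF tree(1)[OF that]]] by (metis Suc_pred' Suc_eq_plus1)
  have "inj_on (\<lambda>S a. degL S a - 1) (lex_trees H)"
  proof (rule inj_onI)
    fix S S' assume S: "S \<in> lex_trees H" and S': "S' \<in> lex_trees H"
      and eq: "(\<lambda>a. degL S a - 1) = (\<lambda>a. degL S' a - 1)"
    let ?f = "\<lambda>a. degL S a - 1"
    have d: "degL S a = ?f a + 1" "degL S' a = ?f a + 1" for a
      using deg[OF S, of a] deg[OF S', of a] fun_cong[OF eq, of a] by argo+
    obtain l where l: "l \<in> flows S (hpoint ?f)"
      using hpoint_flow_ex[OF tree(1)[OF S] d(1)] by blast
    have gen: "generic (hpoint ?f :: 'a + 'b \<Rightarrow> real)"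
      by (rule generic_hpoint[OF flows_hpoint_sum[OF l]])
    show "S = S'"
    proof (rule lex_trees_eq[OF S S' l])
      show "flows S' (hpoint ?f) \<noteq> {}" by (rule hpoint_flow_ex[OF tree(1)[OF S'] d(2)])
      show "l \<epsilon> \<noteq> 0" if "\<epsilon> \<in> S" for \<epsilon>
        using generic_flow_pos[OF gen tree(1)[OF S] _ _ that] l unfolding flows_def by blast
    qed
  qed
  moreover have "(\<lambda>a. degL S a - 1) \<in> hypertrees H" if "S \<in> lex_trees H" for S
    unfolding hypertrees_def using tree(2)[OF that] deg[OF that] by blast
  moreover have "f \<in> (\<lambda>S a. degL S a - 1) ` lex_trees H" if f: "f \<in> hypertrees H" for f
  proof -
    obtain S where S: "spanning_tree H S" "\<And>a. degL S a = f a + 1"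
      using f unfolding hypertrees_def by blast
    then have St: "is_tree S" "S \<subseteq> H" by (simp_all add: spanning_tree_def)
    \<comment> \<open>Any tree realising f shows that \<open>hpoint f\<close> carries a flow; the
      lexicographic tree found for this point has the same left degrees by
      \<open>hpoint_flow_degL\<close>.\<close>
    have "flows S (hpoint f) \<noteq> {}" by (rule hpoint_flow_ex[OF St(1) S(2)])
    then have "flows H (hpoint f) \<noteq> {}" using St(2) unfolding flows_def by blast
    from generic_lex_tree_ex[OF generic_hpoint[OF hypertrees_sum[OF f]] this]
    obtain S' where S': "S' \<in> lex_trees H" "flows S' (hpoint f :: 'a + 'b \<Rightarrow> real) \<noteq> {}" by blast
    then have "degL S' a = f a + 1" for a using hpoint_flow_degL[OF tree(1)] by blast
    then have "f = (\<lambda>a. degL S' a - 1)" by simp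
    then show ?thesis using S'(1) by blast
  qed
  ultimately show ?thesis unfolding bij_betw_def by blast
qed

section \<open>A new left node joined to all right nodes\<close>

definition add_node :: "('e \<times> 'v) set \<Rightarrow> ('e option \<times> 'v) set" where
  "add_node G = {(Some e, v) | e v. (e, v) \<in> G} \<union> {(None, v) | v. True}"

definition drop_node :: "('e option \<times> 'v) set \<Rightarrow> ('e \<times> 'v) set" where
  "drop_node S = {(e, v). (Some e, v) \<in> S}"

definition sub_hypertrees :: "('e::finite \<times> 'v::finite) set \<Rightarrow> ('e \<Rightarrow> nat) set" where
  "sub_hypertrees G = {g. \<exists>f\<in>hypertrees G. \<forall>e. g e \<le> f e}"

lemma add_node_iff [simp]: "(Some e, v) \<in> add_node G \<longleftrightarrow> (e, v) \<in> G" "(None, v) \<in> add_node G"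
  by (auto simp: add_node_def)

lemma drop_node_iff [simp]: "(e, v) \<in> drop_node S \<longleftrightarrow> (Some e, v) \<in> S"
  by (simp add: drop_node_def)

lemma bg_connected_add_node:
  fixes G :: "('e::finite \<times> 'v::finite) set"
  assumes "\<And>e. \<exists>v. (e, v) \<in> G"
  shows "bg_connected (add_node G)"
  unfolding bg_connected_iff_edge_closed
proof (intro allI impI)
  fix K assume "edge_closed (add_node G) K"
  then have K: "(Inl x \<in> K) = (Inr v \<in> K)" if "(x, v) \<in> add_node G" for x v
    using that unfolding edge_closed_def by blast
  have 1: "(Inr v \<in> K) = (Inl None \<in> K)" for v using K[of None v] by simp
  have 2: "(Inl x \<in> K) = (Inl None \<in> K)" for x
  proof (cases x)
    case (Some e)
    obtain v where "(e, v) \<in> G" using assms by blast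
    then show ?thesis using K[of "Some e" v] 1 Some by simp
  qed simp
  have "(y \<in> K) = (Inl None \<in> K)" for y using 1 2 by (cases y) auto
  then show "K = {} \<or> K = UNIV" by blast
qed

lemma supported_drop_node_circulation:
  fixes S :: "('e::finite option \<times> 'v::finite) set"
  assumes S: "is_tree S" and l: "supported l (drop_node S)" "marg l = (\<lambda>_. 0 :: real)"
  shows "l = (\<lambda>_. 0)"
proof -
  define k where "k \<epsilon> = (case \<epsilon> of (Some e, v) \<Rightarrow> l (e, v) | (None, v) \<Rightarrow> 0)" for \<epsilon> :: "'e option \<times> 'v"
  have s: "supported k S"
  proof (intro allI impI)
    fix \<epsilon> assume "\<epsilon> \<notin> S"
    then show "k \<epsilon> = 0" using l(1)
      by (cases \<epsilon>; cases "fst \<epsilon>") (auto simp: k_def)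
  qed
  have "marg k x = 0" for x
  proof (cases x)
    case (Inl y)
    then show ?thesis using fun_cong[OF l(2), of "Inl (the y)"]
      by (cases y) (auto simp: k_def)
  next
    case (Inr v)
    then show ?thesis using fun_cong[OF l(2), of "Inr v"]
      by (simp add: k_def UNIV_option_conv sum.reindex)
  qed
  then have "k = (\<lambda>_. 0)" by (intro is_tree_circulation[OF S s] ext) simp
  from fun_cong[OF this] have "l (e, v) = 0" for e v
    using \<open>k = (\<lambda>_. 0)\<close> by (metis k_def old.prod.case option.case(2))
  then show ?thesis by auto
qed

text \<open>The value at the new node is determined because hypertrees have a fixed sum. Deleting
  the new node from a tree leaves a forest, which extends to a spanning tree of G with at least the
  same degrees.\<close>

lemma bij_betw_hypertrees_add_node:
  fixes G :: "('e::finite \<times> 'v::finite) set"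
  assumes conn: "bg_connected G"
  shows "bij_betw (\<lambda>f. f \<circ> Some) (hypertrees (add_node G)) (sub_hypertrees G)"
proof -
  have sums: "f None + (\<Sum>e\<in>UNIV. f (Some e)) + 1 = CARD('v)" if "f \<in> hypertrees (add_node G)" for f
    using hypertrees_sum[OF that] by (simp add: UNIV_option_conv sum.reindex)
  have "inj_on (\<lambda>f. f \<circ> Some) (hypertrees (add_node G))"
  proof (rule inj_onI)
    fix f f' assume f: "f \<in> hypertrees (add_node G)" and f': "f' \<in> hypertrees (add_node G)"
      and eq: "f \<circ> Some = f' \<circ> Some"
    have *: "f (Some e) = f' (Some e)" for e using fun_cong[OF eq, of e] by simp
    then have "f None = f' None" using sums[OF f] sums[OF f'] by simp
    with * have "f x = f' x" for x by (cases x) auto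
    then show "f = f'" by blast
  qed
  moreover have "f \<circ> Some \<in> sub_hypertrees G" if f: "f \<in> hypertrees (add_node G)" for f
  proof -
    obtain S where S: "spanning_tree (add_node G) S" "\<And>a. degL S a = f a + 1"
      using f unfolding hypertrees_def by blast
    then have St: "is_tree S" "S \<subseteq> add_node G" by (simp_all add: spanning_tree_def)
    have sub: "drop_node S \<subseteq> G" using St(2) by (auto simp: drop_node_def)
    obtain F where F: "spanning_tree G F" "drop_node S \<subseteq> F"
      using spanning_tree_extend[OF conn sub supported_drop_node_circulation[OF St(1)]] by blast
    have Fc: "bg_connected F" using F(1) by (simp add: spanning_tree_def)
    have "(\<lambda>e. degL F e - 1) \<in> hypertrees G"
      unfolding hypertrees_def using F(1) connected_degL_pos[OF Fc] by force
    moreover have "(f \<circ> Some) e \<le> degL F e - 1" for e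
    proof -
      have "degL S (Some e) \<le> degL F e"
        by (rule card_mono) (use F(2) in \<open>auto simp: drop_node_def\<close>)
      then show ?thesis by (simp add: S(2))
    qed
    ultimately show ?thesis unfolding sub_hypertrees_def mem_Collect_eq by (intro bexI allI)
  qed
  moreover have "g \<in> (\<lambda>f. f \<circ> Some) ` hypertrees (add_node G)" if "g \<in> sub_hypertrees G" for g
  proof -
    obtain f where f: "f \<in> hypertrees G" "\<And>e. g e \<le> f e"
      using \<open>g \<in> sub_hypertrees G\<close> unfolding sub_hypertrees_def by blast
    obtain F where F: "spanning_tree G F" "\<And>e. degL F e = f e + 1"
      using f(1) unfolding hypertrees_def by blast
    have Ft: "is_tree F" using F(1) by (simp add: spanning_tree_def)
    \<comment> \<open>The tree of f is thinned to \<open>g e + 1\<close> edges at each e; the new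
      node will reconnect the pieces.\<close>
    have "\<exists>A. A \<subseteq> {v. (e, v) \<in> F} \<and> card A = g e + 1" for e
      by (rule obtain_subset_with_card_n[of "g e + 1" "{v. (e, v) \<in> F}"]) (use F(2) f(2) in auto)
    then obtain A where A: "\<And>e. A e \<subseteq> {v. (e, v) \<in> F}" "\<And>e. card (A e) = g e + 1" by metis
    define F0 where "F0 = {(e, v). v \<in> A e}"
    have F0: "F0 \<subseteq> F" using A(1) by (auto simp: F0_def)
    define F1 where "F1 = {(Some e, v) | e v. (e, v) \<in> F0}"
    have A_ne: "A e \<noteq> {}" for e using A(2)[of e] by auto
    have F1_iff: "(Some e, v) \<in> F1 \<longleftrightarrow> (e, v) \<in> F0" "(None, v) \<notin> F1" for e v
      by (auto simp: F1_def)
    have ex: "\<exists>v. (e, v) \<in> F0" for e using A_ne by (auto simp: F0_def)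
    have free: "l = (\<lambda>_. 0)" if l: "supported l F1" "marg l = (\<lambda>_. 0)" for l :: "_ \<Rightarrow> real"
    proof -
      have none: "l (None, v) = 0" for v using l(1) F1_iff(2) by blast
      have "(\<lambda>(e, v). l (Some e, v)) = (\<lambda>_. 0)"
      proof (rule is_tree_circulation[OF Ft])
        show "supported (\<lambda>(e, v). l (Some e, v)) F"
        proof (intro allI impI)
          fix \<epsilon> :: "'e \<times> 'v" assume "\<epsilon> \<notin> F"
          then have "(Some (fst \<epsilon>), snd \<epsilon>) \<notin> F1" using F0 F1_iff(1)[of "fst \<epsilon>" "snd \<epsilon>"] by auto
          then show "(case \<epsilon> of (e, v) \<Rightarrow> l (Some e, v)) = 0" using l(1) by (simp add: case_prod_beta)
        qed
        show "marg (\<lambda>(e, v). l (Some e, v)) = (\<lambda>_. 0)"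
        proof
          fix x :: "'e + 'v"
          show "marg (\<lambda>(e, v). l (Some e, v)) x = 0"
          proof (cases x)
            case (Inl e)
            then show ?thesis using fun_cong[OF l(2), of "Inl (Some e)"] by simp
          next
            case (Inr v)
            then show ?thesis using fun_cong[OF l(2), of "Inr v"] none
              by (simp add: UNIV_option_conv sum.reindex)
          qed
        qed
      qed
      then have some: "l (Some e, v) = 0" for e v by (metis old.prod.case)
      show ?thesis
      proof
        fix \<epsilon> show "l \<epsilon> = 0" using none some by (cases \<epsilon>; cases "fst \<epsilon>") auto
      qed
    qed
    have "F1 \<subseteq> add_node F0" by (auto simp: F1_def)
    \<comment> \<open>The extension takes place in \<open>add_node F0\<close> rather than
      \<open>add_node G\<close>, so only edges at the new node are added and the degrees
      \<open>g e + 1\<close> survive.\<close>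
    from spanning_tree_extend[OF bg_connected_add_node[OF ex] this free]
    obtain S where S: "spanning_tree (add_node F0) S" "F1 \<subseteq> S" by blast
    have St: "bg_connected S" "S \<subseteq> add_node F0" "is_tree S" using S(1) by (auto simp: spanning_tree_def)
    have "add_node F0 \<subseteq> add_node G" using F0 F(1) by (auto simp: add_node_def spanning_tree_def)
    then have SG: "spanning_tree (add_node G) S" using St by (auto simp: spanning_tree_def)
    have eqA: "{v. (Some e, v) \<in> S} = A e" for e
    proof
      show "{v. (Some e, v) \<in> S} \<subseteq> A e" using St(2) by (auto simp: add_node_def F0_def)
      show "A e \<subseteq> {v. (Some e, v) \<in> S}" using S(2) F1_iff by (auto simp: F0_def)
    qed
    have "(\<lambda>a. degL S a - 1) \<in> hypertrees (add_node G)"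
      unfolding hypertrees_def using SG connected_degL_pos[OF St(1)] by force
    moreover have "(\<lambda>a. degL S a - 1) \<circ> Some = g"
      by (rule ext) (simp add: eqA A(2))
    ultimately show ?thesis by blast
  qed
  ultimately show ?thesis unfolding bij_betw_def by blast
qed

section \<open>Lattice points of the cone over the root polytope\<close>

text \<open>The witnessing flow may be real; integral coefficients come later from the unimodularity
  of trees.\<close>

definition lattice_cone :: "('e::finite \<times> 'v::finite) set \<Rightarrow> ('e + 'v \<Rightarrow> nat) set" where
  "lattice_cone G = {p. flows G (\<lambda>x. real (p x)) \<noteq> {}}"

text \<open>The share \<open>1 / CARD('v)\<close> of a right node amounts to
  \<open>CARD('e) + 2\<close> units, so a single one exceeds the units of all left nodes together by
  2. The \<open>itself\<close> argument carries the two types.\<close>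

definition shift_unit :: "('e::finite \<times> 'v::finite) itself \<Rightarrow> real" where
  "shift_unit _ = 1 / (real CARD('v) * (real CARD('e) + 2))"

text \<open>Adding 1/CARD('v) at each right node, a much smaller amount at each left node, and the
  remainder at the new node makes every lattice point of the cone generic.\<close>

definition shift_point :: "('e::finite + 'v::finite \<Rightarrow> nat) \<Rightarrow> 'e option + 'v \<Rightarrow> real" where
  "shift_point p x = (case x of
      Inl None \<Rightarrow> 1 - real CARD('e) * shift_unit TYPE('e \<times> 'v)
    | Inl (Some e) \<Rightarrow> real (p (Inl e)) + shift_unit TYPE('e \<times> 'v)
    | Inr v \<Rightarrow> real (p (Inr v)) + 1 / real CARD('v))"

lemma sum_UNIV_option:
  fixes h :: "'a::finite option \<Rightarrow> 'r::comm_monoid_add"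
  shows "(\<Sum>x\<in>UNIV. h x) = h None + (\<Sum>a\<in>UNIV. h (Some a))"
  by (simp add: UNIV_option_conv sum.reindex)

lemma shift_unit_pos: "shift_unit TYPE('e::finite \<times> 'v::finite) > 0"
  by (simp add: shift_unit_def add_pos_pos)

lemma inverse_CARD_eq:
  "1 / real CARD('v::finite) = (real CARD('e::finite) + 2) * shift_unit TYPE('e \<times> 'v)"
proof -
  have "real CARD('e) + 2 \<noteq> 0" by (metis of_nat_0_le_iff add_nonneg_pos less_irrefl zero_less_numeral)
  then show ?thesis by (simp add: shift_unit_def)
qed

lemma one_eq_shift_unit:
  "1 = real CARD('v::finite) * (real CARD('e::finite) + 2) * shift_unit TYPE('e \<times> 'v)"
proof -
  have "real CARD('e) + 2 \<noteq> 0" by (metis of_nat_0_le_iff add_nonneg_pos less_irrefl zero_less_numeral)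
  then show ?thesis by (simp add: shift_unit_def)
qed

lemma cutsum_shift_point:
  fixes p :: "'e::finite + 'v::finite \<Rightarrow> nat"
  shows "cutsum (shift_point p) K =
    of_bool (Inl None \<in> K) * (1 - real CARD('e) * shift_unit TYPE('e \<times> 'v))
    + real (\<Sum>e\<in>{e. Inl (Some e) \<in> K}. p (Inl e))
    + real (card {e. Inl (Some e) \<in> K}) * shift_unit TYPE('e \<times> 'v)
    - real (\<Sum>v\<in>{v. Inr v \<in> K}. p (Inr v)) - real (card {v. Inr v \<in> K}) / real CARD('v)"
  unfolding cutsum_alt sum_UNIV_sum sum_UNIV_option
  by (simp add: shift_point_def sum.distrib sum_negf sum_subtractf)

lemma cutsum_shift_point_UNIV:
  fixes p :: "'e::finite + 'v::finite \<Rightarrow> nat"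
  shows "cutsum (shift_point p) UNIV = real (\<Sum>e\<in>UNIV. p (Inl e)) - real (\<Sum>v\<in>UNIV. p (Inr v))"
  by (simp add: cutsum_shift_point)

lemma lattice_cone_balanced:
  assumes "p \<in> lattice_cone G"
  shows "(\<Sum>e\<in>UNIV. p (Inl e)) = (\<Sum>v\<in>UNIV. p (Inr v))"
proof -
  obtain l where "l \<in> flows G (\<lambda>x. real (p x))" using assms by (auto simp: lattice_cone_def)
  then have "cutsum (\<lambda>x. real (p x)) UNIV = 0"
    using cutsum_marg_UNIV[of l] by (simp add: flows_def)
  then have "real (\<Sum>e\<in>UNIV. p (Inl e)) = real (\<Sum>v\<in>UNIV. p (Inr v))"
    by (simp add: cutsum_Plus)
  then show ?thesis by (simp only: of_nat_eq_iff)
qed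

text \<open>Counted in shift units, the equation shows that \<open>CARD('e) + 2\<close> divides the
  number of left nodes in K, which is therefore 0. Then K holds only right nodes, whose
  contributions are all negative.\<close>

lemma cutsum_shift_point_eq_0:
  fixes p :: "'e::finite + 'v::finite \<Rightarrow> nat" and K :: "('e option + 'v) set"
  assumes K: "cutsum (shift_point p) K = 0" and none: "Inl None \<notin> K"
  shows "K = {}"
proof -
  let ?X = "{e. Inl (Some e) \<in> K}" and ?Y = "{v. Inr v \<in> K}"
  let ?n = "CARD('e)" and ?m = "CARD('v)" and ?d = "shift_unit TYPE('e \<times> 'v)"
  define z where "z = int (\<Sum>e\<in>?X. p (Inl e)) - int (\<Sum>v\<in>?Y. p (Inr v))"
  have d: "?d > 0" by (rule shift_unit_pos)
  have "of_int z + real (card ?X) * ?d - real (card ?Y) / real ?m = 0"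
    using K none by (simp add: cutsum_shift_point z_def)
  then have "of_int z * (real ?m * (real ?n + 2) * ?d) + real (card ?X) * ?d
      - real (card ?Y) * ((real ?n + 2) * ?d) = 0"
    by (simp only: one_eq_shift_unit[symmetric] inverse_CARD_eq[symmetric]) simp
  then have "?d * (of_int z * (real ?m * (real ?n + 2)) + real (card ?X) - real (card ?Y) * (real ?n + 2)) = 0"
    by (simp add: algebra_simps)
  then have "of_int z * (real ?m * (real ?n + 2)) + real (card ?X) - real (card ?Y) * (real ?n + 2) = 0"
    using d by simp
  then have "of_int (z * (int ?m * (int ?n + 2)) + int (card ?X) - int (card ?Y) * (int ?n + 2)) = (0::real)"
    by simp
  then have eq: "z * (int ?m * (int ?n + 2)) + int (card ?X) - int (card ?Y) * (int ?n + 2) = 0"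
    by (simp only: of_int_eq_0_iff)
  then have "int (card ?X) = int (?n + 2) * (int (card ?Y) - z * int ?m)"
    by (simp add: algebra_simps)
  then have "?n + 2 dvd card ?X" by (metis dvd_triv_left int_dvd_int_iff)
  moreover have "card ?X \<le> ?n" by (simp add: card_mono)
  ultimately have "card ?X = 0"
    using dvd_imp_le[of "?n + 2" "card ?X"] by linarith
  then have X: "?X = {}" by (metis card_0_eq finite)
  from eq \<open>card ?X = 0\<close> have "(int ?n + 2) * (int (card ?Y) - z * int ?m) = 0"
    by (simp add: algebra_simps)
  then have Y: "int (card ?Y) = int ?m * z" by (simp add: mult.commute)
  have "z \<le> 0" by (simp add: z_def X sum_nonneg)
  then have "int ?m * z \<le> 0" by (simp add: mult_nonneg_nonpos)
  with Y have "card ?Y = 0" by linarith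
  then have "?Y = {}" by (metis card_0_eq finite)
  have "x \<notin> K" for x
  proof (cases x)
    case (Inl y) then show ?thesis using none X by (cases y) auto
  next
    case (Inr v) then show ?thesis using \<open>?Y = {}\<close> by auto
  qed
  then show ?thesis by blast
qed

lemma generic_shift_point:
  assumes "(\<Sum>e\<in>UNIV. p (Inl e)) = (\<Sum>v\<in>UNIV. p (Inr v))"
  shows "generic (shift_point p)"
  unfolding generic_def
proof (intro allI impI)
  fix K assume K: "cutsum (shift_point p) K = 0"
  show "K = {} \<or> K = UNIV"
  proof (cases "Inl None \<in> K")
    case False
    then show ?thesis using cutsum_shift_point_eq_0[OF K] by blast
  next
    case True
    have "cutsum (shift_point p) (- K) = 0"
      unfolding cutsum_Compl cutsum_shift_point_UNIV K by (simp only: assms)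
    from cutsum_shift_point_eq_0[OF this] True show ?thesis by auto
  qed
qed

section \<open>The shift as a signed flow on a tree\<close>

definition tree_shift :: "('e::finite option \<times> 'v::finite) set \<Rightarrow> 'e option \<times> 'v \<Rightarrow> real" where
  "tree_shift S = (SOME l. supported l S \<and> marg l = shift_point (\<lambda>_. 0))"

lemma tree_shift:
  assumes "is_tree S"
  shows "supported (tree_shift S) S" "marg (tree_shift S) = shift_point (\<lambda>_. 0)"
proof -
  have "cutsum (shift_point (\<lambda>_. 0)) UNIV = 0" by (simp add: cutsum_shift_point_UNIV)
  from connected_flow_ex[OF is_tree_connected[OF assms] this]
  have "supported (tree_shift S) S \<and> marg (tree_shift S) = shift_point (\<lambda>_. 0)"
    unfolding tree_shift_def by (rule someI_ex)
  then show "supported (tree_shift S) S" "marg (tree_shift S) = shift_point (\<lambda>_. 0)" by blast+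
qed

text \<open>The far side of the edge lacks the new node and contains v, worth
  \<open>CARD('e) + 2\<close> units, against at most \<open>CARD('e)\<close> units of left
  nodes.\<close>

lemma tree_shift_root_above:
  fixes S :: "('e::finite option \<times> 'v::finite) set"
  assumes S: "is_tree S" and xv: "(x, v) \<in> S" and r: "Inl None \<in> tree_cut S (x, v)"
  shows "2 * shift_unit TYPE('e \<times> 'v) \<le> tree_shift S (x, v)" "tree_shift S (x, v) \<le> 1"
proof -
  let ?d = "shift_unit TYPE('e \<times> 'v)" and ?K = "- tree_cut S (x, v)"
  let ?X = "{e. Inl (Some e) \<in> ?K}" and ?Y = "{v. Inr v \<in> ?K}"
  have d: "?d > 0" by (rule shift_unit_pos)
  have "tree_shift S (x, v) = cutsum (shift_point (\<lambda>_. 0)) (tree_cut S (x, v))"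
    using is_tree_flow_eq_cutsum[OF S tree_shift(1)[OF S] xv] tree_shift(2)[OF S] by simp
  also have "\<dots> = - cutsum (shift_point (\<lambda>_. 0)) ?K"
    unfolding cutsum_Compl cutsum_shift_point_UNIV by simp
  also have "\<dots> = real (card ?Y) / real CARD('v) - real (card ?X) * ?d"
    using r by (simp add: cutsum_shift_point)
  finally have eq: "tree_shift S (x, v) = real (card ?Y) / real CARD('v) - real (card ?X) * ?d" .
  have "v \<in> ?Y" using tree_cut(3)[OF S xv] by simp
  then have "card ?Y > 0" by (metis card_gt_0_iff empty_iff finite)
  then have "1 / real CARD('v) \<le> real (card ?Y) / real CARD('v)"
    by (intro divide_right_mono) auto
  moreover have "real (card ?X) * ?d \<le> real CARD('e) * ?d"
    by (rule mult_right_mono) (use d in \<open>auto simp: card_mono\<close>)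
  ultimately show "2 * ?d \<le> tree_shift S (x, v)"
    unfolding eq inverse_CARD_eq[where 'e='e] by (simp add: algebra_simps)
  have "real (card ?Y) / real CARD('v) \<le> 1" by (simp add: card_mono)
  moreover have "real (card ?X) * ?d \<ge> 0" using d by simp
  ultimately show "tree_shift S (x, v) \<le> 1" unfolding eq by linarith
qed

text \<open>The cut now lacks the new node, so its sum compares left units with right shares
  directly. It does not contain v, which keeps the value above -1.\<close>

lemma tree_shift_root_below:
  fixes S :: "('e::finite option \<times> 'v::finite) set"
  assumes S: "is_tree S" and xv: "(x, v) \<in> S" and r: "Inl None \<notin> tree_cut S (x, v)"
  shows "tree_shift S (x, v) > -1" "tree_shift S (x, v) \<le> 1" "tree_shift S (x, v) \<noteq> 0"
proof -
  let ?d = "shift_unit TYPE('e \<times> 'v)" and ?K = "tree_cut S (x, v)"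
  let ?X = "{e. Inl (Some e) \<in> ?K}" and ?Y = "{v. Inr v \<in> ?K}"
  have d: "?d > 0" by (rule shift_unit_pos)
  have "tree_shift S (x, v) = cutsum (shift_point (\<lambda>_. 0)) ?K"
    using is_tree_flow_eq_cutsum[OF S tree_shift(1)[OF S] xv] tree_shift(2)[OF S] by simp
  also have "\<dots> = real (card ?X) * ?d - real (card ?Y) / real CARD('v)"
    using r by (simp add: cutsum_shift_point)
  finally have eq: "tree_shift S (x, v) = real (card ?X) * ?d - real (card ?Y) / real CARD('v)" .
  have "generic (shift_point (\<lambda>_::'e + 'v. 0))" by (rule generic_shift_point) simp
  then show "tree_shift S (x, v) \<noteq> 0"
    by (rule generic_flow_pos[OF _ S tree_shift[OF S] xv])
  have "?Y \<subset> UNIV" using tree_cut(3)[OF S xv] by blast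
  then have "card ?Y < CARD('v)" by (rule psubset_card_mono[rotated]) simp
  then have "real (card ?Y) / real CARD('v) < 1" by simp
  moreover have "real (card ?X) * ?d \<ge> 0" using d by simp
  ultimately show "tree_shift S (x, v) > -1" unfolding eq by linarith
  have "real (card ?X) * ?d \<le> (real CARD('e) + 2) * ?d"
  proof (rule mult_right_mono)
    have "card ?X \<le> CARD('e)" by (simp add: card_mono)
    then show "real (card ?X) \<le> real CARD('e) + 2" by linarith
  qed (use d in simp)
  also have "\<dots> = 1 / real CARD('v)" by (rule inverse_CARD_eq[symmetric])
  also have "\<dots> \<le> 1" by (simp add: Suc_leI)
  finally show "tree_shift S (x, v) \<le> 1" unfolding eq
    by (smt (verit) divide_nonneg_nonneg of_nat_0_le_iff)
qed

text \<open>These bounds make rounding unambiguous: a natural number plus the shift is positive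
  exactly if the number or the shift is positive, and the upper bound keeps a negative integer plus
  the shift from being positive.\<close>

lemma tree_shift_bounds:
  fixes S :: "('e::finite option \<times> 'v::finite) set"
  assumes S: "is_tree S" and "\<epsilon> \<in> S"
  shows "tree_shift S \<epsilon> > -1" "tree_shift S \<epsilon> \<le> 1" "tree_shift S \<epsilon> \<noteq> 0"
proof -
  obtain x v where \<epsilon>: "\<epsilon> = (x, v)" by (cases \<epsilon>)
  then have xv: "(x, v) \<in> S" using assms(2) by simp
  have "shift_unit TYPE('e \<times> 'v) > 0" by (rule shift_unit_pos)
  then show "tree_shift S \<epsilon> > -1" "tree_shift S \<epsilon> \<le> 1" "tree_shift S \<epsilon> \<noteq> 0"
    using tree_shift_root_above[OF S xv] tree_shift_root_below[OF S xv] unfolding \<epsilon>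
    by (cases "Inl None \<in> tree_cut S (x, v)"; force)+
qed

lemma tree_shift_None_pos:
  fixes S :: "('e::finite option \<times> 'v::finite) set"
  assumes S: "is_tree S" and "(None, v) \<in> S"
  shows "tree_shift S (None, v) > 0"
proof -
  have "shift_unit TYPE('e \<times> 'v) > 0" by (rule shift_unit_pos)
  then show ?thesis
    using tree_shift_root_above(1)[OF assms tree_cut(2)[OF assms]] by linarith
qed

text \<open>The facets excluded from the half-open cone of S: the coefficients that must be at least
  1 for the shifted point to lie inside.\<close>

definition forced_edges :: "('e::finite option \<times> 'v::finite) set \<Rightarrow> ('e \<times> 'v) set" where
  "forced_edges S = {(e, v). (Some e, v) \<in> S \<and> tree_shift S (Some e, v) < 0}"

text \<open>Seen from the new node as root, e has one edge towards the root, and each of its other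
  edges carries at least 2 shift units. The total at e is one unit, so the edge towards the root is
  negative exactly if there are others.\<close>

lemma degL_forced_edges:
  fixes S :: "('e::finite option \<times> 'v::finite) set"
  assumes S: "is_tree S"
  shows "degL (forced_edges S) e = of_bool (2 \<le> degL S (Some e))"
proof -
  let ?d = "shift_unit TYPE('e \<times> 'v)"
  have d: "?d > 0" by (rule shift_unit_pos)
  define A where "A = {v. (Some e, v) \<in> S}"
  define D where "D = {v. (Some e, v) \<in> S \<and> Inl None \<in> tree_cut S (Some e, v)}"
  have "real (card D) = real (card A) - 1"
    using tree_cut_root_left[OF S, of "Some e" "Inl None"] by (simp add: A_def D_def)
  then have cA: "card A = card D + 1" by linarith
  have DA: "D \<subseteq> A" by (auto simp: A_def D_def)
  then have "card (A - D) = 1" using cA by (simp add: card_Diff_subset)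
  then obtain w where w: "A - D = {w}" by (auto simp: card_1_singleton_iff)
  have A: "A = insert w D" "w \<notin> D" using w DA by auto
  have "(\<Sum>v\<in>A. tree_shift S (Some e, v)) = (\<Sum>v\<in>UNIV. tree_shift S (Some e, v))"
    by (rule sum.mono_neutral_left) (use tree_shift(1)[OF S] in \<open>auto simp: A_def\<close>)
  also have "\<dots> = ?d"
    using fun_cong[OF tree_shift(2)[OF S], of "Inl (Some e)"] by (simp add: shift_point_def)
  finally have sum: "tree_shift S (Some e, w) + (\<Sum>v\<in>D. tree_shift S (Some e, v)) = ?d"
    using A by simp
  have Dge: "2 * ?d \<le> tree_shift S (Some e, v)" if "v \<in> D" for v
    using tree_shift_root_above(1)[OF S] that unfolding D_def by blast
  then have "(\<Sum>v\<in>D. 2 * ?d) \<le> (\<Sum>v\<in>D. tree_shift S (Some e, v))" by (rule sum_mono)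
  then have le: "tree_shift S (Some e, w) \<le> ?d - real (card D) * (2 * ?d)" using sum by simp
  have "{v. (e, v) \<in> forced_edges S} = {v\<in>A. tree_shift S (Some e, v) < 0}"
    by (auto simp: forced_edges_def A_def)
  also have "\<dots> = (if card D = 0 then {} else {w})"
  proof (cases "card D = 0")
    case True
    then have "D = {}" by simp
    then show ?thesis using sum d A by auto
  next
    case False
    then have "1 \<le> card D" by linarith
    then have "1 \<le> real (card D)" by linarith
    then have "real (card D) * (2 * ?d) \<ge> 1 * (2 * ?d)"
      by (intro mult_right_mono) (use d in auto)
    then have "tree_shift S (Some e, w) < 0" using le d by linarith
    moreover have "\<not> tree_shift S (Some e, v) < 0" if "v \<in> D" for v
      using Dge[OF that] d by linarith
    ultimately show ?thesis using False A by auto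
  qed
  finally have eq: "{v. (e, v) \<in> forced_edges S} = (if card D = 0 then {} else {w})" .
  have "degL S (Some e) = card D + 1" using cA by (simp add: A_def)
  then show ?thesis unfolding eq by (cases "card D") simp_all
qed

definition lift_flow :: "('e \<times> 'v \<Rightarrow> nat) \<Rightarrow> 'e option \<times> 'v \<Rightarrow> real" where
  "lift_flow k \<epsilon> = (case fst \<epsilon> of None \<Rightarrow> 0 | Some e \<Rightarrow> real (k (e, snd \<epsilon>)))"

lemma lift_flow_simps [simp]: "lift_flow k (None, v) = 0" "lift_flow k (Some e, v) = real (k (e, v))"
  by (simp_all add: lift_flow_def)

lemma marg_lift_flow:
  "marg (lift_flow k) x = shift_point (marg k) x - shift_point (\<lambda>_. 0) x"
proof (cases x)
  case (Inl y)
  then show ?thesis by (cases y) (simp_all add: shift_point_def)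
next
  case (Inr v)
  then show ?thesis by (simp add: shift_point_def sum_UNIV_option)
qed

text \<open>Coefficients of the lattice points in the half-open cone of S. Edges at the new node are
  absent because the marginal there is 0.\<close>

definition tree_points :: "('e::finite option \<times> 'v::finite) set \<Rightarrow> ('e \<times> 'v \<Rightarrow> nat) set" where
  "tree_points S = {k. supported k (drop_node S) \<and> (\<forall>\<epsilon>\<in>forced_edges S. 1 \<le> k \<epsilon>)}"

lemma tree_points_flow:
  fixes S :: "('e::finite option \<times> 'v::finite) set"
  assumes S: "is_tree S" and k: "k \<in> tree_points S"
  shows "(\<lambda>\<epsilon>. lift_flow k \<epsilon> + tree_shift S \<epsilon>) \<in> flows S (shift_point (marg k))"
    and "\<And>\<epsilon>. \<epsilon> \<in> S \<Longrightarrow> 0 < lift_flow k \<epsilon> + tree_shift S \<epsilon>"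
proof -
  have k': "supported k (drop_node S)" "\<And>\<epsilon>. \<epsilon> \<in> forced_edges S \<Longrightarrow> 1 \<le> k \<epsilon>"
    using k by (auto simp: tree_points_def)
  have supp: "lift_flow k \<epsilon> + tree_shift S \<epsilon> = 0" if "\<epsilon> \<notin> S" for \<epsilon>
  proof -
    obtain x v where \<epsilon>: "\<epsilon> = (x, v)" by (cases \<epsilon>)
    have "tree_shift S \<epsilon> = 0" using tree_shift(1)[OF S] that by blast
    moreover have "lift_flow k \<epsilon> = 0"
      using k'(1) that by (cases x) (auto simp: \<epsilon>)
    ultimately show ?thesis by simp
  qed
  show pos: "0 < lift_flow k \<epsilon> + tree_shift S \<epsilon>" if "\<epsilon> \<in> S" for \<epsilon>
  proof -
    obtain x v where \<epsilon>: "\<epsilon> = (x, v)" by (cases \<epsilon>)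
    show ?thesis
    proof (cases x)
      case None
      then show ?thesis using tree_shift_None_pos[OF S, of v] that by (simp add: \<epsilon>)
    next
      case (Some e)
      note b = tree_shift_bounds[OF S that]
      show ?thesis
      proof (cases "tree_shift S \<epsilon> < 0")
        case True
        then have "1 \<le> k (e, v)" using that by (intro k'(2)) (auto simp: forced_edges_def \<epsilon> Some)
        then have "1 \<le> lift_flow k \<epsilon>" by (simp add: \<epsilon> Some)
        then show ?thesis using b by linarith
      next
        case False
        moreover have "0 \<le> lift_flow k \<epsilon>" by (simp add: \<epsilon> Some)
        ultimately show ?thesis using b by linarith
      qed
    qed
  qed
  show "(\<lambda>\<epsilon>. lift_flow k \<epsilon> + tree_shift S \<epsilon>) \<in> flows S (shift_point (marg k))"
    unfolding flows_def
  proof (intro CollectI conjI allI impI ext)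
    show "0 \<le> lift_flow k \<epsilon> + tree_shift S \<epsilon>" for \<epsilon>
      using pos[of \<epsilon>] supp[of \<epsilon>] by (cases "\<epsilon> \<in> S") auto
    show "marg (\<lambda>\<epsilon>. lift_flow k \<epsilon> + tree_shift S \<epsilon>) x = shift_point (marg k) x" for x
      by (simp add: marg_add marg_lift_flow tree_shift(2)[OF S])
  qed (rule supp)
qed

lemma flows_shift_point_ne:
  fixes G :: "('e::finite \<times> 'v::finite) set"
  assumes p: "p \<in> lattice_cone G" and ex: "\<And>e. \<exists>v. (e, v) \<in> G"
  shows "flows (add_node G) (shift_point p) \<noteq> {}"
proof -
  let ?d = "shift_unit TYPE('e \<times> 'v)"
  have d: "?d > 0" by (rule shift_unit_pos)
  obtain l where l: "l \<in> flows G (\<lambda>x. real (p x))" using p by (auto simp: lattice_cone_def)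
  obtain t where t: "\<And>e. (e, t e) \<in> G" using ex by metis
  \<comment> \<open>Each left node sends its unit along one edge \<open>t e\<close>, and the new
    node fills up every right share; at most \<open>CARD('e)\<close> of the
    \<open>CARD('e) + 2\<close> units of a share are already taken.\<close>
  define k where "k \<epsilon> = (case \<epsilon> of (Some e, v) \<Rightarrow> l (e, v) + ?d * of_bool (v = t e)
      | (None, v) \<Rightarrow> 1 / real CARD('v) - ?d * (\<Sum>e\<in>UNIV. of_bool (v = t e)))" for \<epsilon>
  have le: "(\<Sum>e\<in>(UNIV::'e set). of_bool (v = t e)) \<le> real CARD('e)" for v
  proof -
    have "(\<Sum>e\<in>(UNIV::'e set). of_bool (v = t e)) \<le> (\<Sum>e\<in>(UNIV::'e set). (1::real))"
      by (rule sum_mono) auto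
    then show ?thesis by simp
  qed
  have one: "(\<Sum>v\<in>UNIV. of_bool (v = t e)) = (1::real)" for e
    by (simp add: of_bool_def)
  have margl: "marg l x = real (p x)" for x using l by (auto simp: flows_def)
  have "k \<in> flows (add_node G) (shift_point p)"
    unfolding flows_def
  proof (intro CollectI conjI allI impI ext)
    fix \<epsilon> :: "'e option \<times> 'v"
    obtain x v where \<epsilon>: "\<epsilon> = (x, v)" by (cases \<epsilon>)
    show "0 \<le> k \<epsilon>"
    proof (cases x)
      case None
      have "?d * (\<Sum>e\<in>(UNIV::'e set). of_bool (v = t e)) \<le> ?d * (real CARD('e) + 2)"
        by (rule mult_left_mono) (use le[of v] d in auto)
      then show ?thesis by (simp add: \<epsilon> None k_def inverse_CARD_eq[where 'e='e] mult.commute)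
    next
      case (Some e)
      then show ?thesis using l d by (simp add: \<epsilon> k_def flows_def)
    qed
    show "k \<epsilon> = 0" if "\<epsilon> \<notin> add_node G"
    proof (cases x)
      case (Some e)
      then have "(e, v) \<notin> G" using that \<epsilon> by simp
      then show ?thesis using l t by (auto simp: \<epsilon> k_def Some flows_def)
    qed (use that \<epsilon> in simp)
  next
    fix x :: "'e option + 'v"
    show "marg k x = shift_point p x"
    proof (cases x)
      case (Inl y)
      show ?thesis
      proof (cases y)
        case None
        have "(\<Sum>v\<in>UNIV. \<Sum>e\<in>(UNIV::'e set). of_bool (v = t e)) = (\<Sum>e\<in>(UNIV::'e set). (1::real))"
          by (subst sum.swap) (simp only: one)
        then show ?thesis
          by (simp add: Inl None k_def shift_point_def sum_subtractf sum_distrib_left[symmetric] mult.commute)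
      next
        case (Some e)
        then show ?thesis using margl[of "Inl e"] one[of e]
          by (simp add: Inl k_def shift_point_def sum.distrib sum_distrib_left[symmetric])
      qed
    next
      case (Inr v)
      then show ?thesis using margl[of "Inr v"]
        by (simp add: k_def shift_point_def sum_UNIV_option sum.distrib sum_distrib_left[symmetric])
    qed
  qed
  then show ?thesis by blast
qed

text \<open>A shifted lattice point is generic and so interior to the cone of one lexicographic
  tree. Removing \<open>tree_shift\<close> leaves an integral flow, and the bounds on the shift turn
  positivity into membership in \<open>tree_points\<close>.\<close>

lemma bij_betw_tree_points_lattice_cone:
  fixes G :: "('e::finite \<times> 'v::finite) set"
  assumes ex: "\<And>e. \<exists>v. (e, v) \<in> G"
  shows "bij_betw (\<lambda>(S, k). marg k) (Sigma (lex_trees (add_node G)) tree_points) (lattice_cone G)"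
proof -
  let ?H = "add_node G"
  have tree: "is_tree S" "S \<subseteq> ?H" if "S \<in> lex_trees ?H" for S
    using that by (auto simp: lex_trees_def spanning_tree_def)
  have cone: "marg k \<in> lattice_cone G" if S: "S \<in> lex_trees ?H" and k: "k \<in> tree_points S" for S k
  proof -
    have "drop_node S \<subseteq> G" using tree(2)[OF S] by (auto simp: drop_node_def)
    then have "(\<lambda>\<epsilon>. real (k \<epsilon>)) \<in> flows G (\<lambda>x. real (marg k x))"
      using k unfolding flows_def tree_points_def by (auto simp: marg_of_nat fun_eq_iff simp del: marg_simps)
    then show ?thesis unfolding lattice_cone_def by blast
  qed
  have "S = S' \<and> k = k'" if S: "S \<in> lex_trees ?H" "S' \<in> lex_trees ?H"
    and k: "k \<in> tree_points S" "k' \<in> tree_points S'" and eq: "marg k = marg k'" for S S' k k'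
  proof
    note f = tree_points_flow[OF tree(1)[OF S(1)] k(1)] and f' = tree_points_flow(1)[OF tree(1)[OF S(2)] k(2)]
    note f'' = f'[folded eq]
    show SS: "S = S'"
      by (rule lex_trees_eq[OF S f(1)]) (use f(2) f'' in force)+
    have "(\<lambda>\<epsilon>. lift_flow k \<epsilon> + tree_shift S \<epsilon>) = (\<lambda>\<epsilon>. lift_flow k' \<epsilon> + tree_shift S' \<epsilon>)"
      by (rule lex_trees_flow_eq[OF S f(1) f''])
    from fun_cong[OF this] have "k (e, v) = k' (e, v)" for e v
      using SS by (metis add_right_cancel lift_flow_simps(2) of_nat_eq_iff)
    then show "k = k'" by (auto simp: fun_eq_iff)
  qed
  then have "inj_on (\<lambda>(S, k). marg k) (Sigma (lex_trees ?H) tree_points)"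
    by (auto simp: inj_on_def)
  moreover have "\<exists>S\<in>lex_trees ?H. \<exists>k\<in>tree_points S. p = marg k" if p: "p \<in> lattice_cone G" for p
  proof -
    have gen: "generic (shift_point p)" by (rule generic_shift_point[OF lattice_cone_balanced[OF p]])
    obtain S l where S: "S \<in> lex_trees ?H" and l: "l \<in> flows S (shift_point p)"
      using generic_lex_tree_ex[OF gen flows_shift_point_ne[OF p ex]] by blast
    note t = tree(1)[OF S]
    have l': "supported l S" "marg l = shift_point p" "\<And>\<epsilon>. 0 \<le> l \<epsilon>" using l by (auto simp: flows_def)
    have lpos: "0 < l \<epsilon>" if "\<epsilon> \<in> S" for \<epsilon>
      using generic_flow_pos[OF gen t l'(1,2) that] l'(3)[of \<epsilon>] by simp
    define h where "h \<epsilon> = l \<epsilon> - tree_shift S \<epsilon>" for \<epsilon>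
    have hS: "supported h S" using l'(1) tree_shift(1)[OF t] by (simp add: h_def)
    have hm: "marg h x = shift_point p x - shift_point (\<lambda>_. 0) x" for x
      unfolding h_def by (simp add: marg_diff l'(2) tree_shift(2)[OF t])
    have hm_simps: "marg h (Inl None) = 0" "marg h (Inl (Some e)) = real (p (Inl e))"
      "marg h (Inr v) = real (p (Inr v))" for e v
      unfolding hm by (simp_all add: shift_point_def)
    have "marg h x \<in> \<int>" for x
      unfolding hm by (cases x; cases "projl x") (auto simp: shift_point_def)
    then have hint: "h \<epsilon> \<in> \<int>" for \<epsilon> by (rule is_tree_flow_Ints[OF t hS])
    have hge: "0 \<le> h \<epsilon>" and hge1: "tree_shift S \<epsilon> < 0 \<Longrightarrow> 1 \<le> h \<epsilon>" for \<epsilon>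
    proof -
      obtain z where z: "h \<epsilon> = of_int z" using hint[of \<epsilon>] by (auto elim: Ints_cases)
      show "0 \<le> h \<epsilon>"
      proof (cases "\<epsilon> \<in> S")
        case True
        have "h \<epsilon> > -1" using lpos[OF True] tree_shift_bounds(2)[OF t True] by (simp add: h_def)
        then have "real_of_int (-1) < real_of_int z" by (simp add: z)
        then have "-1 < z" by (simp only: of_int_less_iff)
        then show ?thesis by (simp add: z)
      qed (use hS in simp)
      show "1 \<le> h \<epsilon>" if "tree_shift S \<epsilon> < 0"
      proof -
        have "h \<epsilon> > 0" using l'(3)[of \<epsilon>] that by (simp add: h_def)
        then have "0 < z" by (simp add: z)
        then show ?thesis by (simp add: z)
      qed
    qed
    \<comment> \<open>The shift accounts for the whole marginal at the new node, so the nonnegative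
      rest vanishes on its edges.\<close>
    have hnone: "h (None, v) = 0" for v
      using hm_simps(1) sum_nonneg_eq_0_iff[of UNIV "\<lambda>v. h (None, v)"] hge by simp
    define k where "k \<epsilon> = nat \<lfloor>h (Some (fst \<epsilon>), snd \<epsilon>)\<rfloor>" for \<epsilon>
    have k: "real (k (e, v)) = h (Some e, v)" for e v
      using hint[of "(Some e, v)"] hge[of "(Some e, v)"] by (auto simp: k_def elim!: Ints_cases)
    have "k \<in> tree_points S"
      unfolding tree_points_def
    proof (intro CollectI conjI allI impI ballI)
      fix \<epsilon> :: "'e \<times> 'v"
      obtain e v where \<epsilon>: "\<epsilon> = (e, v)" by (cases \<epsilon>)
      show "k \<epsilon> = 0" if "\<epsilon> \<notin> drop_node S"
        using hS that by (simp add: \<epsilon> k_def)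
      show "1 \<le> k \<epsilon>" if "\<epsilon> \<in> forced_edges S"
      proof -
        have "1 \<le> real (k (e, v))" unfolding k by (rule hge1) (use that in \<open>simp add: \<epsilon> forced_edges_def\<close>)
        then show ?thesis by (simp add: \<epsilon>)
      qed
    qed
    moreover have "p = marg k"
    proof
      fix x
      have "real (p x) = real (marg k x)"
      proof (cases x)
        case (Inl e)
        then show ?thesis using hm_simps(2)[of e] by (simp add: k)
      next
        case (Inr v)
        then show ?thesis using hm_simps(3)[of v] by (simp add: k hnone sum_UNIV_option)
      qed
      then show "p x = marg k x" by (simp only: of_nat_eq_iff)
    qed
    ultimately show ?thesis using S by blast
  qed
  ultimately show ?thesis unfolding bij_betw_def using cone by (auto simp: image_iff)
qed

section \<open>Generating function of the lattice points\<close>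

lemma has_sum_power_real:
  assumes "0 < x" "x < (1::real)"
  shows "((\<lambda>j. x ^ j) has_sum (1 / (1 - x))) UNIV"
    and "((\<lambda>j. x ^ j) has_sum (x / (1 - x))) {1..}"
proof -
  show "((\<lambda>j. x ^ j) has_sum (1 / (1 - x))) UNIV"
    by (rule sums_nonneg_imp_has_sum) (use assms geometric_sums[of x] in auto)
  show "((\<lambda>j. x ^ j) has_sum (x / (1 - x))) {1..}"
    using has_sum_geometric_from_1[of x] assms by simp
qed

text \<open>A product over the edges of geometric series that start at 1 on R and at 0 on the rest
  of S, with a single term off S.\<close>

lemma has_sum_power_supported:
  fixes R S :: "'i::finite set"
  assumes x: "0 < x" "x < (1::real)" and RS: "R \<subseteq> S"
  shows "((\<lambda>k. x ^ (\<Sum>\<epsilon>\<in>UNIV. k \<epsilon>)) has_sum (x ^ card R / (1 - x) ^ card S))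
    {k. supported k S \<and> (\<forall>\<epsilon>\<in>R. 1 \<le> k \<epsilon>)}"
proof -
  define B :: "'i \<Rightarrow> nat set" where "B \<epsilon> = (if \<epsilon> \<in> R then {1..} else if \<epsilon> \<in> S then UNIV else {0})" for \<epsilon>
  define c where "c \<epsilon> = (if \<epsilon> \<in> R then x / (1 - x) else if \<epsilon> \<in> S then 1 / (1 - x) else 1)" for \<epsilon>
  have hs: "((\<lambda>j. x ^ j) has_sum c \<epsilon>) (B \<epsilon>)" for \<epsilon>
    using has_sum_power_real[OF x] by (auto simp: B_def c_def has_sum_finite_iff)
  have abs: "(\<lambda>j. norm (x ^ j)) summable_on B \<epsilon>" for \<epsilon>
    using hs[of \<epsilon>] x by (auto simp: summable_on_def)
  have set_eq: "{k. supported k S \<and> (\<forall>\<epsilon>\<in>R. 1 \<le> k \<epsilon>)} = (\<Pi>\<^sub>E \<epsilon>\<in>UNIV. B \<epsilon>)"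
    using RS by (fastforce simp: B_def PiE_UNIV_domain Pi_def split: if_splits)
  have "infsum (\<lambda>k. \<Prod>\<epsilon>\<in>UNIV. x ^ k \<epsilon>) (\<Pi>\<^sub>E \<epsilon>\<in>UNIV. B \<epsilon>) = (\<Prod>\<epsilon>\<in>UNIV. infsum (\<lambda>j. x ^ j) (B \<epsilon>))"
    by (rule infsum_prod_PiE_abs) (use abs in auto)
  also have "\<dots> = (\<Prod>\<epsilon>\<in>UNIV. c \<epsilon>)"
    using infsumI[OF hs] by simp
  also have "\<dots> = x ^ card R / (1 - x) ^ card S"
  proof -
    have "c \<epsilon> = (if \<epsilon> \<in> R then x else 1) * (if \<epsilon> \<in> S then 1 / (1 - x) else 1)" for \<epsilon>
      using RS by (auto simp: c_def)
    then have "(\<Prod>\<epsilon>\<in>UNIV. c \<epsilon>) = x ^ card R * (1 / (1 - x)) ^ card S"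
      by (simp add: prod.distrib prod.If_cases)
    then show ?thesis by (simp add: power_divide)
  qed
  finally have i: "infsum (\<lambda>k. x ^ (\<Sum>\<epsilon>\<in>UNIV. k \<epsilon>)) (\<Pi>\<^sub>E \<epsilon>\<in>UNIV. B \<epsilon>) = x ^ card R / (1 - x) ^ card S"
    by (simp add: power_sum)
  \<comment> \<open>A family that is not summable has \<open>infsum\<close> 0 by convention, so a
    nonzero value yields summability.\<close>
  moreover have "x ^ card R / (1 - x) ^ card S \<noteq> 0" using x by simp
  ultimately have "(\<lambda>k. x ^ (\<Sum>\<epsilon>\<in>UNIV. k \<epsilon>)) summable_on (\<Pi>\<^sub>E \<epsilon>\<in>UNIV. B \<epsilon>)"
    by (metis infsum_not_exists)
  from has_sum_infsum[OF this] show ?thesis unfolding set_eq i .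
qed

lemma has_sum_finite_Sigma:
  fixes f :: "'a \<times> 'b \<Rightarrow> 'c::topological_comm_monoid_add"
  assumes "finite A" "\<And>a. a \<in> A \<Longrightarrow> ((\<lambda>y. f (a, y)) has_sum g a) (B a)"
  shows "(f has_sum (\<Sum>a\<in>A. g a)) (Sigma A B)"
  using assms
proof (induction A)
  case (insert a A)
  have "inj_on (Pair a) (B a)" by (auto simp: inj_on_def)
  then have "(f has_sum g a) (Pair a ` B a)"
    using insert.prems[of a] by (simp add: has_sum_reindex o_def)
  moreover have "(f has_sum (\<Sum>a\<in>A. g a)) (Sigma A B)" by (rule insert.IH) (use insert.prems in auto)
  moreover have "Pair a ` B a \<inter> Sigma A B = {}" using insert.hyps by auto
  ultimately have "(f has_sum (g a + (\<Sum>a\<in>A. g a))) (Pair a ` B a \<union> Sigma A B)"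
    by (rule has_sum_Un_disjoint)
  moreover have "Pair a ` B a \<union> Sigma A B = Sigma (insert a A) B" by auto
  ultimately show ?case using insert.hyps by simp
qed auto

lemma sum_marg_Inl: "(\<Sum>e\<in>UNIV. marg k (Inl e)) = (\<Sum>\<epsilon>\<in>UNIV. k \<epsilon>)"
  by (simp add: sum_UNIV_prod)

lemma lattice_cone_has_sum:
  fixes G :: "('e::finite \<times> 'v::finite) set"
  assumes conn: "bg_connected G" and x: "0 < x" "x < (1::real)"
  shows "((\<lambda>p. x ^ (\<Sum>e\<in>UNIV. p (Inl e))) has_sum
    (\<Sum>g\<in>sub_hypertrees G. x ^ card {e. 0 < g e} / (1 - x) ^ ((\<Sum>e\<in>UNIV. g e) + CARD('e)))) (lattice_cone G)"
proof -
  let ?T = "lex_trees (add_node G)" and ?w = "\<lambda>S. x ^ card (forced_edges S) / (1 - x) ^ card (drop_node S)"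
  have tree: "is_tree S" if "S \<in> ?T" for S using that by (auto simp: lex_trees_def spanning_tree_def)
  have ex: "\<exists>v. (e, v) \<in> G" for e by (rule connected_neighbour_ex[OF conn])
  have "((\<lambda>k. x ^ (\<Sum>e\<in>UNIV. marg k (Inl e))) has_sum ?w S) (tree_points S)" for S :: "('e option \<times> 'v) set"
    unfolding sum_marg_Inl tree_points_def
    by (rule has_sum_power_supported[OF x]) (auto simp: forced_edges_def)
  then have "((\<lambda>(S, k). x ^ (\<Sum>e\<in>UNIV. marg k (Inl e))) has_sum (\<Sum>S\<in>?T. ?w S)) (Sigma ?T tree_points)"
    by (intro has_sum_finite_Sigma) auto
  then have "((\<lambda>p. x ^ (\<Sum>e\<in>UNIV. p (Inl e))) has_sum (\<Sum>S\<in>?T. ?w S)) (lattice_cone G)"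
    unfolding has_sum_reindex_bij_betw[OF bij_betw_tree_points_lattice_cone[OF ex], symmetric]
    by (simp add: case_prod_beta')
  moreover have "(\<Sum>S\<in>?T. ?w S) = (\<Sum>g\<in>sub_hypertrees G. x ^ card {e. 0 < g e} / (1 - x) ^ ((\<Sum>e\<in>UNIV. g e) + CARD('e)))"
  proof -
    define \<phi> where "\<phi> = (\<lambda>f. f \<circ> Some) \<circ> (\<lambda>(S :: ('e option \<times> 'v) set) a. degL S a - 1)"
    have \<phi>: "\<phi> S e = degL S (Some e) - 1" for S e by (simp add: \<phi>_def)
    have bij: "bij_betw \<phi> ?T (sub_hypertrees G)"
      unfolding \<phi>_def by (rule bij_betw_trans[OF bij_betw_lex_trees_hypertrees bij_betw_hypertrees_add_node[OF conn]])
    have "?w S = x ^ card {e. 0 < \<phi> S e} / (1 - x) ^ ((\<Sum>e\<in>UNIV. \<phi> S e) + CARD('e))" if S: "S \<in> ?T" for S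
    proof -
      note t = tree[OF S]
      have pos: "degL S a > 0" for a by (rule connected_degL_pos[OF is_tree_connected[OF t]])
      have deg: "degL S (Some e) = \<phi> S e + 1" for e using pos[of "Some e"] by (simp add: \<phi>)
      have "card (forced_edges S) = (\<Sum>e\<in>UNIV. degL (forced_edges S) e)" by (rule sum_degL[symmetric])
      also have "\<dots> = (\<Sum>e\<in>UNIV. if 0 < \<phi> S e then 1 else 0)"
        unfolding degL_forced_edges[OF t] deg by (rule sum.cong) auto
      also have "\<dots> = card {e. 0 < \<phi> S e}" by (simp add: sum.If_cases)
      finally have 1: "card (forced_edges S) = card {e. 0 < \<phi> S e}" .
      have "card (drop_node S) = (\<Sum>e\<in>UNIV. degL (drop_node S) e)" by (rule sum_degL[symmetric])
      also have "\<dots> = (\<Sum>e\<in>UNIV. \<phi> S e + 1)" unfolding deg[symmetric] by simp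
      also have "\<dots> = (\<Sum>e\<in>UNIV. \<phi> S e) + CARD('e)" by (simp add: sum_Suc)
      finally show ?thesis unfolding 1 by simp
    qed
    then have "(\<Sum>S\<in>?T. ?w S) = (\<Sum>S\<in>?T. x ^ card {e. 0 < \<phi> S e} / (1 - x) ^ ((\<Sum>e\<in>UNIV. \<phi> S e) + CARD('e)))"
      by (rule sum.cong[OF refl])
    also have "\<dots> = (\<Sum>g\<in>sub_hypertrees G. x ^ card {e. 0 < g e} / (1 - x) ^ ((\<Sum>e\<in>UNIV. g e) + CARD('e)))"
      by (rule sum.reindex_bij_betw[OF bij])
    finally show ?thesis .
  qed
  ultimately show ?thesis by simp
qed

section \<open>Internal activity\<close>

lemma degL_insert:
  fixes F :: "('a::finite \<times> 'b::finite) set"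
  assumes "(c, d) \<notin> F"
  shows "degL (insert (c, d) F) a = degL F a + of_bool (a = c)"
proof (cases "a = c")
  case True
  have "{b. (c, b) \<in> insert (c, d) F} = insert d {b. (c, b) \<in> F}" by auto
  then show ?thesis using assms True by simp
next
  case False
  then have "{b. (a, b) \<in> insert (c, d) F} = {b. (a, b) \<in> F}" by auto
  then show ?thesis using False by simp
qed

lemma degL_remove:
  fixes F :: "('a::finite \<times> 'b::finite) set"
  assumes "(c, d) \<in> F"
  shows "degL F a = degL (F - {(c, d)}) a + of_bool (a = c)"
  using degL_insert[of c d "F - {(c, d)}" a] assms by (simp add: insert_absorb)

text \<open>S realises f with one unit moved from e to c, so it has more edges at c than S'. Trading
  one of them for an edge of S' moves the unit to a node c', and this is repeated until f' exceeds f
  there. Each trade brings S closer to S'.\<close>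

lemma hypertree_exchange_chain:
  fixes G :: "('e::finite \<times> 'v::finite) set"
  assumes "spanning_tree G S'" "\<And>a. degL S' a = f' a + 1" "f' e < f e"
    and "spanning_tree G S" "\<And>a. degL S a + of_bool (a = e) = f a + 1 + of_bool (a = c)" "f' c \<le> f c"
  shows "\<exists>e'. f e' < f' e' \<and> (f(e := f e - 1))(e' := f e' + 1) \<in> hypertrees G"
  using assms(4-6)
proof (induction "card (S - S')" arbitrary: S c rule: less_induct)
  case less
  have t: "is_tree S" "is_tree S'" "S \<subseteq> G" "S' \<subseteq> G"
    using less.prems(1) assms(1) by (auto simp: spanning_tree_def)
  have "degL S' c < degL S c"
    using less.prems(2)[of c] less.prems(3) assms(2)[of c] assms(3) by (cases "c = e") auto
  then have "\<not> {v. (c, v) \<in> S} \<subseteq> {v. (c, v) \<in> S'}" by (meson card_mono finite leD)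
  then obtain v where v: "(c, v) \<in> S" "(c, v) \<notin> S'" by blast
  obtain \<eta> where \<eta>: "\<eta> \<in> S'" "\<eta> \<notin> S" "is_tree (insert \<eta> (S - {(c, v)}))"
    using spanning_tree_exchange[OF t(1,2) v] by blast
  obtain c' v' where cv: "\<eta> = (c', v')" by (cases \<eta>)
  define S2 where "S2 = insert (c', v') (S - {(c, v)})"
  have S2: "spanning_tree G S2"
    using \<eta> t(3,4) by (auto simp: S2_def cv spanning_tree_def)
  have deg: "degL S2 a + of_bool (a = e) = f a + 1 + of_bool (a = c')" for a
  proof -
    have "degL S2 a = degL (S - {(c, v)}) a + of_bool (a = c')"
      unfolding S2_def by (rule degL_insert) (use \<eta> cv in auto)
    then show ?thesis using degL_remove[OF v(1), of a] less.prems(2)[of a] by linarith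
  qed
  show ?case
  proof (cases "f c' < f' c'")
    case True
    then have ne: "c' \<noteq> e" using assms(3) by auto
    have "degL S2 a = ((f(e := f e - 1))(c' := f c' + 1)) a + 1" for a
      using deg[of a] ne assms(3) by (auto simp: of_bool_def split: if_splits)
    then have "(f(e := f e - 1))(c' := f c' + 1) \<in> hypertrees G"
      unfolding hypertrees_def using S2 by blast
    then show ?thesis using True by blast
  next
    case False
    have "card (S2 - S') < card (S - S')"
    proof (rule psubset_card_mono)
      show "S2 - S' \<subset> S - S'" using v \<eta>(1) cv by (auto simp: S2_def)
    qed simp
    then show ?thesis by (rule less.hyps[OF _ S2 deg]) (use False in simp)
  qed
qed

text \<open>The exchange axiom for bases of an integral polymatroid; the chain starts with the unit
  still at e.\<close>

lemma hypertree_exchange: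
  assumes "f \<in> hypertrees G" "f' \<in> hypertrees G" "f' e < f e"
  shows "\<exists>e'. f e' < f' e' \<and> (f(e := f e - 1))(e' := f e' + 1) \<in> hypertrees G"
proof -
  obtain S S' where S: "spanning_tree G S" "\<And>a. degL S a = f a + 1"
    and S': "spanning_tree G S'" "\<And>a. degL S' a = f' a + 1"
    using assms(1,2) unfolding hypertrees_def by blast
  show ?thesis
    by (rule hypertree_exchange_chain[of G S' f' e f S e]) (use S S' assms(3) in auto)
qed

text \<open>The analogue of the intervals from a basis without its internally active elements up to
  the basis, which partition the independent sets of a matroid.\<close>

definition hypertree_cell :: "('e::{finite,linorder} \<times> 'v::finite) set \<Rightarrow> ('e \<Rightarrow> nat) \<Rightarrow> ('e \<Rightarrow> nat) set" where
  "hypertree_cell G f = {g. (\<forall>e. g e \<le> f e) \<and> (\<forall>e. \<not> internally_active G f e \<longrightarrow> g e = f e)}"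

lemma finite_hypertrees: "finite (hypertrees (G :: ('e::finite \<times> 'v::finite) set))"
proof (rule finite_subset)
  show "hypertrees G \<subseteq> (\<lambda>(F :: ('e \<times> 'v) set) a. degL F a - 1) ` UNIV"
  proof
    fix f assume "f \<in> hypertrees G"
    then obtain F :: "('e \<times> 'v) set" where "\<And>a. degL F a = f a + 1" unfolding hypertrees_def by blast
    then have "f = (\<lambda>a. degL F a - 1)" by simp
    then show "f \<in> (\<lambda>(F :: ('e \<times> 'v) set) a. degL F a - 1) ` UNIV" by blast
  qed
qed simp

text \<open>Among the hypertrees above g, one of least weight by ranks is taken. If an inactive
  hyperedge had room above g, a unit could move from it to a smaller hyperedge, lowering the
  weight.\<close>

lemma sub_hypertrees_eq_cells:
  fixes G :: "('e::{finite,linorder} \<times> 'v::finite) set"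
  shows "sub_hypertrees G = (\<Union>f\<in>hypertrees G. hypertree_cell G f)"
proof
  show "(\<Union>f\<in>hypertrees G. hypertree_cell G f) \<subseteq> sub_hypertrees G"
    by (auto simp: sub_hypertrees_def hypertree_cell_def)
  show "sub_hypertrees G \<subseteq> (\<Union>f\<in>hypertrees G. hypertree_cell G f)"
  proof
    fix g assume "g \<in> sub_hypertrees G"
    then have ex: "\<exists>f. f \<in> hypertrees G \<and> (\<forall>e. g e \<le> f e)" by (auto simp: sub_hypertrees_def)
    define rk :: "'e \<Rightarrow> nat" where "rk e = card {a. a < e}" for e
    have rk: "rk a < rk b" if "a < b" for a b
      unfolding rk_def by (rule psubset_card_mono) (use that in auto)
    obtain f where f: "f \<in> hypertrees G" "\<And>e. g e \<le> f e"
      and min: "\<And>f'. f' \<in> hypertrees G \<Longrightarrow> (\<forall>e. g e \<le> f' e) \<Longrightarrow> (\<Sum>a\<in>UNIV. f a * rk a) \<le> (\<Sum>a\<in>UNIV. f' a * rk a)"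
      using ex_has_least_nat[of "\<lambda>f. f \<in> hypertrees G \<and> (\<forall>e. g e \<le> f e)" _ "\<lambda>f. \<Sum>a\<in>UNIV. f a * rk a"] ex
      by blast
    have "g e = f e" if nact: "\<not> internally_active G f e" for e
    proof (rule ccontr)
      assume "g e \<noteq> f e"
      with f(2)[of e] have lt: "g e < f e" by simp
      obtain e' where e': "e' < e" "0 < f e" "(f(e := f e - 1))(e' := f e' + 1) \<in> hypertrees G"
        using nact unfolding internally_active_def by blast
      define f' where "f' = (f(e := f e - 1))(e' := f e' + 1)"
      have "g a \<le> f' a" for a using f(2)[of a] lt e'(1) by (auto simp: f'_def)
      then have le: "(\<Sum>a\<in>UNIV. f a * rk a) \<le> (\<Sum>a\<in>UNIV. f' a * rk a)"
        using min[of f'] e'(3) by (simp add: f'_def)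
      have eq: "f' a + of_bool (a = e) = f a + of_bool (a = e')" for a
        using e'(1,2) by (auto simp: f'_def)
      have rk_sum: "(\<Sum>a\<in>UNIV. (h a + of_bool (a = c)) * rk a) = (\<Sum>a\<in>UNIV. h a * rk a) + rk c"
        for h :: "'e \<Rightarrow> nat" and c
        unfolding distrib_right sum.distrib by simp
      have "(\<Sum>a\<in>UNIV. f' a * rk a) + rk e = (\<Sum>a\<in>UNIV. (f' a + of_bool (a = e)) * rk a)"
        by (rule rk_sum[symmetric])
      also have "\<dots> = (\<Sum>a\<in>UNIV. f a * rk a) + rk e'"
        unfolding eq by (rule rk_sum)
      finally show False using le rk[OF e'(1)] by linarith
    qed
    then show "g \<in> (\<Union>f\<in>hypertrees G. hypertree_cell G f)"
      using f by (auto simp: hypertree_cell_def)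
  qed
qed

text \<open>At the largest e where f and f' differ, the larger of the two exceeds g and so has e
  active. Exchange moves a unit from e to another hyperedge where the two differ, necessarily a
  smaller one, against activity.\<close>

lemma hypertree_cells_disjoint:
  fixes G :: "('e::{finite,linorder} \<times> 'v::finite) set"
  assumes "f \<in> hypertrees G" "f' \<in> hypertrees G" "f \<noteq> f'"
  shows "hypertree_cell G f \<inter> hypertree_cell G f' = {}"
proof (rule ccontr)
  assume "hypertree_cell G f \<inter> hypertree_cell G f' \<noteq> {}"
  then obtain g where g: "g \<in> hypertree_cell G f" "g \<in> hypertree_cell G f'" by blast
  define D where "D = {a. f a \<noteq> f' a}"
  have ne: "D \<noteq> {}" using assms(3) by (auto simp: D_def)
  have eD: "Max D \<in> D" by (rule Max_in) (use ne in auto)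
  have False if h: "h \<in> hypertrees G" "h' \<in> hypertrees G" "g \<in> hypertree_cell G h" "g \<in> hypertree_cell G h'"
      "h' (Max D) < h (Max D)" and D: "D = {a. h a \<noteq> h' a}" for h h'
  proof -
    let ?e = "Max D"
    have "g ?e \<noteq> h ?e" using h(4,5) by (auto simp: hypertree_cell_def dest: spec[of _ ?e])
    then have act: "internally_active G h ?e" using h(3) by (auto simp: hypertree_cell_def)
    obtain e' where e': "h e' < h' e'" "(h(?e := h ?e - 1))(e' := h e' + 1) \<in> hypertrees G"
      using hypertree_exchange[OF h(1,2,5)] by blast
    have "e' \<in> D" using e'(1) D by auto
    then have "e' \<le> ?e" by (rule Max_ge[rotated]) simp
    moreover have "e' \<noteq> ?e" using e'(1) h(5) by auto
    ultimately have "e' < ?e" by simp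
    then show False using act e'(2) h(5) unfolding internally_active_def by auto
  qed
  note * = this
  have "f (Max D) \<noteq> f' (Max D)" using eD by (simp add: D_def)
  then consider "f' (Max D) < f (Max D)" | "f (Max D) < f' (Max D)" by linarith
  then show False
  proof cases
    case 1 then show False by (rule *[OF assms(1,2) g]) (simp add: D_def)
  next
    case 2 then show False by (rule *[OF assms(2,1) g(2,1)]) (auto simp: D_def)
  qed
qed

text \<open>The factor of an active hyperedge of value n: the terms with k > 0 form a geometric sum
  equal to \<open>1 - (1 - x) ^ n\<close>.\<close>

lemma sum_active_range:
  "(\<Sum>k\<le>n. (x::real) ^ of_bool (0 < k) * (1 - x) ^ (n - k)) = 1"
proof (induction n)
  case (Suc n)
  have "(\<Sum>k\<le>Suc n. x ^ of_bool (0 < k) * (1 - x) ^ (Suc n - k))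
     = (\<Sum>k\<le>n. x ^ of_bool (0 < k) * (1 - x) ^ (Suc n - k)) + x" by simp
  also have "(\<Sum>k\<le>n. x ^ of_bool (0 < k) * (1 - x) ^ (Suc n - k))
     = (\<Sum>k\<le>n. (1 - x) * (x ^ of_bool (0 < k) * (1 - x) ^ (n - k)))"
    by (rule sum.cong) (auto simp: Suc_diff_le)
  also have "\<dots> = 1 - x" unfolding sum_distrib_left[symmetric] Suc.IH by simp
  finally show ?case by simp
qed simp

text \<open>The cell is a box and both exponents are sums over the hyperedges, so the sum
  factors.\<close>

lemma sum_hypertree_cell:
  fixes G :: "('e::{finite,linorder} \<times> 'v::finite) set"
  assumes f: "f \<in> hypertrees G"
  shows "(\<Sum>g\<in>hypertree_cell G f. x ^ card {e. 0 < g e} * (1 - x) ^ (CARD('v) - 1 - (\<Sum>e\<in>UNIV. g e)))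
    = (x :: real) ^ internal_inactivity G f"
proof -
  define B where "B e = (if internally_active G f e then {..f e} else {f e})" for e
  have cell: "hypertree_cell G f = (\<Pi>\<^sub>E e\<in>UNIV. B e)"
    by (fastforce simp: B_def hypertree_cell_def PiE_UNIV_domain Pi_def split: if_splits)
  have m: "CARD('v) - 1 = (\<Sum>e\<in>UNIV. f e)" using hypertrees_sum[OF f] by simp
  have "(\<Sum>g\<in>hypertree_cell G f. x ^ card {e. 0 < g e} * (1 - x) ^ (CARD('v) - 1 - (\<Sum>e\<in>UNIV. g e)))
     = (\<Sum>g\<in>hypertree_cell G f. \<Prod>e\<in>UNIV. x ^ of_bool (0 < g e) * (1 - x) ^ (f e - g e))"
  proof (rule sum.cong[OF refl])
    fix g assume "g \<in> hypertree_cell G f"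
    then have "(\<Sum>e\<in>UNIV. f e) - (\<Sum>e\<in>UNIV. g e) = (\<Sum>e\<in>UNIV. f e - g e)"
      by (intro sum_subtractf_nat[symmetric]) (auto simp: hypertree_cell_def)
    moreover have "card {e. 0 < g e} = (\<Sum>e\<in>UNIV. of_bool (0 < g e))"
      by (simp add: of_bool_def sum.If_cases)
    ultimately show "x ^ card {e. 0 < g e} * (1 - x) ^ (CARD('v) - 1 - (\<Sum>e\<in>UNIV. g e))
       = (\<Prod>e\<in>UNIV. x ^ of_bool (0 < g e) * (1 - x) ^ (f e - g e))"
      unfolding m by (simp only: prod.distrib power_sum)
  qed
  also have "\<dots> = (\<Prod>e\<in>UNIV. \<Sum>k\<in>B e. x ^ of_bool (0 < k) * (1 - x) ^ (f e - k))"
    unfolding cell by (rule prod_sum_PiE[symmetric]) (auto simp: B_def)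
  also have "\<dots> = (\<Prod>e\<in>UNIV. if internally_active G f e then 1 else x)"
  proof (rule prod.cong[OF refl])
    fix e
    \<comment> \<open>Inactivity includes a positive value, so the single term of an inactive
      hyperedge is x and not 1.\<close>
    have "0 < f e" if "\<not> internally_active G f e" using that unfolding internally_active_def by blast
    then show "(\<Sum>k\<in>B e. x ^ of_bool (0 < k) * (1 - x) ^ (f e - k)) = (if internally_active G f e then 1 else x)"
      by (simp add: B_def sum_active_range)
  qed
  also have "\<dots> = x ^ internal_inactivity G f"
    by (simp add: prod.If_cases internal_inactivity_def Collect_neg_eq)
  finally show ?thesis .
qed

lemma interior_poly_eq_sum_sub_hypertrees:
  fixes G :: "('e::{finite,linorder} \<times> 'v::finite) set"
  shows "interior_poly G x =
    (\<Sum>g\<in>sub_hypertrees G. x ^ card {e. 0 < g e} * (1 - x) ^ (CARD('v) - 1 - (\<Sum>e\<in>UNIV. g e)))"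
proof -
  have fin: "finite (hypertree_cell G f)" for f
  proof (rule finite_subset)
    show "hypertree_cell G f \<subseteq> (\<Pi>\<^sub>E e\<in>UNIV. {..f e})"
      by (auto simp: hypertree_cell_def PiE_UNIV_domain)
  qed (simp add: finite_PiE)
  have "(\<Sum>g\<in>sub_hypertrees G. x ^ card {e. 0 < g e} * (1 - x) ^ (CARD('v) - 1 - (\<Sum>e\<in>UNIV. g e)))
    = (\<Sum>f\<in>hypertrees G. \<Sum>g\<in>hypertree_cell G f.
        x ^ card {e. 0 < g e} * (1 - x) ^ (CARD('v) - 1 - (\<Sum>e\<in>UNIV. g e)))"
    unfolding sub_hypertrees_eq_cells
    by (rule sum.UNION_disjoint) (use finite_hypertrees fin hypertree_cells_disjoint in blast)+
  also have "\<dots> = (\<Sum>f\<in>hypertrees G. x ^ internal_inactivity G f)"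
    by (rule sum.cong[OF refl sum_hypertree_cell])
  finally show ?thesis unfolding interior_poly_def by simp
qed

lemma sub_hypertrees_sum_le:
  fixes G :: "('e::finite \<times> 'v::finite) set"
  assumes "g \<in> sub_hypertrees G"
  shows "(\<Sum>e\<in>UNIV. g e) + 1 \<le> CARD('v)"
proof -
  obtain f where f: "f \<in> hypertrees G" "\<And>e. g e \<le> f e" using assms by (auto simp: sub_hypertrees_def)
  have "(\<Sum>e\<in>UNIV. g e) \<le> (\<Sum>e\<in>UNIV. f e)" by (rule sum_mono) (rule f(2))
  then show ?thesis using hypertrees_sum[OF f(1)] by linarith
qed

lemma lattice_cone_has_sum_interior_poly:
  fixes G :: "('e::{finite,linorder} \<times> 'v::finite) set"
  assumes conn: "bg_connected G" and x: "0 < x" "x < (1::real)"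
  shows "((\<lambda>p. x ^ (\<Sum>e\<in>UNIV. p (Inl e))) has_sum
    (interior_poly G x / (1 - x) ^ (CARD('e) + CARD('v) - 1))) (lattice_cone G)"
proof -
  have "interior_poly G x / (1 - x) ^ (CARD('e) + CARD('v) - 1)
    = (\<Sum>g\<in>sub_hypertrees G. x ^ card {e. 0 < g e} / (1 - x) ^ ((\<Sum>e\<in>UNIV. g e) + CARD('e)))"
    unfolding interior_poly_eq_sum_sub_hypertrees sum_divide_distrib
  proof (rule sum.cong[OF refl])
    fix g assume g: "g \<in> sub_hypertrees G"
    have "CARD('e) + CARD('v) - 1 = (CARD('v) - 1 - (\<Sum>e\<in>UNIV. g e)) + ((\<Sum>e\<in>UNIV. g e) + CARD('e))"
      using sub_hypertrees_sum_le[OF g] by linarith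
    then have "(1 - x) ^ (CARD('e) + CARD('v) - 1)
       = (1 - x) ^ (CARD('v) - 1 - (\<Sum>e\<in>UNIV. g e)) * (1 - x) ^ ((\<Sum>e\<in>UNIV. g e) + CARD('e))"
      by (simp only: power_add)
    then show "x ^ card {e. 0 < g e} * (1 - x) ^ (CARD('v) - 1 - (\<Sum>e\<in>UNIV. g e)) / (1 - x) ^ (CARD('e) + CARD('v) - 1)
       = x ^ card {e. 0 < g e} / (1 - x) ^ ((\<Sum>e\<in>UNIV. g e) + CARD('e))"
      using x by simp
  qed
  then show ?thesis using lattice_cone_has_sum[OF assms] by simp
qed

section \<open>Triangulations of the root polytope\<close>

text \<open>All edge vectors lie in the hyperplane where the left coordinates sum to 1, which misses
  the origin.\<close>

lemma aff_dim_rp_point: "int (dim (rp_point ` F)) = aff_dim (rp_point ` F) + 1"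
proof -
  define c :: "real ^ ('a + 'b)" where "c = flow_vec (case_sum (\<lambda>_. 1) (\<lambda>_. 0))"
  have "c \<bullet> rp_point \<epsilon> = 1" for \<epsilon>
  proof -
    obtain a b where \<epsilon>: "\<epsilon> = (a, b)" by (cases \<epsilon>)
    show ?thesis
      by (simp add: inner_vec_def c_def \<epsilon> sum_UNIV_sum rp_point_nth of_bool_def)
  qed
  then have "affine hull (rp_point ` F) \<subseteq> {z. c \<bullet> z = 1}"
    by (intro hull_minimal affine_hyperplane) auto
  then have "0 \<notin> affine hull (rp_point ` F)" by auto
  then have "aff_dim (insert 0 (rp_point ` F)) = aff_dim (rp_point ` F) + 1"
    by (simp add: aff_dim_insert)
  moreover have "aff_dim (insert 0 (rp_point ` F)) = int (dim (insert 0 (rp_point ` F)))"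
    by (intro aff_dim_zero hull_inc) simp
  ultimately show ?thesis by (simp add: dim_insert span_zero)
qed

lemma aff_dim_root_polytope:
  fixes G :: "('e::finite \<times> 'v::finite) set"
  assumes "bg_connected G"
  shows "aff_dim (root_polytope G) = int CARD('e) + int CARD('v) - 2"
  unfolding root_polytope_def aff_dim_convex_hull
  using aff_dim_rp_point[of G] dim_rp_point_connected[OF assms] by linarith

text \<open>A proper closed K yields a functional w that vanishes on all edge vectors of S but not
  on all of \<open>balanced_space\<close>.\<close>

lemma bg_connected_if_span:
  fixes S :: "('a::finite \<times> 'b::finite) set"
  assumes span: "balanced_space \<subseteq> span (rp_point ` S)"
  shows "bg_connected S"
  unfolding bg_connected_iff_edge_closed
proof (intro allI impI, rule ccontr)
  fix K assume K: "edge_closed S K" "\<not> (K = {} \<or> K = UNIV)"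
  then obtain x y where xy: "x \<in> K" "y \<notin> K" by blast
  define w :: "real ^ ('a + 'b)" where "w = flow_vec (\<lambda>z. of_bool (z \<in> K) * side z)"
  have "rp_point ` S \<subseteq> {z. w \<bullet> z = 0}"
  proof (clarify)
    fix a b assume "(a, b) \<in> S"
    then have "Inl a \<in> K \<longleftrightarrow> Inr b \<in> K" using K(1) by (auto simp: edge_closed_def)
    then show "w \<bullet> rp_point (a, b) = 0"
      by (simp add: inner_vec_def w_def sum_UNIV_sum rp_point_nth of_bool_def if_distrib cong: if_cong)
  qed
  then have "span (rp_point ` S) \<subseteq> {z. w \<bullet> z = 0}"
    by (rule span_minimal) (rule subspace_hyperplane)
  \<comment> \<open>A balanced vector supported on one node inside K and one outside; the signs make
    its product with w equal to 1.\<close>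
  moreover define p where "p z = side x * of_bool (z = x) - side y * of_bool (z = y)" for z
  have "(\<Sum>z\<in>UNIV. h z * p z) = h x * side x - h y * side y" for h
  proof -
    have "(\<Sum>z\<in>UNIV. h z * (c * of_bool (z = w))) = h w * c" for c and w
    proof -
      have "(\<Sum>z\<in>UNIV. h z * (c * of_bool (z = w))) = (\<Sum>z\<in>UNIV. if z = w then h z * c else 0)"
        by (rule sum.cong) auto
      then show ?thesis by simp
    qed
    then show ?thesis by (simp only: p_def right_diff_distrib sum_subtractf)
  qed
  note sum_p = this
  have "flow_vec p \<in> balanced_space"
    using sum_p[of side] by (simp add: balanced_space_def inner_vec_def)
  moreover have "w \<bullet> flow_vec p = 1"
    using sum_p[of "\<lambda>z. of_bool (z \<in> K) * side z"] xy by (simp add: inner_vec_def w_def)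
  ultimately show False using span by auto
qed

text \<open>Convex coefficients of the vertices are flows of total 1, and the total is the sum of
  the left marginals.\<close>

lemma flow_vec_in_convex_hull_iff:
  "flow_vec p \<in> convex hull (rp_point ` S) \<longleftrightarrow> flows S p \<noteq> {} \<and> (\<Sum>a\<in>UNIV. p (Inl a)) = 1"
proof
  have inj: "inj_on rp_point S" by (rule inj_on_subset[OF inj_rp_point]) simp
  show "flow_vec p \<in> convex hull (rp_point ` S)" if p: "flows S p \<noteq> {} \<and> (\<Sum>a\<in>UNIV. p (Inl a)) = 1"
  proof -
    obtain l where l: "\<And>\<epsilon>. 0 \<le> l \<epsilon>" "supported l S" "marg l = p"
      using p unfolding flows_def by blast
    have "(\<Sum>\<epsilon>\<in>S. l \<epsilon>) = (\<Sum>\<epsilon>\<in>UNIV. l \<epsilon>)"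
      by (rule sum.mono_neutral_left) (use l(2) in auto)
    then have "(\<Sum>\<epsilon>\<in>S. l \<epsilon>) = 1" using sum_marg_Inl[of l] l(3) p by simp
    then have "(\<Sum>\<epsilon>\<in>S. l \<epsilon> *\<^sub>R rp_point \<epsilon>) \<in> convex hull (rp_point ` S)"
      by (intro convex_sum) (use l(1) in \<open>auto intro: hull_inc\<close>)
    then show ?thesis using sum_rp_point_supported[OF l(2)] by (simp add: l(3))
  qed
  assume "flow_vec p \<in> convex hull (rp_point ` S)"
  then obtain u where u: "\<And>x. x \<in> rp_point ` S \<Longrightarrow> 0 \<le> u x" "sum u (rp_point ` S) = 1"
    "(\<Sum>x\<in>rp_point ` S. u x *\<^sub>R x) = flow_vec p"
    unfolding convex_hull_finite[OF finite_imageI[OF finite]] by blast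
  define l where "l \<epsilon> = (if \<epsilon> \<in> S then u (rp_point \<epsilon>) else 0)" for \<epsilon>
  have supp: "supported l S" by (simp add: l_def)
  have "flow_vec (marg l) = (\<Sum>\<epsilon>\<in>S. u (rp_point \<epsilon>) *\<^sub>R rp_point \<epsilon>)"
    unfolding sum_rp_point_supported[OF supp] by (rule sum.cong) (auto simp: l_def)
  also have "\<dots> = flow_vec p" using u(3) by (simp add: sum.reindex[OF inj])
  finally have "marg l x = p x" for x by (metis flow_vec_nth)
  then have marg: "marg l = p" by blast
  have "(\<Sum>a\<in>UNIV. p (Inl a)) = (\<Sum>\<epsilon>\<in>UNIV. l \<epsilon>)" using sum_marg_Inl[of l] marg by simp
  also have "\<dots> = (\<Sum>\<epsilon>\<in>S. u (rp_point \<epsilon>))"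
    unfolding l_def by (simp add: sum.If_cases)
  also have "\<dots> = 1" using u(2) by (simp add: sum.reindex[OF inj])
  finally have "(\<Sum>a\<in>UNIV. p (Inl a)) = 1" .
  moreover have "l \<in> flows S p" using supp marg u(1) by (auto simp: flows_def l_def)
  ultimately show "flows S p \<noteq> {} \<and> (\<Sum>a\<in>UNIV. p (Inl a)) = 1" by blast
qed

lemma flows_scale:
  assumes "l \<in> flows S p" "0 \<le> c"
  shows "(\<lambda>\<epsilon>. c * l \<epsilon>) \<in> flows S (\<lambda>x. c * p x)"
  using assms by (auto simp: flows_def marg_cmult fun_eq_iff simp del: marg_simps)

text \<open>Affine independence in full dimension fixes the number of edges, and full dimension
  makes the edge vectors span \<open>balanced_space\<close>.\<close>

lemma is_tree_triangulation:
  fixes G :: "('e::finite \<times> 'v::finite) set"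
  assumes conn: "bg_connected G" and T: "is_triangulation G T" and S: "S \<in> T"
  shows "is_tree S"
proof -
  have ind: "\<not> affine_dependent (rp_point ` S)"
    and dimS: "aff_dim (rp_point ` S) = aff_dim (root_polytope G)"
    using T S by (auto simp: is_triangulation_def aff_dim_convex_hull)
  have "int (card (rp_point ` S)) = int CARD('e) + int CARD('v) - 1"
    using aff_dim_affine_independent[OF ind] dimS aff_dim_root_polytope[OF conn] by simp
  moreover have "card (rp_point ` S) = card S"
    by (intro card_image inj_on_subset[OF inj_rp_point]) simp
  ultimately have card: "card S + 1 = CARD('e) + CARD('v)" by linarith
  have "int (dim (rp_point ` S)) = int CARD('e) + int CARD('v) - 1"
    using aff_dim_rp_point[of S] dimS aff_dim_root_polytope[OF conn] by simp
  then have "dim (balanced_space :: (real ^ ('e + 'v)) set) \<le> dim (span (rp_point ` S))"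
    using dim_balanced_space[where 'a='e and 'b='v] by simp
  moreover have "span (rp_point ` S) \<subseteq> balanced_space"
    by (rule span_minimal) (use rp_point_in_balanced_space subspace_balanced_space in auto)
  ultimately have "span (rp_point ` S) = balanced_space"
    by (intro subspace_dim_equal) (auto simp: subspace_balanced_space)
  then have "bg_connected S" by (intro bg_connected_if_span) simp
  then show ?thesis using card by (simp add: spanning_tree_def)
qed

lemma triangulation_nonempty:
  assumes "bg_connected (G :: ('e::finite \<times> 'v::finite) set)" "is_triangulation G T"
  shows "T \<noteq> {}"
proof
  assume "T = {}"
  then have "root_polytope G = {}" using assms(2) by (auto simp: is_triangulation_def)
  then have "G = {}" by (simp add: root_polytope_def)
  then show False using connected_neighbour_ex[OF assms(1)] by simp
qed

text \<open>Faces of a simplex are hulls of vertex subsets, and an affinely independent set is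
  recovered from its hull as the extreme points. So the common face has its vertices in both
  simplices.\<close>

lemma triangulation_common_face:
  assumes T: "is_triangulation G T" and S: "S \<in> T" "S' \<in> T"
    and z: "z \<in> convex hull (rp_point ` S)" "z \<in> convex hull (rp_point ` S')"
  shows "z \<in> convex hull (rp_point ` (S \<inter> S'))"
proof -
  let ?I = "convex hull (rp_point ` S) \<inter> convex hull (rp_point ` S')"
  have ind: "\<not> affine_dependent (rp_point ` S)" "\<not> affine_dependent (rp_point ` S')"
    and face: "?I face_of convex hull (rp_point ` S)" "?I face_of convex hull (rp_point ` S')"
    using T S unfolding is_triangulation_def by blast+
  obtain c where c: "c \<subseteq> rp_point ` S" "?I = convex hull c"
    using face(1) unfolding face_of_convex_hull_affine_independent[OF ind(1)] by blast
  obtain c' where c': "c' \<subseteq> rp_point ` S'" "?I = convex hull c'"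
    using face(2) unfolding face_of_convex_hull_affine_independent[OF ind(2)] by blast
  have "\<not> affine_dependent c" "\<not> affine_dependent c'"
    using affine_independent_subset c(1) c'(1) ind by blast+
  then have "c = c'"
    using extreme_point_of_convex_hull_affine_independent c(2) c'(2) by (metis subsetI subset_antisym)
  then have "c \<subseteq> rp_point ` S \<inter> rp_point ` S'" using c(1) c'(1) by blast
  also have "\<dots> = rp_point ` (S \<inter> S')" by (rule image_Int[OF inj_rp_point, symmetric])
  finally have "c \<subseteq> rp_point ` (S \<inter> S')" .
  then have "convex hull c \<subseteq> convex hull (rp_point ` (S \<inter> S'))" by (rule hull_mono)
  then show ?thesis using z c(2) by blast
qed

text \<open>After scaling to height 1, injectivity comes from the common faces and surjectivity from
  the covering of the polytope; unimodularity of trees makes the coefficients integral.\<close>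

lemma bij_betw_triangulation_lattice_cone:
  fixes G :: "('e::finite \<times> 'v::finite) set"
  assumes conn: "bg_connected G" and T: "is_triangulation G T"
  shows "bij_betw marg {k. \<exists>S\<in>T. supported k S} (lattice_cone G)"
proof -
  have sub: "S \<subseteq> G" if "S \<in> T" for S using T that by (auto simp: is_triangulation_def)
  note tree = is_tree_triangulation[OF conn T]
  have zero: "k = (\<lambda>_. 0)" if "(\<Sum>e\<in>UNIV. marg k (Inl e)) = 0" for k :: "'e \<times> 'v \<Rightarrow> nat"
    using that by (auto simp: fun_eq_iff)
  have into: "marg k \<in> lattice_cone G" if "S \<in> T" "supported k S" for k S
  proof -
    have "supported k G" using that sub by blast
    then have "(\<lambda>\<epsilon>. real (k \<epsilon>)) \<in> flows G (\<lambda>x. real (marg k x))"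
      by (auto simp: flows_def marg_of_nat fun_eq_iff simp del: marg_simps)
    then show ?thesis by (auto simp: lattice_cone_def)
  qed
  have "inj_on marg {k :: 'e \<times> 'v \<Rightarrow> nat. \<exists>S\<in>T. supported k S}"
  proof (rule inj_onI, clarify)
    fix k k' :: "'e \<times> 'v \<Rightarrow> nat" and S S'
    assume S: "S \<in> T" "S' \<in> T" and k: "supported k S" "supported k' S'" and eq: "marg k = marg k'"
    define s where "s = (\<Sum>e\<in>UNIV. marg k (Inl e))"
    show "k = k'"
    \<comment> \<open>The apex of the cone cannot be scaled to height 1 and is treated
      apart.\<close>
    proof (cases "s = 0")
      case True
      then show ?thesis using zero[of k] zero[of k'] eq unfolding s_def by metis
    next
      case False
      define q where "q x = 1 / real s * real (marg k x)" for x
      have fl: "(\<lambda>\<epsilon>. 1 / real s * real (h \<epsilon>)) \<in> flows R q"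
        if "supported h R" "marg h = marg k" for h :: "'e \<times> 'v \<Rightarrow> nat" and R
      proof -
        have "(\<lambda>\<epsilon>. real (h \<epsilon>)) \<in> flows R (\<lambda>x. real (marg k x))"
          using that by (auto simp: flows_def marg_of_nat fun_eq_iff simp del: marg_simps)
        from flows_scale[OF this, of "1 / real s"] show ?thesis unfolding q_def by simp
      qed
      have "(\<Sum>e\<in>UNIV. q (Inl e)) = 1 / real s * real s"
        unfolding q_def sum_distrib_left[symmetric] s_def by (simp del: marg_simps)
      then have q1: "(\<Sum>e\<in>UNIV. q (Inl e)) = 1" using False by simp
      have "flow_vec q \<in> convex hull (rp_point ` S)" "flow_vec q \<in> convex hull (rp_point ` S')"
        unfolding flow_vec_in_convex_hull_iff using q1 fl[OF k(1) refl] fl[OF k(2) eq[symmetric]] by blast+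
      from triangulation_common_face[OF T S this]
      obtain l where l: "l \<in> flows (S \<inter> S') q" unfolding flow_vec_in_convex_hull_iff by blast
      \<comment> \<open>Both scaled vectors agree with the flow on the common face, by uniqueness of
        flows on S and on S'.\<close>
      have same: "l = (\<lambda>\<epsilon>. 1 / real s * real (h \<epsilon>))"
        if "R \<in> T" "S \<inter> S' \<subseteq> R" "supported h R" "marg h = marg k" for h :: "'e \<times> 'v \<Rightarrow> nat" and R
      proof (rule is_tree_flow_unique[OF tree[OF that(1)]])
        show "supported l R" using l that(2) by (auto simp: flows_def)
        show "supported (\<lambda>\<epsilon>. 1 / real s * real (h \<epsilon>)) R" using that(3) by simp
        show "marg l = marg (\<lambda>\<epsilon>. 1 / real s * real (h \<epsilon>))"
          using l fl[OF that(3,4)] by (simp add: flows_def)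
      qed
      have "(\<lambda>\<epsilon>. 1 / real s * real (k \<epsilon>)) = (\<lambda>\<epsilon>. 1 / real s * real (k' \<epsilon>))"
        using same[OF S(1) _ k(1) refl] same[OF S(2) _ k(2) eq[symmetric]] by simp
      then show ?thesis using False by (simp add: fun_eq_iff)
    qed
  qed
  moreover have "\<exists>S\<in>T. \<exists>k. supported k S \<and> p = marg k" if p: "p \<in> lattice_cone G" for p
  proof -
    define s where "s = (\<Sum>e\<in>UNIV. p (Inl e))"
    show ?thesis
    proof (cases "s = 0")
      case True
      then have "p (Inl e) = 0" "p (Inr v) = 0" for e v
        using lattice_cone_balanced[OF p] by (simp_all add: s_def)
      then have "p = marg (\<lambda>_. 0)" by (auto simp: marg_def fun_eq_iff split: sum.split)
      moreover obtain S where "S \<in> T" using triangulation_nonempty[OF conn T] by blast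
      ultimately show ?thesis by (intro bexI[of _ S] exI[of _ "\<lambda>_. 0"]) auto
    next
      case False
      define q where "q x = 1 / real s * real (p x)" for x
      obtain l where "l \<in> flows G (\<lambda>x. real (p x))" using p by (auto simp: lattice_cone_def)
      from flows_scale[OF this, of "1 / real s"] have "flows G q \<noteq> {}" unfolding q_def by auto
      moreover have "(\<Sum>e\<in>UNIV. q (Inl e)) = 1 / real s * real s"
        unfolding q_def sum_distrib_left[symmetric] s_def by simp
      ultimately have "flow_vec q \<in> root_polytope G"
        unfolding root_polytope_def flow_vec_in_convex_hull_iff using False by simp
      then have "flow_vec q \<in> \<Union> ((\<lambda>S. convex hull (rp_point ` S)) ` T)"
        using T unfolding is_triangulation_def by simp
      then obtain S l where S: "S \<in> T" and l: "l \<in> flows S q"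
        by (auto simp: flow_vec_in_convex_hull_iff)
      from flows_scale[OF l, of "real s"] have "(\<lambda>\<epsilon>. real s * l \<epsilon>) \<in> flows S (\<lambda>x. real (p x))"
        using False by (simp add: q_def)
      then obtain h where hf: "h \<in> flows S (\<lambda>x. real (p x))" by (rule that)
      have h: "\<And>\<epsilon>. 0 \<le> h \<epsilon>" "supported h S" "marg h = (\<lambda>x. real (p x))"
        using hf by (simp_all add: flows_def)
      have hint: "h \<epsilon> \<in> \<int>" for \<epsilon> by (rule is_tree_flow_Ints[OF tree[OF S] h(2)]) (simp add: h(3))
      define k where "k \<epsilon> = nat \<lfloor>h \<epsilon>\<rfloor>" for \<epsilon>
      have k: "real (k \<epsilon>) = h \<epsilon>" for \<epsilon>
        using hint[of \<epsilon>] h(1)[of \<epsilon>] by (auto simp: k_def elim!: Ints_cases)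
      have "supported k S" using h(2) by (simp add: k_def)
      moreover have "p x = marg k x" for x
      proof -
        have "real (marg k x) = real (p x)"
          unfolding marg_of_nat[symmetric] k by (simp only: h(3))
        then show ?thesis by simp
      qed
      ultimately show ?thesis using S by blast
    qed
  qed
  ultimately show ?thesis unfolding bij_betw_def using into by (auto simp: image_iff) blast
qed

text \<open>Contains the empty face, which \<open>num_faces\<close> does not count and the leading
  term of \<open>f_vector\<close> supplies.\<close>

definition faces :: "'a set set \<Rightarrow> 'a set set" where
  "faces T = {F. \<exists>S\<in>T. F \<subseteq> S}"

lemma card_faces_le:
  fixes T :: "'a::finite set set"
  assumes "F \<in> faces T" "\<And>S. S \<in> T \<Longrightarrow> card S = N"
  shows "card F \<le> N"
proof -
  obtain S where "S \<in> T" "F \<subseteq> S" using assms(1) by (auto simp: faces_def)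
  then show ?thesis using assms(2) card_mono[of S F] by simp
qed

text \<open>A vector supported on a simplex belongs to exactly one face in the sense of being
  positive precisely there, namely its support; the empty face accounts for the apex.\<close>

lemma lattice_cone_has_sum_triangulation:
  fixes G :: "('e::finite \<times> 'v::finite) set"
  assumes conn: "bg_connected G" and T: "is_triangulation G T" and x: "0 < x" "x < (1::real)"
  shows "((\<lambda>p. x ^ (\<Sum>e\<in>UNIV. p (Inl e))) has_sum
    (\<Sum>F\<in>faces T. x ^ card F / (1 - x) ^ card F)) (lattice_cone G)"
proof -
  let ?B = "\<lambda>F :: ('e \<times> 'v) set. {k :: _ \<Rightarrow> nat. supported k F \<and> (\<forall>\<epsilon>\<in>F. 1 \<le> k \<epsilon>)}"
  have B: "k \<in> ?B F \<longleftrightarrow> F = {\<epsilon>. k \<epsilon> \<noteq> 0}" for k F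
    by (auto simp: Suc_le_eq)
  have "((\<lambda>k. x ^ (\<Sum>e\<in>UNIV. marg k (Inl e))) has_sum (x ^ card F / (1 - x) ^ card F)) (?B F)" for F
    unfolding sum_marg_Inl by (rule has_sum_power_supported[OF x]) simp
  then have sum: "((\<lambda>z. x ^ (\<Sum>e\<in>UNIV. marg (snd z) (Inl e))) has_sum (\<Sum>F\<in>faces T. x ^ card F / (1 - x) ^ card F))
      (Sigma (faces T) ?B)"
    by (intro has_sum_finite_Sigma) (simp_all only: snd_conv finite)
  have bij: "bij_betw snd (Sigma (faces T) ?B) {k. \<exists>S\<in>T. supported k S}"
    unfolding bij_betw_def
  proof
    show "inj_on snd (Sigma (faces T) ?B)"
    proof (rule inj_onI)
      fix z z' assume z: "z \<in> Sigma (faces T) ?B" "z' \<in> Sigma (faces T) ?B" and eq: "snd z = snd z'"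
      have "snd y \<in> ?B (fst y)" if "y \<in> Sigma (faces T) ?B" for y
        using that by (cases y) (simp only: mem_Sigma_iff fst_conv snd_conv)
      from this[OF z(1)] this[OF z(2)] have "fst z = fst z'" using eq unfolding B by simp
      then show "z = z'" using eq by (rule prod_eqI)
    qed
    show "snd ` Sigma (faces T) ?B = {k. \<exists>S\<in>T. supported k S}"
    proof (intro set_eqI iffI)
      fix k assume "k \<in> snd ` Sigma (faces T) ?B"
      then obtain F where "F \<in> faces T" "k \<in> ?B F" by auto
      then show "k \<in> {k. \<exists>S\<in>T. supported k S}" by (auto simp: faces_def)
    next
      fix k :: "'e \<times> 'v \<Rightarrow> nat" assume "k \<in> {k. \<exists>S\<in>T. supported k S}"
      then obtain S where S: "S \<in> T" "supported k S" by blast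
      have "{\<epsilon>. k \<epsilon> \<noteq> 0} \<subseteq> S"
      proof
        fix \<epsilon> assume "\<epsilon> \<in> {\<epsilon>. k \<epsilon> \<noteq> 0}"
        then show "\<epsilon> \<in> S" using S(2)[rule_format, of \<epsilon>] by (cases "\<epsilon> \<in> S") simp_all
      qed
      then have "{\<epsilon>. k \<epsilon> \<noteq> 0} \<in> faces T" using S(1) by (auto simp: faces_def)
      then have "({\<epsilon>. k \<epsilon> \<noteq> 0}, k) \<in> Sigma (faces T) ?B" by (simp only: mem_Sigma_iff B)
      then show "k \<in> snd ` Sigma (faces T) ?B" by (rule rev_image_eqI) (simp only: snd_conv)
    qed
  qed
  have "((\<lambda>k. x ^ (\<Sum>e\<in>UNIV. marg k (Inl e))) has_sum (\<Sum>F\<in>faces T. x ^ card F / (1 - x) ^ card F))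
      {k. \<exists>S\<in>T. supported k S}"
    by (rule has_sum_reindex_bij_betw[OF bij, THEN iffD1]) (rule sum)
  then show ?thesis
    unfolding has_sum_reindex_bij_betw[OF bij_betw_triangulation_lattice_cone[OF conn T], symmetric] .
qed

lemma h_vector_eq_sum_faces:
  fixes T :: "'a::finite set set"
  assumes "T \<noteq> {}" and card: "\<And>S. S \<in> T \<Longrightarrow> card S = d + 1" and x: "x \<noteq> 0"
  shows "x ^ (d + 1) * h_vector T d (1 / x) = (\<Sum>F\<in>faces T. x ^ card F * (1 - x) ^ (d + 1 - card F))"
proof -
  define y where "y = 1 / x - 1"
  have le: "card F \<le> d + 1" if "F \<in> faces T" for F
    by (rule card_faces_le[OF that card])
  have "(\<Sum>F\<in>faces T. y ^ (d + 1 - card F)) = (\<Sum>j\<le>d + 1. \<Sum>F\<in>{F\<in>faces T. card F = j}. y ^ (d + 1 - card F))"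
    by (rule sum.group[symmetric]) (use le in auto)
  also have "\<dots> = (\<Sum>j\<le>Suc d. real (card {F\<in>faces T. card F = j}) * y ^ (d + 1 - j))"
    by simp
  also have "\<dots> = real (card {F\<in>faces T. card F = 0}) * y ^ (d + 1)
      + (\<Sum>k\<le>d. real (card {F\<in>faces T. card F = Suc k}) * y ^ (d - k))"
    by (subst sum.atMost_Suc_shift) simp
  \<comment> \<open>The empty set is a face because T is nonempty; it yields the leading term of
    \<open>f_vector\<close>.\<close>
  also have "{F\<in>faces T. card F = 0} = {{}}"
    using assms(1) by (auto simp: faces_def)
  finally have f: "f_vector T d y = (\<Sum>F\<in>faces T. y ^ (d + 1 - card F))"
    by (simp add: f_vector_def num_faces_def faces_def)
  have "x ^ (d + 1) * h_vector T d (1 / x) = (\<Sum>F\<in>faces T. x ^ (d + 1) * y ^ (d + 1 - card F))"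
    unfolding h_vector_def y_def[symmetric] f by (rule sum_distrib_left)
  also have "\<dots> = (\<Sum>F\<in>faces T. x ^ card F * (1 - x) ^ (d + 1 - card F))"
  proof (rule sum.cong[OF refl])
    fix F assume "F \<in> faces T"
    then have "x ^ (d + 1) = x ^ card F * x ^ (d + 1 - card F)"
      using le by (simp add: power_add[symmetric])
    moreover have "x ^ (d + 1 - card F) * y ^ (d + 1 - card F) = (1 - x) ^ (d + 1 - card F)"
      unfolding power_mult_distrib[symmetric] y_def using x by (simp add: right_diff_distrib)
    ultimately show "x ^ (d + 1) * y ^ (d + 1 - card F) = x ^ card F * (1 - x) ^ (d + 1 - card F)"
      by (simp only: mult.assoc)
  qed
  finally show ?thesis .
qed

section \<open>From equal generating functions to equal polynomials\<close>

lemma interior_poly_eq_sum_faces: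
  fixes G :: "('e::{finite,linorder} \<times> 'v::finite) set" and T :: "'a::finite set set"
  assumes le: "\<And>F. F \<in> faces T \<Longrightarrow> card F \<le> N"
    and eq: "\<And>x. 0 < x \<Longrightarrow> x < 1 \<Longrightarrow> interior_poly G x / (1 - x) ^ N = (\<Sum>F\<in>faces T. x ^ card F / (1 - x) ^ card F)"
  shows "interior_poly G x = (\<Sum>F\<in>faces T. x ^ card F * (1 - x) ^ (N - card F))"
proof -
  define P where "P = (\<Sum>f\<in>hypertrees G. monom (1::real) (internal_inactivity G f))"
  define Q where "Q = (\<Sum>F\<in>faces T. monom (1::real) (card F) * [:1, -1:] ^ (N - card F))"
  have P: "poly P x = interior_poly G x" for x
    by (simp add: P_def interior_poly_def poly_sum poly_monom)
  have Q: "poly Q x = (\<Sum>F\<in>faces T. x ^ card F * (1 - x) ^ (N - card F))" for x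
    by (simp add: Q_def poly_sum poly_monom poly_power)
  have "poly (P - Q) x = 0" if x: "x \<in> {0<..<1}" for x
  proof -
    have "interior_poly G x = (1 - x) ^ N * (\<Sum>F\<in>faces T. x ^ card F / (1 - x) ^ card F)"
      using eq[of x] x by (simp add: field_simps)
    also have "\<dots> = (\<Sum>F\<in>faces T. x ^ card F * (1 - x) ^ (N - card F))"
      unfolding sum_distrib_left
    proof (rule sum.cong[OF refl])
      fix F assume "F \<in> faces T"
      then have "(1 - x) ^ N = (1 - x) ^ (N - card F) * (1 - x) ^ card F"
        using le by (simp add: power_add[symmetric])
      then show "(1 - x) ^ N * (x ^ card F / (1 - x) ^ card F) = x ^ card F * (1 - x) ^ (N - card F)"
        using x by simp
    qed
    finally show ?thesis by (simp add: P Q)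
  qed
  \<comment> \<open>The identity is known only on the open unit interval; infinitely many roots make
    the polynomial \<open>P - Q\<close> vanish, which extends it to every x.\<close>
  then have "{0<..<1} \<subseteq> {x. poly (P - Q) x = 0}" by blast
  moreover have "infinite {0<..<(1::real)}" by (simp add: infinite_Ioo)
  ultimately have "P - Q = 0" using poly_roots_finite[of "P - Q"] finite_subset by blast
  then show ?thesis using P[of x] Q[of x] by simp
qed

section \<open>Exchange of the colour classes\<close>

lemma edge_closed_swap: "edge_closed (prod.swap ` G) K \<longleftrightarrow> edge_closed G (case_sum Inr Inl -` K)"
  by (force simp: edge_closed_def)

lemma bg_connected_swap:
  fixes G :: "('e::finite \<times> 'v::finite) set"
  assumes "bg_connected G"
  shows "bg_connected (prod.swap ` G)"
  unfolding bg_connected_iff_edge_closed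
proof (intro allI impI)
  fix K :: "('v + 'e) set"
  assume "edge_closed (prod.swap ` G) K"
  then have "case_sum Inr Inl -` K = {} \<or> case_sum Inr Inl -` K = (UNIV :: ('e + 'v) set)"
    using assms unfolding edge_closed_swap bg_connected_iff_edge_closed by blast
  moreover have "case_sum Inr Inl (case_sum Inr Inl y :: 'e + 'v) = y" for y :: "'v + 'e"
    by (cases y) auto
  ultimately show "K = {} \<or> K = UNIV" by (metis UNIV_I UNIV_eq_I empty_iff equals0I vimage_eq)
qed

lemma lattice_cone_swap:
  fixes G :: "('e::finite \<times> 'v::finite) set"
  assumes "p \<in> lattice_cone G"
  shows "p \<circ> case_sum Inr Inl \<in> lattice_cone (prod.swap ` G)"
proof -
  obtain l where l: "l \<in> flows G (\<lambda>x. real (p x))" using assms by (auto simp: lattice_cone_def)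
  then have m: "marg l x = real (p x)" for x by (auto simp: flows_def)
  have "marg (l \<circ> prod.swap) x = real ((p \<circ> case_sum Inr Inl) x)" for x
    using m[of "case_sum Inr Inl x"] by (cases x) simp_all
  moreover have "(l \<circ> prod.swap) \<epsilon> = 0" if "\<epsilon> \<notin> prod.swap ` G" for \<epsilon>
  proof -
    have "prod.swap \<epsilon> \<notin> G" using that by (metis imageI swap_swap)
    then show ?thesis using l by (simp add: flows_def)
  qed
  moreover have "0 \<le> (l \<circ> prod.swap) \<epsilon>" for \<epsilon> using l by (simp add: flows_def)
  ultimately have "l \<circ> prod.swap \<in> flows (prod.swap ` G) (\<lambda>x. real ((p \<circ> case_sum Inr Inl) x))"
    unfolding flows_def by blast
  then show ?thesis by (auto simp: lattice_cone_def)
qed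

lemma bij_betw_lattice_cone_swap:
  fixes G :: "('e::finite \<times> 'v::finite) set"
  shows "bij_betw (\<lambda>p. p \<circ> case_sum Inr Inl) (lattice_cone G) (lattice_cone (prod.swap ` G))"
proof -
  have inv: "(p \<circ> case_sum Inr Inl) \<circ> case_sum Inr Inl = p" for p :: "'x + 'y \<Rightarrow> nat"
    by (auto simp: fun_eq_iff split: sum.split)
  have inv': "prod.swap ` prod.swap ` G = G" by (simp add: image_image)
  show ?thesis
    by (rule bij_betwI[where g = "\<lambda>p. p \<circ> case_sum Inr Inl"])
      (use lattice_cone_swap[of _ G] lattice_cone_swap[of _ "prod.swap ` G"] inv inv' in auto)
qed

theorem theorem1p1:
  fixes G :: "('e::{finite,linorder} \<times> 'v::{finite,linorder}) set"
    and T :: "('e \<times> 'v) set set"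
  assumes "bg_connected G"
    and "is_triangulation G T"
  shows "\<forall>x::real. x \<noteq> 0 \<longrightarrow>
           interior_poly G x =
             x ^ (CARD('e) + CARD('v) - 1) * h_vector T (nat (aff_dim (root_polytope G))) (1 / x) \<and>
           interior_poly (prod.swap ` G) x =
             x ^ (CARD('e) + CARD('v) - 1) * h_vector T (nat (aff_dim (root_polytope G))) (1 / x)"
proof (intro allI impI)
  fix x :: real assume x: "x \<noteq> 0"
  define d where "d = nat (aff_dim (root_polytope G))"
  have pos: "0 < CARD('e)" "0 < CARD('v)" by simp_all
  \<comment> \<open>The affine dimension \<open>CARD('e) + CARD('v) - 2\<close> is nonnegative
    because both classes are nonempty, so \<open>nat\<close> truncates nothing.\<close>
  have N: "CARD('e) + CARD('v) - 1 = d + 1" "CARD('v) + CARD('e) - 1 = d + 1"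
    using aff_dim_root_polytope[OF assms(1)] pos unfolding d_def by linarith+
  have card: "card S = d + 1" if "S \<in> T" for S
    using is_tree_card[OF is_tree_triangulation[OF assms that]] N(1) by linarith
  have le: "card F \<le> d + 1" if "F \<in> faces T" for F
    by (rule card_faces_le[OF that card])
  have "interior_poly G x = (\<Sum>F\<in>faces T. x ^ card F * (1 - x) ^ (d + 1 - card F))"
  proof (rule interior_poly_eq_sum_faces[OF le])
    fix x :: real assume x: "0 < x" "x < 1"
    show "interior_poly G x / (1 - x) ^ (d + 1) = (\<Sum>F\<in>faces T. x ^ card F / (1 - x) ^ card F)"
      by (rule has_sum_unique[OF lattice_cone_has_sum_interior_poly[OF assms(1) x, unfolded N]
            lattice_cone_has_sum_triangulation[OF assms x]])
  qed
  moreover have "interior_poly (prod.swap ` G) x = (\<Sum>F\<in>faces T. x ^ card F * (1 - x) ^ (d + 1 - card F))"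
  proof (rule interior_poly_eq_sum_faces[OF le])
    fix x :: real assume x: "0 < x" "x < 1"
    have "((\<lambda>p. x ^ (\<Sum>v\<in>UNIV. p (Inl v))) has_sum (interior_poly (prod.swap ` G) x / (1 - x) ^ (d + 1)))
        (lattice_cone (prod.swap ` G))"
      by (rule lattice_cone_has_sum_interior_poly[OF bg_connected_swap[OF assms(1)] x, unfolded N])
    then have "((\<lambda>p. x ^ (\<Sum>v\<in>UNIV. p (Inr v))) has_sum (interior_poly (prod.swap ` G) x / (1 - x) ^ (d + 1)))
        (lattice_cone G)"
      unfolding has_sum_reindex_bij_betw[OF bij_betw_lattice_cone_swap, symmetric] by simp
    \<comment> \<open>Lattice points have equal left and right totals, so the height can be measured
      on either side.\<close>
    then have "((\<lambda>p. x ^ (\<Sum>e\<in>UNIV. p (Inl e))) has_sum (interior_poly (prod.swap ` G) x / (1 - x) ^ (d + 1)))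
        (lattice_cone G)"
      by (rule has_sum_cong[THEN iffD1, rotated]) (simp add: lattice_cone_balanced)
    then show "interior_poly (prod.swap ` G) x / (1 - x) ^ (d + 1) = (\<Sum>F\<in>faces T. x ^ card F / (1 - x) ^ card F)"
      by (rule has_sum_unique) (rule lattice_cone_has_sum_triangulation[OF assms x])
  qed
  moreover have "T \<noteq> {}" by (rule triangulation_nonempty[OF assms])
  ultimately show "interior_poly G x =
             x ^ (CARD('e) + CARD('v) - 1) * h_vector T (nat (aff_dim (root_polytope G))) (1 / x) \<and>
           interior_poly (prod.swap ` G) x =
             x ^ (CARD('e) + CARD('v) - 1) * h_vector T (nat (aff_dim (root_polytope G))) (1 / x)"
    unfolding d_def[symmetric] N using h_vector_eq_sum_faces[OF _ card x] by simp
qed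

end
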